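(* Let $\Lambda$ be a closed approximate subgroup of a locally compact group $G$. There are a locally compact group $H$, an injective group homomorphism $\phi:H\to G$ and an open approximate subgroup $\Xi$ of $H$ such that the restriction $\phi_{|\phi^{-1}(\Lambda)}$ is proper and $\Lambda\subset\phi(\Xi)\subset\Lambda^3$. Furthermore, if $G$ is a Lie group, then $H$ is a Lie group.
   Context: An approximate subgroup of a group $G$ is a subset $\Lambda \subset G$ with $\Lambda=\Lambda^{-1}$, $e\in\Lambda$, and $\Lambda\Lambda\subset F\Lambda$ for some finite $F\subset G$. $\Lambda^3=\{\lambda_1\lambda_2\lambda_3:\lambda_i\in\Lambda\}$. *)

theory Defs
  imports "HOL-Analysis.Analysis" "HOL-Algebra.Coset"
begin

section \<open>Topological groups\<close>

locale topological_group = group G for G (structure) +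
  fixes T :: "'a topology"
  assumes topspace_eq_carrier: "topspace T = carrier G"
    and continuous_mult: "continuous_map (prod_topology T T) T (\<lambda>(x, y). x \<otimes> y)"
    and continuous_inv: "continuous_map T T (\<lambda>x. inv x)"

text \<open>Locally compact groups are Hausdorff by convention.\<close>

locale locally_compact_group = topological_group +
  assumes locally_compact: "locally_compact_space T"
    and Hausdorff: "Hausdorff_space T"

definition approximate_subgroup :: "('a, 'b) monoid_scheme \<Rightarrow> 'a set \<Rightarrow> bool" where
  "approximate_subgroup G L \<longleftrightarrow>
     L \<subseteq> carrier G \<and> L = set_inv\<^bsub>G\<^esub> L \<and> \<one>\<^bsub>G\<^esub> \<in> L \<and>
     (\<exists>F. finite F \<and> F \<subseteq> carrier G \<and> L <#>\<^bsub>G\<^esub> L \<subseteq> F <#>\<^bsub>G\<^esub> L)"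


section \<open>Smooth functions on open subsets of n-space\<close>

text \<open>
  The dimension of a Lie group is not known in advance, so n-space is the topology
  \<open>Euclidean_space n\<close> (sequences vanishing from index \<open>n\<close> on) rather than a type.
\<close>

definition partial_deriv :: "nat \<Rightarrow> ((nat \<Rightarrow> real) \<Rightarrow> real) \<Rightarrow> (nat \<Rightarrow> real) \<Rightarrow> real" where
  "partial_deriv i f x = deriv (\<lambda>t. f (x(i := t))) (x i)"

text \<open>
  The classical \<open>C\<^sup>k\<close> condition by continuous iterated partial derivatives. It is only meaningful
  for \<open>U\<close> open in \<open>Euclidean_space n\<close>; then the values of \<open>f\<close> outside \<open>U\<close> do not matter.
\<close>

fun Ck_on :: "nat \<Rightarrow> nat \<Rightarrow> (nat \<Rightarrow> real) set \<Rightarrow> ((nat \<Rightarrow> real) \<Rightarrow> real) \<Rightarrow> bool" where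
  "Ck_on 0 n U f \<longleftrightarrow> continuous_map (subtopology (Euclidean_space n) U) euclideanreal f"
| "Ck_on (Suc k) n U f \<longleftrightarrow>
     continuous_map (subtopology (Euclidean_space n) U) euclideanreal f \<and>
     (\<forall>i<n. (\<forall>x\<in>U. (\<lambda>t. f (x(i := t))) field_differentiable at (x i)) \<and>
            Ck_on k n U (partial_deriv i f))"

definition smooth_on ::
    "nat \<Rightarrow> nat \<Rightarrow> (nat \<Rightarrow> real) set \<Rightarrow> ((nat \<Rightarrow> real) \<Rightarrow> nat \<Rightarrow> real) \<Rightarrow> bool" where
  "smooth_on m n U g \<longleftrightarrow>
     openin (Euclidean_space m) U \<and> g ` U \<subseteq> topspace (Euclidean_space n) \<and>
     (\<forall>i<n. \<forall>k. Ck_on k m U (\<lambda>x. g x i))"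


section \<open>Smooth manifolds and Lie groups\<close>

type_synonym 'a chart = "'a set \<times> ('a \<Rightarrow> nat \<Rightarrow> real)"

definition is_chart :: "nat \<Rightarrow> 'a topology \<Rightarrow> 'a chart \<Rightarrow> bool" where
  "is_chart n T = (\<lambda>(U, c).
     openin T U \<and> openin (Euclidean_space n) (c ` U) \<and>
     homeomorphic_map (subtopology T U) (subtopology (Euclidean_space n) (c ` U)) c)"

text \<open>The map \<open>f\<close> read in the charts \<open>(U, c)\<close> and \<open>(V, d)\<close> is \<open>d \<circ> f \<circ> c\<inverse>\<close> on \<open>c (U \<inter> f\<inverse> V)\<close>.\<close>

definition smooth_in_charts ::
    "nat \<Rightarrow> nat \<Rightarrow> 'a chart \<Rightarrow> 'b chart \<Rightarrow> ('a \<Rightarrow> 'b) \<Rightarrow> bool" where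
  "smooth_in_charts m n = (\<lambda>(U, c) (V, d) f.
     smooth_on m n (c ` (U \<inter> f -` V)) (\<lambda>x. d (f (inv_into U c x))))"

definition smooth_atlas :: "nat \<Rightarrow> 'a topology \<Rightarrow> 'a chart set \<Rightarrow> bool" where
  "smooth_atlas n T A \<longleftrightarrow>
     (\<forall>p\<in>A. is_chart n T p) \<and> topspace T = (\<Union>(U, c)\<in>A. U) \<and>
     (\<forall>p\<in>A. \<forall>q\<in>A. smooth_in_charts n n p q (\<lambda>x. x))"

definition smooth_map ::
    "nat \<Rightarrow> 'a topology \<Rightarrow> 'a chart set \<Rightarrow> nat \<Rightarrow> 'b topology \<Rightarrow> 'b chart set \<Rightarrow> ('a \<Rightarrow> 'b) \<Rightarrow> bool" where
  "smooth_map m S A n T B f \<longleftrightarrow>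
     continuous_map S T f \<and> (\<forall>p\<in>A. \<forall>q\<in>B. smooth_in_charts m n p q f)"

text \<open>The product chart lists the \<open>m\<close> coordinates of the first factor, then those of the second.\<close>

definition prod_atlas :: "nat \<Rightarrow> 'a chart set \<Rightarrow> 'b chart set \<Rightarrow> ('a \<times> 'b) chart set" where
  "prod_atlas m A B =
     {(U \<times> V, \<lambda>(x, y) i. if i < m then c x i else d y (i - m)) | U c V d. (U, c) \<in> A \<and> (V, d) \<in> B}"

text \<open>
  Manifolds are Hausdorff, but, as usual for locally compact groups, a Lie group may have
  uncountably many components (every discrete group is a Lie group). Second countability
  of the identity component is automatic.
\<close>

locale lie_group = topological_group +
  assumes Hausdorff: "Hausdorff_space T"
    and smooth_structure:
      "\<exists>n A. smooth_atlas n T A \<and>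
         smooth_map (n + n) (prod_topology T T) (prod_atlas n A A) n T A (\<lambda>(x, y). x \<otimes> y) \<and>
         smooth_map n T A n T A (\<lambda>x. inv x)"

end

theory Submission
  imports Defs "HOL-Algebra.Generated_Groups" "Jordan_Normal_Form.Determinant"
begin

text \<open>
  Let \<open>H\<close> be the subgroup generated by \<open>\<Lambda>\<close>, and declare the sets \<open>\<Lambda>\<^sup>2 \<inter> W\<close>, where \<open>W\<close> runs
  through the neighbourhoods of the unit of \<open>G\<close>, to be a base of neighbourhoods of the unit of \<open>H\<close>.
  Every product \<open>\<Lambda>\<^sup>k\<close> is covered by finitely many translates \<open>f \<Lambda>\<close>. These are closed, and the
  ones that contain the unit satisfy \<open>f \<in> \<Lambda>\<close>; so \<open>\<Lambda>\<^sup>k\<close> and \<open>\<Lambda>\<^sup>2\<close> agree near the unit. Hence the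
  base defines a group topology, which on each \<open>\<Lambda>\<^sup>k\<close> is the topology of \<open>G\<close>, and \<open>\<Xi>\<close> can be taken
  as the interior of \<open>\<Lambda>\<^sup>3\<close>.

  If \<open>G\<close> is a Lie group, then near the unit \<open>H\<close> is, in a chart of \<open>G\<close>, a locally closed local
  subgroup \<open>L\<close> of n-space. Instead of the exponential map we use an argument of first order. The
  tangent directions of \<open>L\<close> at the origin form a vector space, because powers of small elements of
  \<open>L\<close> stay in \<open>L\<close>. Since \<open>x\<inverse> y \<in> L\<close> for \<open>x, y \<in> L\<close>, the set \<open>L\<close> is near the origin a graph over
  this space, and by compactness and translation it is a graph over a full neighbourhood. The tangent
  space at \<open>x \<in> L\<close> is the translate of the one at the origin. So the graph map \<open>\<Gamma>\<close> satisfies an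
  equation \<open>\<partial>\<^sub>j \<Gamma> = \<Phi>\<^sub>j \<circ> \<Gamma>\<close> with smooth \<open>\<Phi>\<^sub>j\<close>, and is therefore smooth. The translates of this
  chart make \<open>H\<close> a Lie group.
\<close>

section \<open>Functions of class \<open>C\<^sup>k\<close> on n-space\<close>

text \<open>Covering the powers of \<Lambda> is a question of sides: from \<Lambda>\<Lambda>
  \<subseteq> F\<Lambda> the next product is \<Lambda>F\<Lambda>, with F in the middle. Elements of
  the generated group can be moved out to the left, because \<Lambda>h lies in \<Lambda>\<Lambda>
  for a generator h and the rest is induction on words; hence covers are taken with F inside
  \<open>H\<close>. The set \<Lambda>\<Lambda> need not be closed; compactness near the unit comes
  from a closed finite union of translates that agrees with it there. The third power appears
  because, for x in \<Lambda>, the neighbourhood x\<Lambda>\<Lambda> of x lies in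
  \<Lambda>\<Lambda>\<Lambda>. In the Lie case the obstacle is that \<open>L\<close> is given as a
  closed set only, with no curve in it to differentiate. So tangency means approximability at every
  small scale, the projection to the tangent space is shown to be onto by a nearest point argument,
  and the graph is differentiated by comparing h with a product h u, where u in \<open>L\<close> is
  small and therefore nearly tangent. Orders of smoothness are then gained one at a time from the
  differential equation.\<close>

abbreviation esp :: "nat \<Rightarrow> (nat \<Rightarrow> real) set" where
  "esp n \<equiv> topspace (Euclidean_space n)"

text \<open>The l^1 norm of the first \<open>n\<close> coordinates: bounds on it can be proved one
  coordinate at a time, and it adds up under concatenation of coordinates
  (\<open>nrm_join\<close>).\<close>

definition nrm :: "nat \<Rightarrow> (nat \<Rightarrow> real) \<Rightarrow> real" where
  "nrm n x = (\<Sum>i<n. \<bar>x i\<bar>)"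

lemma nrm_nonneg [simp]: "0 \<le> nrm n x"
  by (simp add: nrm_def sum_nonneg)

lemma nrm_zero [simp]: "nrm n (\<lambda>i. 0) = 0"
  by (simp add: nrm_def)

lemma component_le_nrm: "i < n \<Longrightarrow> \<bar>x i\<bar> \<le> nrm n x"
  unfolding nrm_def by (rule member_le_sum) auto

lemma nrm_le_add:
  "(\<And>i. i < n \<Longrightarrow> \<bar>x i\<bar> \<le> \<bar>y i\<bar> + \<bar>z i\<bar>) \<Longrightarrow> nrm n x \<le> nrm n y + nrm n z"
  unfolding nrm_def sum.distrib [symmetric] by (rule sum_mono) auto

lemma nrm_scale: "nrm n (\<lambda>i. c * x i) = \<bar>c\<bar> * nrm n x"
  by (simp add: nrm_def abs_mult sum_distrib_left)

lemma nrm_triangle: "nrm n (\<lambda>i. x i - z i) \<le> nrm n (\<lambda>i. x i - y i) + nrm n (\<lambda>i. y i - z i)"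
  by (rule nrm_le_add) linarith

lemma esp_eqI: "x \<in> esp n \<Longrightarrow> y \<in> esp n \<Longrightarrow> (\<And>i. i < n \<Longrightarrow> x i = y i) \<Longrightarrow> x = y"
  unfolding topspace_Euclidean_space
  by (rule ext) (metis (mono_tags, lifting) linorder_not_le mem_Collect_eq)

lemma nrm_eq_0: "x \<in> esp n \<Longrightarrow> y \<in> esp n \<Longrightarrow> nrm n (\<lambda>i. x i - y i) = 0 \<Longrightarrow> x = y"
  by (rule esp_eqI) (auto simp: nrm_def sum_nonneg_eq_0_iff)

lemma fun_upd_esp: "x \<in> esp n \<Longrightarrow> i < n \<Longrightarrow> x(i := t) \<in> esp n"
  by (auto simp: topspace_Euclidean_space)

lemma nrm_fun_upd: "i < n \<Longrightarrow> nrm n (\<lambda>j. (x(i := t)) j - x j) = \<bar>t - x i\<bar>"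
  unfolding nrm_def
  by (subst sum.remove [of _ i]) (auto intro!: sum.neutral)

lemma continuous_coordinate: "continuous_map (Euclidean_space n) euclideanreal (\<lambda>x. x i)"
  unfolding Euclidean_space_def
  by (intro continuous_map_from_subtopology continuous_map_product_coordinates) auto

text \<open>Coordinates from \<open>n\<close> on vanish for both points, so only the first
  \<open>n\<close> sides of an open box restrict anything, and the least of finitely many radii is a
  norm radius. This makes the later openness arguments metric.\<close>

lemma openin_esp:
  "openin (Euclidean_space n) U \<longleftrightarrow>
     U \<subseteq> esp n \<and> (\<forall>x\<in>U. \<exists>\<delta>>0. \<forall>y\<in>esp n. nrm n (\<lambda>i. y i - x i) < \<delta> \<longrightarrow> y \<in> U)"
  (is "?l \<longleftrightarrow> ?r")
proof
  assume L: ?l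
  show ?r
  proof (intro conjI ballI)
    show "U \<subseteq> esp n" using L by (rule openin_subset)
    fix x assume x: "x \<in> U"
    obtain V where V: "openin (powertop_real UNIV) V" "U = V \<inter> {x. \<forall>i\<ge>n. x i = 0}"
      using L unfolding Euclidean_space_def openin_subtopology by blast
    obtain X where X: "x \<in> (\<Pi>\<^sub>E i\<in>UNIV. X i)" "\<And>i. open (X i)" "(\<Pi>\<^sub>E i\<in>UNIV. X i) \<subseteq> V"
      using product_topology_open_contains_basis [OF V(1), of x] x V(2) by auto
    have "\<forall>i. \<exists>d>0. \<forall>t. \<bar>t - x i\<bar> < d \<longrightarrow> t \<in> X i"
      using X(1,2) by (metis PiE_mem UNIV_I open_real)
    then obtain d where d: "\<And>i. d i > (0::real)" "\<And>i t. \<bar>t - x i\<bar> < d i \<Longrightarrow> t \<in> X i"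
      by metis
    \<comment> \<open>The inserted 1 keeps the set nonempty when \<open>n = 0\<close>.\<close>
    define \<delta> where "\<delta> = Min (insert 1 (d ` {..<n}))"
    have "\<delta> > 0" unfolding \<delta>_def using d(1) by auto
    moreover have "y \<in> U" if y: "y \<in> esp n" "nrm n (\<lambda>i. y i - x i) < \<delta>" for y
    proof -
      have "y i \<in> X i" for i
      proof (cases "i < n")
        case True
        have "\<bar>y i - x i\<bar> < \<delta>" using component_le_nrm [OF True, of "\<lambda>i. y i - x i"] y(2) by simp
        also have "\<delta> \<le> d i" unfolding \<delta>_def using True by (intro Min_le) auto
        finally show ?thesis by (rule d(2))
      next
        case False
        then have "y i = 0" "x i = 0" using y(1) x V(2) by (auto simp: topspace_Euclidean_space)
        then show ?thesis using d(1)[of i] d(2)[of "y i" i] by simp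
      qed
      then show ?thesis using X(3) V(2) y(1) by (auto simp: topspace_Euclidean_space PiE_def)
    qed
    ultimately show "\<exists>\<delta>>0. \<forall>y\<in>esp n. nrm n (\<lambda>i. y i - x i) < \<delta> \<longrightarrow> y \<in> U" by blast
  qed
next
  assume R: ?r
  show ?l
  proof (subst openin_subopen, intro ballI)
    fix x assume x: "x \<in> U"
    with R obtain \<delta> where \<delta>: "\<delta> > 0" "\<And>y. y \<in> esp n \<Longrightarrow> nrm n (\<lambda>i. y i - x i) < \<delta> \<Longrightarrow> y \<in> U" by metis
    have "continuous_map (Euclidean_space n) euclideanreal (\<lambda>y. nrm n (\<lambda>i. y i - x i))"
      unfolding nrm_def by (intro continuous_intros continuous_coordinate) auto
    then have "openin (Euclidean_space n) {y \<in> esp n. nrm n (\<lambda>i. y i - x i) \<in> {..<\<delta>}}"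
      by (rule openin_continuous_map_preimage) auto
    then show "\<exists>T. openin (Euclidean_space n) T \<and> x \<in> T \<and> T \<subseteq> U"
      using x R \<delta> by (intro exI[of _ "{y \<in> esp n. nrm n (\<lambda>i. y i - x i) \<in> {..<\<delta>}}"]) auto
  qed
qed

lemma openin_esp_ball:
  assumes "openin (Euclidean_space n) U" "x \<in> U"
  obtains \<delta> where "\<delta> > 0" "\<And>y. y \<in> esp n \<Longrightarrow> nrm n (\<lambda>i. y i - x i) < \<delta> \<Longrightarrow> y \<in> U"
  using assms unfolding openin_esp by metis

lemma openin_nrm_ball: "openin (Euclidean_space n) {y \<in> esp n. nrm n (\<lambda>i. y i - x i) < r}"
  unfolding openin_esp
proof safe
  fix y assume y: "y \<in> esp n" "nrm n (\<lambda>i. y i - x i) < r"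
  have "\<forall>z\<in>esp n. nrm n (\<lambda>i. z i - y i) < r - nrm n (\<lambda>i. y i - x i) \<longrightarrow>
      z \<in> {y \<in> esp n. nrm n (\<lambda>i. y i - x i) < r}"
  proof (intro ballI impI)
    fix z assume "z \<in> esp n" "nrm n (\<lambda>i. z i - y i) < r - nrm n (\<lambda>i. y i - x i)"
    then show "z \<in> {y \<in> esp n. nrm n (\<lambda>i. y i - x i) < r}"
      using nrm_triangle [of n z x y] by simp
  qed
  then show "\<exists>\<delta>>0. \<forall>z\<in>esp n. nrm n (\<lambda>i. z i - y i) < \<delta> \<longrightarrow> z \<in> {y \<in> esp n. nrm n (\<lambda>i. y i - x i) < r}"
    using y(2) by (intro exI[of _ "r - nrm n (\<lambda>i. y i - x i)"]) auto
qed

lemma nrm_ball_open: "openin (Euclidean_space n) {x \<in> esp n. nrm n x < \<rho>}"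
  using openin_nrm_ball [of n "\<lambda>_. 0" \<rho>] by simp

section \<open>Locality of the classes C^k and their closure under arithmetic\<close>

lemma Ck_on_0_iff:
  assumes U: "openin (Euclidean_space n) U"
  shows "Ck_on 0 n U f \<longleftrightarrow>
    (\<forall>x\<in>U. \<forall>\<epsilon>>0. \<exists>\<delta>>0. \<forall>y\<in>esp n. nrm n (\<lambda>i. y i - x i) < \<delta> \<longrightarrow> y \<in> U \<and> \<bar>f y - f x\<bar> < \<epsilon>)"
  (is "?l \<longleftrightarrow> ?r")
proof
  assume ?l
  then have L: "continuous_map (subtopology (Euclidean_space n) U) euclideanreal f" by simp
  show ?r
  proof (intro ballI allI impI)
    fix x \<epsilon> assume x: "x \<in> U" "\<epsilon> > (0::real)"
    have "openin (subtopology (Euclidean_space n) U) {y \<in> topspace (subtopology (Euclidean_space n) U). f y \<in> ball (f x) \<epsilon>}"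
      by (rule openin_continuous_map_preimage [OF L]) auto
    then have "openin (Euclidean_space n) {y \<in> U. f y \<in> ball (f x) \<epsilon>}"
      using U openin_subset [OF U] by (simp add: openin_open_subtopology Int_absorb1)
    moreover have "x \<in> {y \<in> U. f y \<in> ball (f x) \<epsilon>}" using x by simp
    ultimately obtain \<delta> where \<delta>: "\<delta> > 0"
      "\<And>y. y \<in> esp n \<Longrightarrow> nrm n (\<lambda>i. y i - x i) < \<delta> \<Longrightarrow> y \<in> {y \<in> U. f y \<in> ball (f x) \<epsilon>}"
      by (rule openin_esp_ball) blast
    then show "\<exists>\<delta>>0. \<forall>y\<in>esp n. nrm n (\<lambda>i. y i - x i) < \<delta> \<longrightarrow> y \<in> U \<and> \<bar>f y - f x\<bar> < \<epsilon>"
      by (intro exI[of _ \<delta>]) (auto simp: dist_real_def abs_minus_commute)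
  qed
next
  assume R: ?r
  have "openin (Euclidean_space n) {y \<in> U. f y \<in> V}" if V: "open V" for V
    unfolding openin_esp
  proof (intro conjI ballI)
    fix x assume x: "x \<in> {y \<in> U. f y \<in> V}"
    then obtain \<epsilon> where \<epsilon>: "\<epsilon> > 0" "\<And>t. \<bar>t - f x\<bar> < \<epsilon> \<Longrightarrow> t \<in> V"
      using V unfolding open_real by blast
    from x have "x \<in> U" by simp
    with R \<epsilon>(1) obtain \<delta> where "\<delta> > 0"
      "\<forall>y\<in>esp n. nrm n (\<lambda>i. y i - x i) < \<delta> \<longrightarrow> y \<in> U \<and> \<bar>f y - f x\<bar> < \<epsilon>" by blast
    then show "\<exists>\<delta>>0. \<forall>y\<in>esp n. nrm n (\<lambda>i. y i - x i) < \<delta> \<longrightarrow> y \<in> {y \<in> U. f y \<in> V}"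
      using \<epsilon>(2) by (intro exI[of _ \<delta>]) simp
  qed (use openin_subset [OF U] in auto)
  then show ?l
    using openin_subset [OF U] U
    by (auto simp: continuous_map_def openin_open_subtopology Int_absorb1)
qed

lemma Ck_on_Suc_imp: "Ck_on (Suc k) n U f \<Longrightarrow> Ck_on k n U f"
  by (induction k arbitrary: f) auto

lemma Ck_on_mono: "Ck_on k n U f \<Longrightarrow> j \<le> k \<Longrightarrow> Ck_on j n U f"
  by (induction k) (metis le_0_eq, metis Ck_on_Suc_imp le_Suc_eq)

lemma Ck_on_imp_0: "Ck_on k n U f \<Longrightarrow> Ck_on 0 n U f"
  by (rule Ck_on_mono) auto

lemma Ck_on_ball:
  assumes "openin (Euclidean_space n) U" "Ck_on k n U f" "x \<in> U" "\<epsilon> > 0"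
  obtains \<delta> where "\<delta> > 0"
    "\<And>y. y \<in> esp n \<Longrightarrow> nrm n (\<lambda>i. y i - x i) < \<delta> \<Longrightarrow> y \<in> U \<and> \<bar>f y - f x\<bar> < \<epsilon>"
proof -
  have "\<exists>\<delta>>0. \<forall>y\<in>esp n. nrm n (\<lambda>i. y i - x i) < \<delta> \<longrightarrow> y \<in> U \<and> \<bar>f y - f x\<bar> < \<epsilon>"
    using Ck_on_imp_0 [OF assms(2)] assms(3,4) unfolding Ck_on_0_iff [OF assms(1)] by simp
  then show thesis using that by blast
qed

text \<open>A function is arbitrary outside \<open>U\<close>, so statements about its partial
  derivatives at a point of \<open>U\<close> are transferred along this filter, on which the
  coordinate line has not yet left \<open>U\<close>.\<close>

lemma eventually_fun_upd:
  assumes U: "openin (Euclidean_space n) U" and x: "x \<in> U" and i: "i < n"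
  shows "\<forall>\<^sub>F t in nhds (x i). x(i := t) \<in> U"
proof -
  obtain \<delta> where \<delta>: "\<delta> > 0" "\<And>y. y \<in> esp n \<Longrightarrow> nrm n (\<lambda>i. y i - x i) < \<delta> \<Longrightarrow> y \<in> U"
    using openin_esp_ball [OF U x] by blast
  have "x \<in> esp n" using openin_subset [OF U] x by auto
  then show ?thesis
    unfolding eventually_nhds_metric
    using \<delta> i by (intro exI[of _ \<delta>]) (auto simp: dist_real_def nrm_fun_upd fun_upd_esp simp del: fun_upd_apply)
qed

text \<open>At a point of the open set \<open>U\<close> a derivative sees only values in
  \<open>U\<close>. So the partial derivatives of \<open>f\<close> and \<open>g\<close> agree on
  \<open>U\<close>, though perhaps not elsewhere, and the induction hypothesis applies to
  them.\<close>

lemma Ck_on_cong: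
  assumes U: "openin (Euclidean_space n) U" and eq: "\<And>x. x \<in> U \<Longrightarrow> f x = g x"
  shows "Ck_on k n U f \<longleftrightarrow> Ck_on k n U g"
proof -
  have "Ck_on k n U g" if "Ck_on k n U f" "\<And>x. x \<in> U \<Longrightarrow> f x = g x" for f g
    using that
  proof (induction k arbitrary: f g)
    case 0
    then show ?case by (auto elim: continuous_map_eq)
  next
    case (Suc k)
    have ev: "\<forall>\<^sub>F t in nhds (x i). f (x(i := t)) = g (x(i := t))" if "x \<in> U" "i < n" for x i
      using eventually_fun_upd [OF U that] by eventually_elim (use Suc in auto)
    have fd: "(\<lambda>t. g (x(i := t))) field_differentiable at (x i)"
      if "x \<in> U" "i < n" for x i
    proof -
      have "(\<lambda>t. f (x(i := t))) field_differentiable at (x i)" using Suc(2) that by simp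
      then show ?thesis
        unfolding field_differentiable_def using DERIV_cong_ev [OF refl ev [OF that] refl] by blast
    qed
    have "partial_deriv i f x = partial_deriv i g x" if "x \<in> U" "i < n" for x i
      unfolding partial_deriv_def by (rule deriv_cong_ev [OF ev [OF that] refl])
    then have "Ck_on k n U (partial_deriv i g)" if "i < n" for i
      using Suc.IH [of "partial_deriv i f" "partial_deriv i g"] Suc(2) that by auto
    moreover have "continuous_map (subtopology (Euclidean_space n) U) euclideanreal g"
      using Suc(2,3) by (auto elim: continuous_map_eq)
    ultimately show ?case using fd by auto
  qed
  then show ?thesis using eq by metis
qed

lemma Ck_on_subset:
  assumes "Ck_on k n U f" "W \<subseteq> U"
  shows "Ck_on k n W f"
  using assms by (induction k arbitrary: f) (auto intro: continuous_map_from_subtopology_mono)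

text \<open>Charts contain the image of a map only piece by piece; this glues the pieces, as in
  \<open>smooth_into_chart\<close>.\<close>

lemma Ck_on_locally:
  assumes "openin (Euclidean_space n) U"
    and "\<And>x. x \<in> U \<Longrightarrow> \<exists>W. openin (Euclidean_space n) W \<and> x \<in> W \<and> Ck_on k n W f"
  shows "Ck_on k n U f"
  using assms(2)
proof (induction k arbitrary: f)
  case 0
  show ?case unfolding Ck_on_0_iff [OF assms(1)]
  proof (intro ballI allI impI)
    fix x and \<epsilon> :: real assume x: "x \<in> U" "\<epsilon> > 0"
    obtain W where W: "openin (Euclidean_space n) W" "x \<in> W" "Ck_on 0 n W f" using 0 x by blast
    obtain d where d: "d > 0" "\<And>y. y \<in> esp n \<Longrightarrow> nrm n (\<lambda>i. y i - x i) < d \<Longrightarrow> y \<in> W \<and> \<bar>f y - f x\<bar> < \<epsilon>"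
      using Ck_on_ball [OF W(1,3,2) x(2)] by blast
    obtain e where "e > 0" "\<And>y. y \<in> esp n \<Longrightarrow> nrm n (\<lambda>i. y i - x i) < e \<Longrightarrow> y \<in> U"
      using openin_esp_ball [OF assms(1) x(1)] by blast
    with d show "\<exists>\<delta>>0. \<forall>y\<in>esp n. nrm n (\<lambda>i. y i - x i) < \<delta> \<longrightarrow> y \<in> U \<and> \<bar>f y - f x\<bar> < \<epsilon>"
      by (intro exI[of _ "min d e"]) auto
  qed
next
  case (Suc k)
  have W: "\<exists>W. openin (Euclidean_space n) W \<and> x \<in> W \<and> Ck_on (Suc k) n W f" if "x \<in> U" for x
    by (rule Suc.prems [OF that])
  have "Ck_on k n U f" by (rule Suc.IH) (meson W Ck_on_Suc_imp)
  then have "Ck_on 0 n U f" by (rule Ck_on_imp_0)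
  moreover have "Ck_on k n U (partial_deriv i f)" if i: "i < n" for i
  proof (rule Suc.IH)
    fix x assume "x \<in> U"
    with W obtain W where "openin (Euclidean_space n) W" "x \<in> W" "Ck_on (Suc k) n W f" by blast
    then show "\<exists>W. openin (Euclidean_space n) W \<and> x \<in> W \<and> Ck_on k n W (partial_deriv i f)"
      using i by (intro exI[of _ W]) simp
  qed
  moreover have "(\<lambda>t. f (x(i := t))) field_differentiable at (x i)" if x: "x \<in> U" "i < n" for x i
  proof -
    from W [OF x(1)] obtain W where "x \<in> W" "Ck_on (Suc k) n W f" by blast
    then show ?thesis using x(2) by simp
  qed
  ultimately show ?case by simp
qed

text \<open>The entry to the closure properties below: a formula \<open>D\<close> for the partial
  derivatives on \<open>U\<close> suffices, so the arbitrary values of \<open>deriv\<close>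
  elsewhere never enter.\<close>

lemma Ck_on_SucI:
  assumes U: "openin (Euclidean_space n) U"
    and c: "Ck_on 0 n U f"
    and d: "\<And>x i. x \<in> U \<Longrightarrow> i < n \<Longrightarrow> ((\<lambda>t. f (x(i := t))) has_real_derivative D i x) (at (x i))"
    and D: "\<And>i. i < n \<Longrightarrow> Ck_on k n U (D i)"
  shows "Ck_on (Suc k) n U f"
proof -
  have "partial_deriv i f x = D i x" if "x \<in> U" "i < n" for x i
    unfolding partial_deriv_def using d [OF that] by (rule DERIV_imp_deriv)
  then have "Ck_on k n U (partial_deriv i f)" if "i < n" for i
    using Ck_on_cong [OF U, of "partial_deriv i f" "D i" k] D that by blast
  then show ?thesis using c d by (auto simp: field_differentiable_def)
qed

lemma Ck_on_partial:
  assumes "Ck_on (Suc k) n U f" "x \<in> U" "i < n"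
  shows "((\<lambda>t. f (x(i := t))) has_real_derivative partial_deriv i f x) (at (x i))"
  using assms unfolding partial_deriv_def by (auto simp: field_differentiable_derivI)

lemma Ck_on_partial_Ck: "Ck_on (Suc k) n U f \<Longrightarrow> i < n \<Longrightarrow> Ck_on k n U (partial_deriv i f)"
  by simp

lemma Ck_on_const: "openin (Euclidean_space n) U \<Longrightarrow> Ck_on k n U (\<lambda>x. c)"
  by (induction k arbitrary: c) (simp, rule Ck_on_SucI [where D = "\<lambda>_ _. 0"], auto)

lemma Ck_on_coordinate:
  assumes "openin (Euclidean_space n) U"
  shows "Ck_on k n U (\<lambda>x. x j)"
proof -
  have *: "Ck_on 0 n U (\<lambda>x. x j)"
    by (simp add: continuous_map_from_subtopology continuous_coordinate)
  show ?thesis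
  proof (cases k)
    case (Suc k')
    show ?thesis unfolding Suc
      by (rule Ck_on_SucI [where D = "\<lambda>i _. if i = j then 1 else 0", OF assms *])
        (auto simp: Ck_on_const [OF assms])
  qed (use * in simp)
qed

lemma Ck_on_add:
  assumes "openin (Euclidean_space n) U" "Ck_on k n U f" "Ck_on k n U g"
  shows "Ck_on k n U (\<lambda>x. f x + g x)"
  using assms(2,3)
proof (induction k arbitrary: f g)
  case (Suc k)
  show ?case
  proof (rule Ck_on_SucI [OF assms(1)])
    show "Ck_on 0 n U (\<lambda>x. f x + g x)" using Suc(2,3) by (auto intro!: continuous_intros)
    show "((\<lambda>t. f (x(i := t)) + g (x(i := t))) has_real_derivative
        partial_deriv i f x + partial_deriv i g x) (at (x i))" if "x \<in> U" "i < n" for x i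
      using Ck_on_partial [OF Suc(2) that] Ck_on_partial [OF Suc(3) that] by (rule DERIV_add)
  qed (use Suc in auto)
qed (auto intro!: continuous_intros)

lemma Ck_on_mult:
  assumes "openin (Euclidean_space n) U" "Ck_on k n U f" "Ck_on k n U g"
  shows "Ck_on k n U (\<lambda>x. f x * g x)"
  using assms(2,3)
proof (induction k arbitrary: f g)
  case (Suc k)
  show ?case
  proof (rule Ck_on_SucI [OF assms(1)])
    show "Ck_on 0 n U (\<lambda>x. f x * g x)" using Suc(2,3) by (auto intro!: continuous_intros)
    show "((\<lambda>t. f (x(i := t)) * g (x(i := t))) has_real_derivative
        partial_deriv i f x * g x + partial_deriv i g x * f x) (at (x i))" if "x \<in> U" "i < n" for x i
      using DERIV_mult [OF Ck_on_partial [OF Suc(2) that] Ck_on_partial [OF Suc(3) that]]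
      by (simp add: fun_upd_def)
    show "Ck_on k n U (\<lambda>x. partial_deriv i f x * g x + partial_deriv i g x * f x)" if "i < n" for i
      by (intro Ck_on_add assms(1) Suc.IH Ck_on_partial_Ck [OF Suc(2) that]
          Ck_on_partial_Ck [OF Suc(3) that] Ck_on_Suc_imp [OF Suc(2)] Ck_on_Suc_imp [OF Suc(3)])
  qed
qed (auto intro!: continuous_intros)

lemma Ck_on_diff:
  assumes "openin (Euclidean_space n) U" "Ck_on k n U f" "Ck_on k n U g"
  shows "Ck_on k n U (\<lambda>x. f x - g x)"
  using Ck_on_add [OF assms(1,2) Ck_on_mult [OF assms(1) Ck_on_const [OF assms(1), of _ "-1"] assms(3)]]
  by simp

lemma Ck_on_sum:
  assumes "openin (Euclidean_space n) U" "\<And>j. j \<in> J \<Longrightarrow> Ck_on k n U (f j)"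
  shows "Ck_on k n U (\<lambda>x. \<Sum>j\<in>J. f j x)"
  using assms(2)
  by (induction J rule: infinite_finite_induct) (auto intro!: Ck_on_add Ck_on_const assms(1))

lemma Ck_on_prod:
  assumes "openin (Euclidean_space n) U" "\<And>j. j \<in> J \<Longrightarrow> Ck_on k n U (f j)"
  shows "Ck_on k n U (\<lambda>x. \<Prod>j\<in>J. f j x)"
  using assms(2)
  by (induction J rule: infinite_finite_induct) (auto intro!: Ck_on_mult Ck_on_const assms(1))

text \<open>The derivative of 1/f is a product of a derivative of f with powers of 1/f, and 1/f is
  of class C^k by the induction hypothesis.\<close>

lemma Ck_on_inverse:
  assumes "openin (Euclidean_space n) U" "Ck_on k n U f" "\<And>x. x \<in> U \<Longrightarrow> f x \<noteq> 0"
  shows "Ck_on k n U (\<lambda>x. inverse (f x))"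
  using assms(2)
proof (induction k)
  case 0
  then show ?case using assms(3) by (auto intro!: continuous_map_real_inverse)
next
  case (Suc k)
  show ?case
  proof (rule Ck_on_SucI [OF assms(1)])
    show "Ck_on 0 n U (\<lambda>x. inverse (f x))" using Suc(2) assms(3) by (auto intro!: continuous_map_real_inverse)
    show "((\<lambda>t. inverse (f (x(i := t)))) has_real_derivative
        - 1 * (partial_deriv i f x * (inverse (f x) * inverse (f x)))) (at (x i))" if "x \<in> U" "i < n" for x i
      using DERIV_inverse_fun [OF Ck_on_partial [OF Suc(2) that]] assms(3) [OF that(1)]
      by (simp add: fun_upd_def power2_eq_square)
    show "Ck_on k n U (\<lambda>x. - 1 * (partial_deriv i f x * (inverse (f x) * inverse (f x))))" if "i < n" for i
      by (intro Ck_on_mult Ck_on_const assms(1) Suc.IH Ck_on_partial_Ck [OF Suc(2) that]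
          Ck_on_Suc_imp [OF Suc(2)])
  qed
qed

text \<open>Move one coordinate at a time and use the mean value theorem.\<close>

lemma C1_strict:
  assumes U: "openin (Euclidean_space n) U" and f: "Ck_on 1 n U f" and x: "x \<in> U" and \<epsilon>: "\<epsilon> > 0"
  obtains \<delta> where "\<delta> > 0"
    "\<And>y z. \<lbrakk>y \<in> esp n; z \<in> esp n; nrm n (\<lambda>i. y i - x i) < \<delta>; nrm n (\<lambda>i. z i - x i) < \<delta>\<rbrakk> \<Longrightarrow>
       \<bar>f y - f z - (\<Sum>j<n. partial_deriv j f x * (y j - z j))\<bar> \<le> \<epsilon> * nrm n (\<lambda>i. y i - z i)"
proof -
  have f': "Ck_on (Suc 0) n U f" using f by simp
  have "\<exists>d>0. \<forall>y\<in>esp n. nrm n (\<lambda>i. y i - x i) < d \<longrightarrow>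
      y \<in> U \<and> \<bar>partial_deriv j f y - partial_deriv j f x\<bar> < \<epsilon>" if "j < n" for j
    using Ck_on_ball [OF U Ck_on_partial_Ck [OF f' that] x \<epsilon>] by metis
  then obtain d where d: "\<And>j. j < n \<Longrightarrow> d j > 0"
    "\<And>j y. \<lbrakk>j < n; y \<in> esp n; nrm n (\<lambda>i. y i - x i) < d j\<rbrakk> \<Longrightarrow>
      y \<in> U \<and> \<bar>partial_deriv j f y - partial_deriv j f x\<bar> < \<epsilon>"
    by metis
  \<comment> \<open>Halved, because the intermediate points are only known to be within the sum of
    the two distances from \<open>x\<close>.\<close>
  define \<delta> where "\<delta> = Min (insert 1 (d ` {..<n})) / 2"
  have dmin: "2 * \<delta> \<le> d j" if "j < n" for j unfolding \<delta>_def using that by auto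
  show thesis
  proof (rule that)
    show "\<delta> > 0" unfolding \<delta>_def using d(1) by auto
    fix y z
    assume yz: "y \<in> esp n" "z \<in> esp n" "nrm n (\<lambda>i. y i - x i) < \<delta>" "nrm n (\<lambda>i. z i - x i) < \<delta>"
    define w where "w = (\<lambda>k i. if i < k then y i else z i)"
    have w0: "w 0 = z" unfolding w_def by simp
    have "w n \<in> esp n" using yz(1,2) by (auto simp: w_def topspace_Euclidean_space)
    then have wn: "w n = y" by (rule esp_eqI) (use yz(1) in \<open>auto simp: w_def\<close>)
    have step: "\<bar>f (w (Suc k)) - f (w k) - partial_deriv k f x * (y k - z k)\<bar> \<le> \<epsilon> * \<bar>y k - z k\<bar>"
      if k: "k < n" for k
    proof -
      let ?D = "partial_deriv k f"
      let ?S = "closed_segment (z k) (y k)"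
      \<comment> \<open>Subtracting the linear part turns the mean value bound into a bound by the
        oscillation of the partial derivative, which is below \<epsilon> near
        \<open>x\<close>.\<close>
      let ?g = "\<lambda>t. f ((w k)(k := t)) - ?D x * t"
      have pt: "(w k)(k := t) \<in> U \<and> \<bar>?D ((w k)(k := t)) - ?D x\<bar> < \<epsilon>" if t: "t \<in> ?S" for t
      proof (rule d(2) [OF k])
        show "(w k)(k := t) \<in> esp n" using yz(1,2) k by (auto simp: w_def topspace_Euclidean_space)
        have "\<bar>((w k)(k := t)) i - x i\<bar> \<le> \<bar>y i - x i\<bar> + \<bar>z i - x i\<bar>" for i
          using t by (auto simp: w_def closed_segment_eq_real_ivl split: if_splits)
        then have "nrm n (\<lambda>i. ((w k)(k := t)) i - x i) \<le> nrm n (\<lambda>i. y i - x i) + nrm n (\<lambda>i. z i - x i)"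
          by (intro nrm_le_add) auto
        then show "nrm n (\<lambda>i. ((w k)(k := t)) i - x i) < d k" using yz(3,4) dmin [OF k] by linarith
      qed
      have "norm (?g (y k) - ?g (z k)) \<le> \<epsilon> * norm (y k - z k)"
      proof (rule field_differentiable_bound [where S = ?S])
        fix t assume t: "t \<in> ?S"
        have "((\<lambda>s. f (((w k)(k := t))(k := s))) has_real_derivative ?D ((w k)(k := t))) (at (((w k)(k := t)) k))"
          by (rule Ck_on_partial [OF f' _ k]) (use pt [OF t] in auto)
        then have "((\<lambda>s. f ((w k)(k := s))) has_real_derivative ?D ((w k)(k := t))) (at t)" by simp
        then have "(?g has_real_derivative ?D ((w k)(k := t)) - ?D x) (at t)"
          by (auto intro!: derivative_eq_intros)
        then show "(?g has_field_derivative ?D ((w k)(k := t)) - ?D x) (at t within ?S)"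
          by (rule has_field_derivative_at_within)
        show "norm (?D ((w k)(k := t)) - ?D x) \<le> \<epsilon>" using pt [OF t] by auto
      qed auto
      moreover have "(w k)(k := y k) = w (Suc k)" "(w k)(k := z k) = w k"
        by (auto simp: w_def)
      ultimately show ?thesis by (simp add: algebra_simps)
    qed
    have "f y - f z = (\<Sum>k<n. f (w (Suc k)) - f (w k))"
      using sum_lessThan_telescope [of "\<lambda>k. f (w k)" n] w0 wn by simp
    then have "\<bar>f y - f z - (\<Sum>j<n. partial_deriv j f x * (y j - z j))\<bar> =
        \<bar>\<Sum>k<n. f (w (Suc k)) - f (w k) - partial_deriv k f x * (y k - z k)\<bar>"
      by (simp add: sum_subtractf)
    also have "\<dots> \<le> (\<Sum>k<n. \<epsilon> * \<bar>y k - z k\<bar>)"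
      by (rule order_trans [OF sum_abs sum_mono]) (use step in auto)
    finally show "\<bar>f y - f z - (\<Sum>j<n. partial_deriv j f x * (y j - z j))\<bar> \<le> \<epsilon> * nrm n (\<lambda>i. y i - z i)"
      by (simp add: nrm_def sum_distrib_left)
  qed
qed

text \<open>Meant for the remainder \<open>R\<close> of a first-order expansion: differentiability
  becomes the estimate that \<open>R\<close> is small compared with \<open>t - a\<close>.\<close>

lemma has_real_derivative_0I:
  fixes R :: "real \<Rightarrow> real"
  assumes "R a = 0" "\<And>\<epsilon>. \<epsilon> > 0 \<Longrightarrow> \<forall>\<^sub>F t in nhds a. \<bar>R t\<bar> \<le> \<epsilon> * \<bar>t - a\<bar>"
  shows "(R has_real_derivative 0) (at a)"
  unfolding has_field_derivative_iff
proof (rule tendstoI)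
  fix \<epsilon> :: real assume "\<epsilon> > 0"
  then have "\<forall>\<^sub>F t in at a. \<bar>R t\<bar> \<le> \<epsilon> / 2 * \<bar>t - a\<bar>"
    using assms(2) [of "\<epsilon> / 2"] eventually_nhds_conv_at by fastforce
  moreover have "\<forall>\<^sub>F t in at a. t \<noteq> a" by (simp add: eventually_neq_at_within)
  ultimately show "\<forall>\<^sub>F t in at a. dist ((R t - R a) / (t - a)) 0 < \<epsilon>"
  proof eventually_elim
    case (elim t)
    then have "\<bar>R t\<bar> / \<bar>t - a\<bar> \<le> \<epsilon> / 2" by (simp add: divide_le_eq)
    then have "\<bar>R t\<bar> / \<bar>t - a\<bar> < \<epsilon>" using \<open>\<epsilon> > 0\<close> by linarith
    then show ?case using assms(1) by simp
  qed
qed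

section \<open>The chain rule\<close>

lemma DERIV_transfer_ev:
  fixes f :: "real \<Rightarrow> real"
  shows "(g has_real_derivative D) (at a) \<Longrightarrow> \<forall>\<^sub>F t in nhds a. f t = g t \<Longrightarrow> (f has_real_derivative D) (at a)"
  by (simp add: DERIV_cong_ev)

text \<open>\<open>C1_strict\<close> at \<open>\<gamma> a\<close> leaves an error that is small
  compared with the norm of \<open>\<gamma> t - \<gamma> a\<close>, and this norm is at most a
  constant times \<open>\<bar>t - a\<bar>\<close> because every coordinate of \<gamma> is
  differentiable at \<open>a\<close>.\<close>

lemma chain_rule_curve:
  assumes U: "openin (Euclidean_space n) U" and f: "Ck_on 1 n U f"
    and \<gamma>: "\<And>t. \<gamma> t \<in> esp n" "\<gamma> a \<in> U"
    and d: "\<And>j. j < n \<Longrightarrow> ((\<lambda>t. \<gamma> t j) has_real_derivative D j) (at a)"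
  shows "((\<lambda>t. f (\<gamma> t)) has_real_derivative (\<Sum>j<n. partial_deriv j f (\<gamma> a) * D j)) (at a)"
proof -
  let ?S = "\<lambda>t. \<Sum>j<n. partial_deriv j f (\<gamma> a) * (\<gamma> t j - \<gamma> a j)"
  let ?R = "\<lambda>t. f (\<gamma> t) - f (\<gamma> a) - ?S t"
  \<comment> \<open>Exceeds by 1 the limit of the summed difference quotients, and hence bounds them
    near \<open>a\<close>.\<close>
  define K where "K = 1 + (\<Sum>j<n. \<bar>D j\<bar>)"
  have K: "K > 0" unfolding K_def by (simp add: add_pos_nonneg sum_nonneg)
  have "((\<lambda>t. \<Sum>j<n. \<bar>(\<gamma> t j - \<gamma> a j) / (t - a)\<bar>) \<longlongrightarrow> (\<Sum>j<n. \<bar>D j\<bar>)) (at a)"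
    by (intro tendsto_sum tendsto_rabs) (use d in \<open>auto simp: has_field_derivative_iff\<close>)
  then have "\<forall>\<^sub>F t in at a. (\<Sum>j<n. \<bar>(\<gamma> t j - \<gamma> a j) / (t - a)\<bar>) < K"
    by (rule order_tendstoD) (simp add: K_def)
  moreover have "\<forall>\<^sub>F t in at a. t \<noteq> a" by (simp add: eventually_neq_at_within)
  ultimately have "\<forall>\<^sub>F t in at a. nrm n (\<lambda>j. \<gamma> t j - \<gamma> a j) \<le> K * \<bar>t - a\<bar>"
  proof eventually_elim
    case (elim t)
    then have "nrm n (\<lambda>j. \<gamma> t j - \<gamma> a j) / \<bar>t - a\<bar> < K"
      by (simp add: nrm_def sum_divide_distrib)
    then show ?case using elim(2) by (simp add: divide_less_eq)
  qed
  then have lip: "\<forall>\<^sub>F t in nhds a. nrm n (\<lambda>j. \<gamma> t j - \<gamma> a j) \<le> K * \<bar>t - a\<bar>"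
    by (simp add: eventually_nhds_conv_at)
  have "(?R has_real_derivative 0) (at a)"
  proof (rule has_real_derivative_0I)
    fix \<epsilon> :: real assume \<epsilon>: "\<epsilon> > 0"
    with K have "\<epsilon> / K > 0" by simp
    obtain \<delta> where \<delta>: "\<delta> > 0" "\<And>y z. \<lbrakk>y \<in> esp n; z \<in> esp n; nrm n (\<lambda>i. y i - \<gamma> a i) < \<delta>; nrm n (\<lambda>i. z i - \<gamma> a i) < \<delta>\<rbrakk> \<Longrightarrow>
       \<bar>f y - f z - (\<Sum>j<n. partial_deriv j f (\<gamma> a) * (y j - z j))\<bar> \<le> \<epsilon> / K * nrm n (\<lambda>i. y i - z i)"
      using C1_strict [OF U f \<gamma>(2) \<open>\<epsilon> / K > 0\<close>] by blast
    have "\<forall>\<^sub>F t in nhds a. \<bar>t - a\<bar> < \<delta> / K"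
      unfolding eventually_nhds_metric using \<delta>(1) K
      by (intro exI[of _ "\<delta> / K"]) (auto simp: dist_real_def)
    with lip show "\<forall>\<^sub>F t in nhds a. \<bar>?R t\<bar> \<le> \<epsilon> * \<bar>t - a\<bar>"
    proof eventually_elim
      case (elim t)
      then have "nrm n (\<lambda>j. \<gamma> t j - \<gamma> a j) < \<delta>" using K by (simp add: field_simps)
      then have "\<bar>?R t\<bar> \<le> \<epsilon> / K * nrm n (\<lambda>j. \<gamma> t j - \<gamma> a j)" using \<delta> \<gamma>(1) by simp
      also have "\<dots> \<le> \<epsilon> / K * (K * \<bar>t - a\<bar>)" using elim(1) \<open>\<epsilon> / K > 0\<close> by (intro mult_left_mono) auto
      finally show ?case using K by simp
    qed
  qed simp
  moreover have "(?S has_real_derivative (\<Sum>j<n. partial_deriv j f (\<gamma> a) * D j)) (at a)"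
    using d by (auto intro!: derivative_eq_intros sum.cong)
  ultimately have "((\<lambda>t. (?R t + ?S t) + f (\<gamma> a)) has_real_derivative
      (0 + (\<Sum>j<n. partial_deriv j f (\<gamma> a) * D j)) + 0) (at a)"
    by (intro DERIV_add DERIV_const)
  then show ?thesis by simp
qed

lemma continuous_map_into_esp:
  assumes "\<And>x. x \<in> topspace X \<Longrightarrow> g x \<in> esp n"
    and "\<And>j. j < n \<Longrightarrow> continuous_map X euclideanreal (\<lambda>x. g x j)"
  shows "continuous_map X (Euclidean_space n) g"
proof (rule continuous_map_eq)
  show "continuous_map X (Euclidean_space n) (\<lambda>x i. if i < n then g x i else 0)"
    using assms(2) by (simp add: continuous_map_componentwise_Euclidean_space)
  show "(\<lambda>i. if i < n then g x i else 0) = g x" if "x \<in> topspace X" for x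
    using assms(1) [OF that] by (auto simp: topspace_Euclidean_space)
qed

text \<open>By the chain rule the derivative is a sum of products of
  \<open>partial_deriv j f\<close>, taken at \<open>g x\<close>, with derivatives of the components
  of \<open>g\<close>. The first factor is of class C^k by the induction hypothesis for
  \<open>partial_deriv j f\<close>, which is why \<open>f\<close> varies in the induction.\<close>

lemma Ck_on_compose:
  assumes W: "openin (Euclidean_space m) W" and V: "openin (Euclidean_space n) V"
    and g: "\<And>x. x \<in> W \<Longrightarrow> g x \<in> V" "\<And>j. j < n \<Longrightarrow> Ck_on k m W (\<lambda>x. g x j)"
    and f: "Ck_on k n V f"
  shows "Ck_on k m W (\<lambda>x. f (g x))"
  using g(2) f
proof (induction k arbitrary: f)
  case 0
  have "continuous_map (subtopology (Euclidean_space m) W) (Euclidean_space n) g"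
    using 0(1) g(1) openin_subset [OF V] openin_subset [OF W]
    by (intro continuous_map_into_esp) auto
  then have "continuous_map (subtopology (Euclidean_space m) W) (subtopology (Euclidean_space n) V) g"
    using g(1) by (auto simp: continuous_map_in_subtopology)
  from continuous_map_compose [OF this, of euclideanreal f] 0(2) show ?case by (simp add: o_def)
next
  case (Suc k)
  have c: "Ck_on k m W (\<lambda>x. f (g x))"
    by (rule Suc.IH [OF Ck_on_Suc_imp [OF Suc.prems(1)] Ck_on_Suc_imp [OF Suc.prems(2)]])
  show ?case
  proof (rule Ck_on_SucI [OF W])
    show "Ck_on 0 m W (\<lambda>x. f (g x))" using c by (rule Ck_on_imp_0)
    show "Ck_on k m W (\<lambda>x. \<Sum>j<n. partial_deriv j f (g x) * partial_deriv i (\<lambda>x. g x j) x)"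
      if "i < m" for i
    proof (intro Ck_on_sum Ck_on_mult W)
      fix j assume "j \<in> {..<n}"
      then have j: "j < n" by simp
      show "Ck_on k m W (\<lambda>x. partial_deriv j f (g x))"
        using Ck_on_partial_Ck [OF Suc.prems(2) j] Ck_on_Suc_imp [OF Suc.prems(1)]
        by (rule Suc.IH [rotated])
      show "Ck_on k m W (partial_deriv i (\<lambda>x. g x j))"
        by (rule Ck_on_partial_Ck [OF Suc.prems(1) [OF j] that])
    qed
    fix x i assume x: "x \<in> W" "i < m"
    obtain t0 where t0: "t0 = x i" by blast
    \<comment> \<open>Outside \<open>W\<close> the function \<open>g\<close> may leave n-space.\<close>
    define \<gamma> where "\<gamma> = (\<lambda>t. if x(i := t) \<in> W then g (x(i := t)) else g x)"
    have ev: "\<forall>\<^sub>F t in nhds (x i). \<gamma> t = g (x(i := t))"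
      using eventually_fun_upd [OF W x] by eventually_elim (simp add: \<gamma>_def)
    have \<gamma>x: "\<gamma> (x i) = g x" using x by (simp add: \<gamma>_def)
    have "((\<lambda>t. f (\<gamma> t)) has_real_derivative (\<Sum>j<n. partial_deriv j f (\<gamma> (x i)) * partial_deriv i (\<lambda>x. g x j) x)) (at (x i))"
    proof (rule chain_rule_curve [OF V])
      show "Ck_on 1 n V f" by (rule Ck_on_mono [OF Suc.prems(2)]) simp
      show "\<gamma> t \<in> esp n" for t using g(1) openin_subset [OF V] x by (auto simp: \<gamma>_def)
      show "\<gamma> (x i) \<in> V" using g(1) x \<gamma>x by auto
      fix j assume j: "j < n"
      have "((\<lambda>t. g (x(i := t)) j) has_real_derivative partial_deriv i (\<lambda>x. g x j) x) (at (x i))"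
        by (rule Ck_on_partial [OF Suc.prems(1) [OF j] x])
      moreover have "\<forall>\<^sub>F t in nhds (x i). \<gamma> t j = g (x(i := t)) j" using ev by eventually_elim auto
      ultimately show "((\<lambda>t. \<gamma> t j) has_real_derivative partial_deriv i (\<lambda>x. g x j) x) (at (x i))"
        by (rule DERIV_transfer_ev)
    qed
    moreover have "\<forall>\<^sub>F t in nhds (x i). f (g (x(i := t))) = f (\<gamma> t)" using ev by eventually_elim auto
    ultimately show "((\<lambda>t. f (g (x(i := t)))) has_real_derivative
        (\<Sum>j<n. partial_deriv j f (g x) * partial_deriv i (\<lambda>x. g x j) x)) (at (x i))"
      unfolding \<gamma>x by (rule DERIV_transfer_ev)
  qed
qed

section \<open>Tangent space of a closed local subgroup\<close>

lemma nrm_le_add3: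
  "(\<And>i. i < n \<Longrightarrow> \<bar>x i\<bar> \<le> \<bar>y i\<bar> + \<bar>z i\<bar> + \<bar>w i\<bar>) \<Longrightarrow> nrm n x \<le> nrm n y + nrm n z + nrm n w"
  unfolding nrm_def sum.distrib [symmetric] by (rule sum_mono) auto

lemma abs_add3: "\<bar>a + b + c\<bar> \<le> \<bar>a\<bar> + \<bar>b\<bar> + \<bar>c\<bar>" for a :: real
  by linarith

lemma esp_zero [simp]: "(\<lambda>_. 0) \<in> esp n"
  by (simp add: topspace_Euclidean_space)

lemma esp_scale: "x \<in> esp n \<Longrightarrow> (\<lambda>i. a * x i) \<in> esp n"
  by (simp add: topspace_Euclidean_space)

lemma esp_diff: "x \<in> esp n \<Longrightarrow> y \<in> esp n \<Longrightarrow> (\<lambda>i. x i - y i) \<in> esp n"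
  by (simp add: topspace_Euclidean_space)

lemma esp_add: "x \<in> esp n \<Longrightarrow> y \<in> esp n \<Longrightarrow> (\<lambda>i. x i + y i) \<in> esp n"
  by (simp add: topspace_Euclidean_space)

text \<open>
  A minimal set \<open>J\<close> of coordinates that determines the elements of \<open>T\<close> is a set of coordinates
  in which \<open>T\<close> is a graph.
\<close>

lemma subspace_coordinates:
  assumes T: "T \<subseteq> esp n"
    and add: "\<And>v w. v \<in> T \<Longrightarrow> w \<in> T \<Longrightarrow> (\<lambda>i. v i + w i) \<in> T"
    and scale: "\<And>c v. v \<in> T \<Longrightarrow> (\<lambda>i. c * v i) \<in> T"
  obtains J e where "J \<subseteq> {..<n}" "\<And>j. j \<in> J \<Longrightarrow> e j \<in> T"
    "\<And>j k. j \<in> J \<Longrightarrow> k \<in> J \<Longrightarrow> e j k = (if j = k then 1 else 0)"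
    "\<And>v. v \<in> T \<Longrightarrow> v = (\<lambda>i. \<Sum>j\<in>J. v j * e j i)"
proof -
  let ?P = "\<lambda>J. J \<subseteq> {..<n} \<and> (\<forall>v\<in>T. (\<forall>j\<in>J. v j = 0) \<longrightarrow> v = (\<lambda>_. 0))"
  have "?P {..<n}"
  proof (intro conjI ballI impI order_refl)
    fix v assume "v \<in> T" "\<forall>j\<in>{..<n}. v j = 0"
    then show "v = (\<lambda>_. 0)" using T by (intro esp_eqI [of v n]) auto
  qed
  then obtain J where J: "?P J" and min: "\<And>J'. ?P J' \<Longrightarrow> card J \<le> card J'"
    using ex_has_least_nat [of ?P "{..<n}" card] by blast
  have fin: "finite J" using J finite_subset by blast
  have "\<exists>e. e \<in> T \<and> e j = 1 \<and> (\<forall>k\<in>J - {j}. e k = 0)" if j: "j \<in> J" for j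
  proof -
    have "card (J - {j}) < card J" using j fin by (meson card_Diff1_less)
    \<comment> \<open>Minimality: the coordinates other than \<open>j\<close> no longer determine
      the elements of \<open>T\<close>, which yields a nonzero vector visible only at
      \<open>j\<close>.\<close>
    then have "\<not> ?P (J - {j})" using min by (meson not_le)
    then obtain v where v: "v \<in> T" "\<forall>k\<in>J - {j}. v k = 0" "v \<noteq> (\<lambda>_. 0)" using J by blast
    then have "v j \<noteq> 0" using J by blast
    then show ?thesis using scale [OF v(1), of "1 / v j"] v(2)
      by (intro exI[of _ "\<lambda>i. 1 / v j * v i"]) auto
  qed
  then obtain e where e: "\<And>j. j \<in> J \<Longrightarrow> e j \<in> T \<and> e j j = 1 \<and> (\<forall>k\<in>J - {j}. e j k = 0)" by metis
  have e1: "e j k = (if j = k then 1 else 0)" if "j \<in> J" "k \<in> J" for j k using e that by auto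
  \<comment> \<open>Nonempty sums only, since \<open>T\<close> is not assumed to contain 0.\<close>
  have comb: "(\<lambda>i. \<Sum>j\<in>I. c j * e j i) \<in> T" if "I \<subseteq> J" "I \<noteq> {}" for I c
    using finite_subset [OF that(1) fin] that(2,1)
  proof (induction I rule: finite_ne_induct)
    case (singleton x) then show ?case using scale e by simp
  next
    case (insert x F)
    then show ?case using add [OF scale [of "e x" "c x"] insert.IH] e by simp
  qed
  show thesis
  proof (rule that)
    show "J \<subseteq> {..<n}" using J by blast
    show "e j \<in> T" if "j \<in> J" for j using e that by blast
    show "e j k = (if j = k then 1 else 0)" if "j \<in> J" "k \<in> J" for j k by (rule e1 [OF that])
    show "v = (\<lambda>i. \<Sum>j\<in>J. v j * e j i)" if v: "v \<in> T" for v
    proof (cases "J = {}")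
      case True
      then show ?thesis using J v by auto
    next
      case False
      \<comment> \<open>The difference between \<open>v\<close> and its expected expansion vanishes
        on \<open>J\<close>, hence everywhere.\<close>
      define u where "u = (\<lambda>i. v i + (\<Sum>j\<in>J. (- v j) * e j i))"
      have "u \<in> T" unfolding u_def by (rule add [OF v comb [OF order_refl False]])
      moreover have "u k = 0" if "k \<in> J" for k
      proof -
        have "(\<Sum>j\<in>J. (- v j) * e j k) = (\<Sum>j\<in>J. if j = k then - v k else 0)"
          by (rule sum.cong) (auto simp: e1 that)
        then show ?thesis using that fin by (simp add: u_def)
      qed
      ultimately have u0: "u = (\<lambda>_. 0)" using J by simp
      show ?thesis
      proof (rule ext)
        fix i
        have "v i + (\<Sum>j\<in>J. (- v j) * e j i) = 0" using fun_cong [OF u0, of i] unfolding u_def .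
        then show "v i = (\<Sum>j\<in>J. v j * e j i)" unfolding mult_minus_left sum_negf by linarith
      qed
    qed
  qed
qed

text \<open>
  A chart around the unit turns a locally closed local subgroup into a compact set \<open>L\<close>, closed near
  the origin under the product \<open>m\<close> and the division \<open>q x y = x\<inverse> y\<close>.
\<close>

locale local_subgroup =
  fixes n :: nat and m q :: "(nat \<Rightarrow> real) \<Rightarrow> (nat \<Rightarrow> real) \<Rightarrow> nat \<Rightarrow> real"
    and L :: "(nat \<Rightarrow> real) set" and r :: real
  assumes r: "r > 0"
    and m_zero: "\<lbrakk>x \<in> esp n; nrm n x < r\<rbrakk> \<Longrightarrow> m x (\<lambda>_. 0) = x"
    and m_strict: "\<epsilon> > 0 \<Longrightarrow> \<exists>\<delta>>0. \<forall>x\<in>esp n. \<forall>y\<in>esp n. \<forall>x'\<in>esp n. \<forall>y'\<in>esp n.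
        nrm n x < \<delta> \<longrightarrow> nrm n y < \<delta> \<longrightarrow> nrm n x' < \<delta> \<longrightarrow> nrm n y' < \<delta> \<longrightarrow>
        nrm n (\<lambda>i. m x y i - m x' y' i - (x i - x' i) - (y i - y' i)) \<le>
          \<epsilon> * (nrm n (\<lambda>i. x i - x' i) + nrm n (\<lambda>i. y i - y' i))"
    and q_esp: "\<lbrakk>x \<in> esp n; y \<in> esp n; nrm n x < r; nrm n y < r\<rbrakk> \<Longrightarrow> q x y \<in> esp n \<and> m x (q x y) = y"
    and q_small: "\<epsilon> > 0 \<Longrightarrow> \<exists>\<delta>>0. \<forall>x\<in>esp n. \<forall>y\<in>esp n.
        nrm n x < \<delta> \<longrightarrow> nrm n y < \<delta> \<longrightarrow> nrm n (q x y) < \<epsilon>"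
    and L_compact: "compactin (Euclidean_space n) L"
    and L_zero: "(\<lambda>_. 0) \<in> L"
    and L_m: "\<lbrakk>x \<in> L; y \<in> L; nrm n x < r; nrm n y < r\<rbrakk> \<Longrightarrow> m x y \<in> L"
    and L_q: "\<lbrakk>x \<in> L; y \<in> L; nrm n x < r; nrm n y < r\<rbrakk> \<Longrightarrow> q x y \<in> L"
begin

lemma L_esp: "x \<in> L \<Longrightarrow> x \<in> esp n"
  using compactin_subset_topspace [OF L_compact] by blast

lemma m_strict':
  assumes "\<epsilon> > 0"
  obtains \<delta> where "\<delta> > 0" "\<delta> \<le> r"
    "\<And>x y y'. \<lbrakk>x \<in> esp n; y \<in> esp n; y' \<in> esp n; nrm n x < \<delta>; nrm n y < \<delta>; nrm n y' < \<delta>\<rbrakk> \<Longrightarrow>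
       nrm n (\<lambda>i. m x y i - m x y' i - (y i - y' i)) \<le> \<epsilon> * nrm n (\<lambda>i. y i - y' i)"
proof -
  obtain d where d: "d > 0" "\<forall>x\<in>esp n. \<forall>y\<in>esp n. \<forall>x'\<in>esp n. \<forall>y'\<in>esp n.
        nrm n x < d \<longrightarrow> nrm n y < d \<longrightarrow> nrm n x' < d \<longrightarrow> nrm n y' < d \<longrightarrow>
        nrm n (\<lambda>i. m x y i - m x' y' i - (x i - x' i) - (y i - y' i)) \<le>
          \<epsilon> * (nrm n (\<lambda>i. x i - x' i) + nrm n (\<lambda>i. y i - y' i))"
    using m_strict [OF assms] by blast
  show thesis
  proof (rule that [of "min d r"])
    fix x y y' assume h: "x \<in> esp n" "y \<in> esp n" "y' \<in> esp n" "nrm n x < min d r" "nrm n y < min d r" "nrm n y' < min d r"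
    then have "nrm n (\<lambda>i. m x y i - m x y' i - (x i - x i) - (y i - y' i)) \<le>
          \<epsilon> * (nrm n (\<lambda>i. x i - x i) + nrm n (\<lambda>i. y i - y' i))"
      using d(2) by (meson min_less_iff_conj)
    then show "nrm n (\<lambda>i. m x y i - m x y' i - (y i - y' i)) \<le> \<epsilon> * nrm n (\<lambda>i. y i - y' i)"
      by simp
  qed (use d r in auto)
qed

text \<open>Comparing \<open>m x y\<close> with \<open>m x 0 = x\<close> makes the error small
  relative to \<open>y\<close> alone, uniformly in \<open>x\<close>. Products of many small factors
  are controlled this way.\<close>

lemma m_near_add:
  assumes "\<epsilon> > 0"
  obtains \<delta> where "\<delta> > 0" "\<delta> \<le> r"
    "\<And>x y. \<lbrakk>x \<in> esp n; y \<in> esp n; nrm n x < \<delta>; nrm n y < \<delta>\<rbrakk> \<Longrightarrow>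
       nrm n (\<lambda>i. m x y i - x i - y i) \<le> \<epsilon> * nrm n y"
proof -
  obtain \<delta> where \<delta>: "\<delta> > 0" "\<delta> \<le> r"
    "\<And>x y y'. \<lbrakk>x \<in> esp n; y \<in> esp n; y' \<in> esp n; nrm n x < \<delta>; nrm n y < \<delta>; nrm n y' < \<delta>\<rbrakk> \<Longrightarrow>
       nrm n (\<lambda>i. m x y i - m x y' i - (y i - y' i)) \<le> \<epsilon> * nrm n (\<lambda>i. y i - y' i)"
    using m_strict' [OF assms] by blast
  show thesis
  proof (rule that [OF \<delta>(1,2)])
    fix x y assume h: "x \<in> esp n" "y \<in> esp n" "nrm n x < \<delta>" "nrm n y < \<delta>"
    then show "nrm n (\<lambda>i. m x y i - x i - y i) \<le> \<epsilon> * nrm n y"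
      using \<delta>(3) [OF h(1,2) esp_zero h(3,4)] \<delta>(1,2) m_zero [OF h(1)] by simp
  qed
qed

text \<open>Of \<open>q\<close> only continuity at the origin is assumed; its first-order behaviour
  follows by solving \<open>m x (q x y) = y\<close> with \<open>m_near_add\<close>.\<close>

lemma q_near_diff:
  assumes "\<epsilon> > 0"
  obtains \<delta> where "\<delta> > 0" "\<delta> \<le> r"
    "\<And>x y. \<lbrakk>x \<in> esp n; y \<in> esp n; nrm n x < \<delta>; nrm n y < \<delta>\<rbrakk> \<Longrightarrow>
       nrm n (\<lambda>i. y i - x i - q x y i) \<le> \<epsilon> * nrm n (\<lambda>i. y i - x i) \<and>
       nrm n (q x y) \<le> 2 * nrm n (\<lambda>i. y i - x i)"
proof -
  \<comment> \<open>The bound 1/2 absorbs \<open>u\<close> in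
    \<open>nrm n u \<le> nrm n (y - x) + \<eta> * nrm n u\<close>, which costs a factor 2; the bound
    \<epsilon>/2 pays for that factor.\<close>
  define \<eta> where "\<eta> = min (\<epsilon> / 2) (1 / 2)"
  have \<eta>: "\<eta> > 0" "\<eta> \<le> \<epsilon> / 2" "\<eta> \<le> 1 / 2" unfolding \<eta>_def using assms by auto
  obtain d where d: "d > 0" "d \<le> r"
    "\<And>x y. \<lbrakk>x \<in> esp n; y \<in> esp n; nrm n x < d; nrm n y < d\<rbrakk> \<Longrightarrow>
       nrm n (\<lambda>i. m x y i - x i - y i) \<le> \<eta> * nrm n y"
    using m_near_add [OF \<eta>(1)] by blast
  obtain d' where d': "d' > 0" "\<forall>x\<in>esp n. \<forall>y\<in>esp n. nrm n x < d' \<longrightarrow> nrm n y < d' \<longrightarrow> nrm n (q x y) < d"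
    using q_small [OF d(1)] by blast
  show thesis
  proof (rule that [of "min d d'"])
    fix x y assume h: "x \<in> esp n" "y \<in> esp n" "nrm n x < min d d'" "nrm n y < min d d'"
    define u where "u = q x y"
    have u: "u \<in> esp n" "m x u = y" "nrm n u < d"
      using q_esp [OF h(1,2)] h d d' by (auto simp: u_def)
    have 1: "nrm n (\<lambda>i. y i - x i - u i) \<le> \<eta> * nrm n u"
      using d(3) [OF h(1) u(1)] h u by simp
    have "nrm n u \<le> nrm n (\<lambda>i. y i - x i - u i) + nrm n (\<lambda>i. y i - x i)"
      by (rule nrm_le_add) linarith
    moreover have "\<eta> * nrm n u \<le> 1 / 2 * nrm n u" using \<eta> by (intro mult_right_mono) auto
    ultimately have 2: "nrm n u \<le> 2 * nrm n (\<lambda>i. y i - x i)" using 1 by simp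
    have "\<eta> * nrm n u \<le> (\<epsilon> / 2) * (2 * nrm n (\<lambda>i. y i - x i))"
      using \<eta> 2 assms by (intro mult_mono) auto
    with 1 2 show "nrm n (\<lambda>i. y i - x i - q x y i) \<le> \<epsilon> * nrm n (\<lambda>i. y i - x i) \<and>
       nrm n (q x y) \<le> 2 * nrm n (\<lambda>i. y i - x i)" unfolding u_def by simp
  qed (use d d' in auto)
qed

text \<open>The element \<open>g\<close> is the k-th power of \<open>h\<close>. Each further factor
  adds \<open>h\<close> up to an error \<open>\<eta> * nrm n h\<close>, so the errors sum to a
  relative error. With \<eta> \<le> 1 the powers have norm at most
  \<open>2 * (real k * nrm n h)\<close>, which keeps them where \<open>m\<close> does not leave
  \<open>L\<close>.\<close>

lemma powers:
  assumes "\<epsilon> > 0"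
  obtains \<delta> where "\<delta> > 0"
    "\<And>h k. \<lbrakk>h \<in> L; 2 * (real k * nrm n h) < \<delta>\<rbrakk> \<Longrightarrow>
       \<exists>g\<in>L. nrm n (\<lambda>i. g i - real k * h i) \<le> \<epsilon> * (real k * nrm n h)"
proof -
  define \<eta> where "\<eta> = min \<epsilon> 1"
  have \<eta>: "\<eta> > 0" "\<eta> \<le> \<epsilon>" "\<eta> \<le> 1" unfolding \<eta>_def using assms by auto
  obtain d where d: "d > 0" "d \<le> r"
    "\<And>x y. \<lbrakk>x \<in> esp n; y \<in> esp n; nrm n x < d; nrm n y < d\<rbrakk> \<Longrightarrow>
       nrm n (\<lambda>i. m x y i - x i - y i) \<le> \<eta> * nrm n y"
    using m_near_add [OF \<eta>(1)] by blast
  have *: "\<exists>g\<in>L. nrm n (\<lambda>i. g i - real k * h i) \<le> \<eta> * (real k * nrm n h)"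
    if h: "h \<in> L" and "2 * (real k * nrm n h) < d" for h k
    using that(2)
  proof (induction k)
    case 0
    then show ?case using L_zero by (intro bexI[of _ "\<lambda>_. 0"]) auto
  next
    case (Suc k)
    have hn: "0 \<le> nrm n h" "0 \<le> real k * nrm n h" by auto
    have sm: "2 * (real k * nrm n h) < d" "nrm n h < d"
    proof -
      have "2 * (nrm n h + real k * nrm n h) < d"
        using Suc.prems by (simp only: of_nat_Suc distrib_right mult_1_left)
      moreover obtain t where t: "t = real k * nrm n h" by blast
      ultimately show "2 * (real k * nrm n h) < d" "nrm n h < d"
        using hn unfolding t [symmetric] by (simp_all only: distrib_left)
    qed
    then obtain g where g: "g \<in> L" "nrm n (\<lambda>i. g i - real k * h i) \<le> \<eta> * (real k * nrm n h)"
      using Suc.IH by blast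
    have "nrm n g \<le> nrm n (\<lambda>i. g i - real k * h i) + nrm n (\<lambda>i. real k * h i)"
      by (rule nrm_le_add) linarith
    also have "\<dots> \<le> 2 * (real k * nrm n h)"
      using g(2) mult_right_mono [OF \<eta>(3) hn(2)] by (simp add: nrm_scale)
    finally have gd: "nrm n g < d" using sm by linarith
    have "nrm n (\<lambda>i. m g h i - real (Suc k) * h i) \<le>
        nrm n (\<lambda>i. m g h i - g i - h i) + nrm n (\<lambda>i. g i - real k * h i)"
      by (rule nrm_le_add) (simp add: algebra_simps)
    also have "\<dots> \<le> \<eta> * nrm n h + \<eta> * (real k * nrm n h)"
      using d(3) [OF L_esp [OF g(1)] L_esp [OF h] gd sm(2)] g(2) by simp
    finally show ?case using L_m [OF g(1) h] gd sm(2) d(2)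
      by (intro bexI[of _ "m g h"]) (auto simp: algebra_simps)
  qed
  show thesis
  proof (rule that [OF d(1)])
    fix h k assume "h \<in> L" "2 * (real k * nrm n h) < d"
    then obtain g where "g \<in> L" "nrm n (\<lambda>i. g i - real k * h i) \<le> \<eta> * (real k * nrm n h)"
      using * by blast
    moreover have "\<eta> * (real k * nrm n h) \<le> \<epsilon> * (real k * nrm n h)"
      using \<eta> by (intro mult_right_mono) auto
    ultimately show "\<exists>g\<in>L. nrm n (\<lambda>i. g i - real k * h i) \<le> \<epsilon> * (real k * nrm n h)"
      using order_trans by blast
  qed
qed

text \<open>Approximation is required for all small \<open>s\<close>, not along a sequence: two
  tangent vectors can then be approximated at the same scale and their approximants multiplied. That
  limits of directions of \<open>L\<close> qualify is the content of
  \<open>limit_direction_tangent\<close>.\<close>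

definition tangent :: "(nat \<Rightarrow> real) set" where
  "tangent = {v \<in> esp n. \<forall>\<epsilon>>0. \<exists>s0>0. \<forall>s. 0 < s \<longrightarrow> s < s0 \<longrightarrow> (\<exists>h\<in>L. nrm n (\<lambda>i. h i - s * v i) \<le> \<epsilon> * s)}"

lemma tangentD:
  assumes "v \<in> tangent" "\<epsilon> > 0"
  obtains s0 where "s0 > 0" "\<And>s. 0 < s \<Longrightarrow> s < s0 \<Longrightarrow> \<exists>h\<in>L. nrm n (\<lambda>i. h i - s * v i) \<le> \<epsilon> * s"
  using assms unfolding tangent_def by blast

lemma tangent_esp: "v \<in> tangent \<Longrightarrow> v \<in> esp n"
  by (simp add: tangent_def)

lemma nrm_le_of_close:
  assumes "nrm n (\<lambda>i. h i - s * v i) \<le> \<epsilon> * s" "0 < s"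
  shows "nrm n h \<le> s * (nrm n v + \<epsilon>)"
proof -
  have "nrm n h \<le> nrm n (\<lambda>i. h i - s * v i) + nrm n (\<lambda>i. s * v i)"
    by (rule nrm_le_add) linarith
  then show ?thesis using assms by (simp add: nrm_scale algebra_simps)
qed

text \<open>Multiplication is addition to first order, so the product of elements of
  \<open>L\<close> near \<open>s v\<close> and \<open>s w\<close> is near
  \<open>s (v + w)\<close>.\<close>

lemma tangent_add:
  assumes v: "v \<in> tangent" and w: "w \<in> tangent"
  shows "(\<lambda>i. v i + w i) \<in> tangent"
  unfolding tangent_def
proof (intro CollectI conjI allI impI)
  show "(\<lambda>i. v i + w i) \<in> esp n" using v w tangent_esp esp_add by blast
  fix \<epsilon> :: real assume \<epsilon>: "\<epsilon> > 0"
  \<comment> \<open>\<open>s * K\<close> bounds the norms of both approximants; thus the error of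
    the product is at most \<open>\<epsilon> / 3 * s\<close>, like the two approximation
    errors.\<close>
  define K where "K = nrm n v + nrm n w + 2 * \<epsilon> + 1"
  have K: "K > 0" "nrm n v + \<epsilon> / 3 \<le> K" "nrm n w + \<epsilon> / 3 \<le> K"
    unfolding K_def using \<epsilon> nrm_nonneg [of n v] nrm_nonneg [of n w] by linarith+
  have eK: "\<epsilon> / (3 * K) > 0" using \<epsilon> K by simp
  obtain d where d: "d > 0" "d \<le> r"
    "\<And>x y. \<lbrakk>x \<in> esp n; y \<in> esp n; nrm n x < d; nrm n y < d\<rbrakk> \<Longrightarrow>
       nrm n (\<lambda>i. m x y i - x i - y i) \<le> (\<epsilon> / (3 * K)) * nrm n y"
    using m_near_add [OF eK] by blast
  have e3: "\<epsilon> / 3 > 0" using \<epsilon> by simp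
  obtain a where a: "a > 0" "\<And>s. 0 < s \<Longrightarrow> s < a \<Longrightarrow> \<exists>h\<in>L. nrm n (\<lambda>i. h i - s * v i) \<le> \<epsilon> / 3 * s"
    using tangentD [OF v e3] by blast
  obtain b where b: "b > 0" "\<And>s. 0 < s \<Longrightarrow> s < b \<Longrightarrow> \<exists>h\<in>L. nrm n (\<lambda>i. h i - s * w i) \<le> \<epsilon> / 3 * s"
    using tangentD [OF w e3] by blast
  show "\<exists>s0>0. \<forall>s. 0 < s \<longrightarrow> s < s0 \<longrightarrow> (\<exists>h\<in>L. nrm n (\<lambda>i. h i - s * (v i + w i)) \<le> \<epsilon> * s)"
  proof (intro exI[of _ "min (min a b) (d / K)"] conjI allI impI)
    show "0 < min (min a b) (d / K)" using a b d K by simp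
    fix s assume s: "0 < s" "s < min (min a b) (d / K)"
    then have sK: "s * K < d" using K by (simp add: field_simps)
    obtain g where g: "g \<in> L" "nrm n (\<lambda>i. g i - s * v i) \<le> \<epsilon> / 3 * s" using a s by fastforce
    obtain h where h: "h \<in> L" "nrm n (\<lambda>i. h i - s * w i) \<le> \<epsilon> / 3 * s" using b s by fastforce
    have gn: "nrm n g \<le> s * K" using nrm_le_of_close [OF g(2) s(1)] K(2) s(1)
      by (meson mult_left_mono less_imp_le order_trans)
    have hn: "nrm n h \<le> s * K" using nrm_le_of_close [OF h(2) s(1)] K(3) s(1)
      by (meson mult_left_mono less_imp_le order_trans)
    have "nrm n (\<lambda>i. m g h i - g i - h i) \<le> (\<epsilon> / (3 * K)) * nrm n h"
      using d(3) [OF L_esp [OF g(1)] L_esp [OF h(1)]] gn hn sK by simp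
    also have "\<dots> \<le> (\<epsilon> / (3 * K)) * (s * K)" using hn \<epsilon> K by (intro mult_left_mono) auto
    also have "\<dots> = \<epsilon> / 3 * s" using K by (simp add: field_simps)
    finally have 1: "nrm n (\<lambda>i. m g h i - g i - h i) \<le> \<epsilon> / 3 * s" .
    have "nrm n (\<lambda>i. m g h i - s * (v i + w i)) \<le>
        nrm n (\<lambda>i. m g h i - g i - h i) + nrm n (\<lambda>i. g i - s * v i) + nrm n (\<lambda>i. h i - s * w i)"
      by (rule nrm_le_add3) (simp add: algebra_simps)
    also have "\<dots> \<le> \<epsilon> * s" using 1 g(2) h(2) by simp
    finally show "\<exists>h\<in>L. nrm n (\<lambda>i. h i - s * (v i + w i)) \<le> \<epsilon> * s"
      using L_m [OF g(1) h(1)] gn hn sK d(2) by fastforce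
  qed
qed

lemma tangent_zero: "(\<lambda>_. 0) \<in> tangent"
  unfolding tangent_def using L_zero by (auto intro!: exI[of _ 1] bexI[of _ "\<lambda>_. 0"])

text \<open>The inverse of an approximant \<open>g\<close> of \<open>s v\<close> approximates
  \<open>- s v\<close>; it is \<open>q g 0\<close>, because the origin is the unit.\<close>

lemma tangent_minus:
  assumes v: "v \<in> tangent"
  shows "(\<lambda>i. - v i) \<in> tangent"
  unfolding tangent_def
proof (intro CollectI conjI allI impI)
  show "(\<lambda>i. - v i) \<in> esp n" using esp_scale [OF tangent_esp [OF v], of "-1"] by simp
  fix \<epsilon> :: real assume \<epsilon>: "\<epsilon> > 0"
  define K where "K = nrm n v + \<epsilon>"
  have K: "K > 0" "nrm n v + \<epsilon> / 2 \<le> K"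
    unfolding K_def using \<epsilon> nrm_nonneg [of n v] by linarith+
  have eK: "\<epsilon> / (2 * K) > 0" using \<epsilon> K by simp
  obtain d where d: "d > 0" "d \<le> r"
    "\<And>x y. \<lbrakk>x \<in> esp n; y \<in> esp n; nrm n x < d; nrm n y < d\<rbrakk> \<Longrightarrow>
       nrm n (\<lambda>i. y i - x i - q x y i) \<le> (\<epsilon> / (2 * K)) * nrm n (\<lambda>i. y i - x i) \<and>
       nrm n (q x y) \<le> 2 * nrm n (\<lambda>i. y i - x i)"
    using q_near_diff [OF eK] by blast
  have e2: "\<epsilon> / 2 > 0" using \<epsilon> by simp
  obtain a where a: "a > 0" "\<And>s. 0 < s \<Longrightarrow> s < a \<Longrightarrow> \<exists>h\<in>L. nrm n (\<lambda>i. h i - s * v i) \<le> \<epsilon> / 2 * s"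
    using tangentD [OF v e2] by blast
  show "\<exists>s0>0. \<forall>s. 0 < s \<longrightarrow> s < s0 \<longrightarrow> (\<exists>h\<in>L. nrm n (\<lambda>i. h i - s * - v i) \<le> \<epsilon> * s)"
  proof (intro exI[of _ "min a (d / K)"] conjI allI impI)
    show "0 < min a (d / K)" using a d K by simp
    fix s assume s: "0 < s" "s < min a (d / K)"
    then have sK: "s * K < d" using K by (simp add: field_simps)
    obtain g where g: "g \<in> L" "nrm n (\<lambda>i. g i - s * v i) \<le> \<epsilon> / 2 * s" using a s by fastforce
    have gn: "nrm n g \<le> s * K" using nrm_le_of_close [OF g(2) s(1)] K(2) s(1)
      by (meson mult_left_mono less_imp_le order_trans)
    let ?u = "q g (\<lambda>_. 0)"
    have "nrm n (\<lambda>i. 0 - g i - ?u i) \<le> (\<epsilon> / (2 * K)) * nrm n (\<lambda>i. 0 - g i)"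
      using d(3) [OF L_esp [OF g(1)] esp_zero] gn sK d(1) by simp
    also have "\<dots> = (\<epsilon> / (2 * K)) * nrm n g" by (simp add: nrm_def)
    also have "\<dots> \<le> (\<epsilon> / (2 * K)) * (s * K)" using gn \<epsilon> K by (intro mult_left_mono) auto
    also have "\<dots> = \<epsilon> / 2 * s" using K by (simp add: field_simps)
    finally have 1: "nrm n (\<lambda>i. 0 - g i - ?u i) \<le> \<epsilon> / 2 * s" .
    have "nrm n (\<lambda>i. ?u i - s * - v i) \<le> nrm n (\<lambda>i. 0 - g i - ?u i) + nrm n (\<lambda>i. g i - s * v i)"
      by (rule nrm_le_add) (simp add: algebra_simps)
    also have "\<dots> \<le> \<epsilon> * s" using 1 g(2) by simp
    finally show "\<exists>h\<in>L. nrm n (\<lambda>i. h i - s * - v i) \<le> \<epsilon> * s"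
      using L_q [OF g(1) L_zero] gn sK d(1,2) by fastforce
  qed
qed

lemma tangent_scale_pos:
  assumes v: "v \<in> tangent" and c: "c > 0"
  shows "(\<lambda>i. c * v i) \<in> tangent"
  unfolding tangent_def
proof (intro CollectI conjI allI impI)
  show "(\<lambda>i. c * v i) \<in> esp n" using esp_scale tangent_esp [OF v] by blast
  fix \<epsilon> :: real assume "\<epsilon> > 0"
  with c have "\<epsilon> / c > 0" by simp
  then obtain a where a: "a > 0" "\<And>s. 0 < s \<Longrightarrow> s < a \<Longrightarrow> \<exists>h\<in>L. nrm n (\<lambda>i. h i - s * v i) \<le> \<epsilon> / c * s"
    using tangentD [OF v] by blast
  show "\<exists>s0>0. \<forall>s. 0 < s \<longrightarrow> s < s0 \<longrightarrow> (\<exists>h\<in>L. nrm n (\<lambda>i. h i - s * (c * v i)) \<le> \<epsilon> * s)"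
  proof (intro exI[of _ "a / c"] conjI allI impI)
    fix s assume "0 < s" "s < a / c"
    then show "\<exists>h\<in>L. nrm n (\<lambda>i. h i - s * (c * v i)) \<le> \<epsilon> * s"
      using a(2) [of "s * c"] c by (simp add: field_simps)
  qed (use a c in simp)
qed

lemma tangent_scale: "v \<in> tangent \<Longrightarrow> (\<lambda>i. c * v i) \<in> tangent"
  using tangent_scale_pos [of v c] tangent_zero tangent_minus [OF tangent_scale_pos [of v "-c"]]
  by (cases c "0 :: real" rule: linorder_cases) auto

text \<open>A limit of directions of elements of \<open>L\<close> is tangent, by passing to powers of these elements.\<close>

lemma limit_direction_tangent:
  assumes v: "v \<in> esp n"
    and lim: "\<And>\<eta>. \<eta> > 0 \<Longrightarrow> \<exists>h\<in>L. 0 < nrm n h \<and> nrm n h < \<eta> \<and> nrm n (\<lambda>i. h i / nrm n h - v i) \<le> \<eta>"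
  shows "v \<in> tangent"
  unfolding tangent_def
proof (intro CollectI conjI allI impI v)
  fix \<epsilon> :: real assume \<epsilon>: "\<epsilon> > 0"
  then have "\<epsilon> / 4 > 0" by simp
  then obtain \<delta> where \<delta>: "\<delta> > 0" "\<And>h k. \<lbrakk>h \<in> L; 2 * (real k * nrm n h) < \<delta>\<rbrakk> \<Longrightarrow>
       \<exists>g\<in>L. nrm n (\<lambda>i. g i - real k * h i) \<le> \<epsilon> / 4 * (real k * nrm n h)"
    using powers [of "\<epsilon> / 4"] by blast
  show "\<exists>s0>0. \<forall>s. 0 < s \<longrightarrow> s < s0 \<longrightarrow> (\<exists>h\<in>L. nrm n (\<lambda>i. h i - s * v i) \<le> \<epsilon> * s)"
  proof (intro exI[of _ "\<delta> / 2"] conjI allI impI)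
    fix s assume s: "0 < s" "s < \<delta> / 2"
    define K where "K = 1 + nrm n v"
    have K: "K > 0" "nrm n v \<le> K" unfolding K_def using nrm_nonneg [of n v] by linarith+
    \<comment> \<open>The first bound is for the error in the direction, the second for rounding
      \<open>s / nrm n h\<close> to an integer.\<close>
    define \<eta> where "\<eta> = min (\<epsilon> / 4) (\<epsilon> / 4 * s / K)"
    have "\<eta> > 0" unfolding \<eta>_def using \<epsilon> s K by simp
    then obtain h where h: "h \<in> L" "0 < nrm n h" "nrm n h < \<eta>" "nrm n (\<lambda>i. h i / nrm n h - v i) \<le> \<eta>"
      using lim by blast
    \<comment> \<open>The power of \<open>h\<close> whose length comes closest to \<open>s\<close>
      from below; it misses \<open>s\<close> by at most the length of \<open>h\<close>.\<close>
    define j where "j = nat \<lfloor>s / nrm n h\<rfloor>"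
    have rj: "real j = \<lfloor>s / nrm n h\<rfloor>" unfolding j_def using s h(2) by simp
    have "real j \<le> s / nrm n h" unfolding rj by simp
    then have j1: "real j * nrm n h \<le> s" using h(2) by (simp add: field_simps)
    have "s / nrm n h - 1 \<le> real j" unfolding rj by linarith
    then have j2: "s - real j * nrm n h \<le> nrm n h" using h(2) by (simp add: field_simps)
    obtain g where g: "g \<in> L" "nrm n (\<lambda>i. g i - real j * h i) \<le> \<epsilon> / 4 * (real j * nrm n h)"
      using \<delta>(2) [OF h(1), of j] j1 s by auto
    have g2: "nrm n (\<lambda>i. g i - real j * h i) \<le> \<epsilon> / 4 * s"
      using \<epsilon> by (intro order_trans [OF g(2) mult_left_mono [OF j1]]) simp
    have "nrm n (\<lambda>i. (real j * nrm n h) * (h i / nrm n h - v i)) = (real j * nrm n h) * nrm n (\<lambda>i. h i / nrm n h - v i)"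
      by (simp only: nrm_scale) (use h(2) in simp)
    also have "\<dots> \<le> s * (\<epsilon> / 4)"
      using j1 h(2,4) s by (intro mult_mono) (auto simp: \<eta>_def)
    finally have g3: "nrm n (\<lambda>i. (real j * nrm n h) * (h i / nrm n h - v i)) \<le> \<epsilon> / 4 * s" by (simp add: mult.commute)
    have "nrm n (\<lambda>i. (real j * nrm n h - s) * v i) = \<bar>real j * nrm n h - s\<bar> * nrm n v"
      by (rule nrm_scale)
    also have "\<dots> \<le> (\<epsilon> / 4 * s / K) * K"
      using j1 j2 h(3) K \<epsilon> s by (intro mult_mono) (auto simp: \<eta>_def)
    finally have g4: "nrm n (\<lambda>i. (real j * nrm n h - s) * v i) \<le> \<epsilon> / 4 * s" using K by simp
    \<comment> \<open>Three errors: power against multiple, direction of \<open>h\<close> against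
      \<open>v\<close>, and rounding.\<close>
    have "nrm n (\<lambda>i. g i - s * v i) \<le> nrm n (\<lambda>i. g i - real j * h i) +
        nrm n (\<lambda>i. (real j * nrm n h) * (h i / nrm n h - v i)) + nrm n (\<lambda>i. (real j * nrm n h - s) * v i)"
    proof (rule nrm_le_add3)
      fix i
      have "g i - s * v i = (g i - real j * h i) + (real j * nrm n h) * (h i / nrm n h - v i) + (real j * nrm n h - s) * v i"
        using h(2) by (simp add: field_simps)
      then show "\<bar>g i - s * v i\<bar> \<le> \<bar>g i - real j * h i\<bar> + \<bar>(real j * nrm n h) * (h i / nrm n h - v i)\<bar> + \<bar>(real j * nrm n h - s) * v i\<bar>"
        by (metis abs_add3)
    qed
    also have "\<dots> \<le> \<epsilon> * s" using g2 g3 g4 mult_pos_pos [OF \<epsilon> s(1)] by simp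
    finally show "\<exists>h\<in>L. nrm n (\<lambda>i. h i - s * v i) \<le> \<epsilon> * s" using g(1) by blast
  qed (use \<delta> in simp)
qed

end

section \<open>Compactness in n-space\<close>

lemma Euclidean_space_subtopology: "Euclidean_space n = subtopology (powertop_real UNIV) (esp n)"
  unfolding topspace_Euclidean_space using meta_eq_to_obj_eq [OF Euclidean_space_def] by blast

text \<open>By Tychonoff: the ball is closed in the product of all coordinate lines and lies in a
  product of compact intervals.\<close>

lemma compactin_nrm_ball: "compactin (Euclidean_space n) {x \<in> esp n. nrm n x \<le> R}"
proof -
  let ?B = "{x \<in> esp n. nrm n x \<le> R}" and ?P = "\<Pi>\<^sub>E i\<in>(UNIV :: nat set). {-\<bar>R\<bar>..\<bar>R\<bar>}"
  have "continuous_map (Euclidean_space n) euclideanreal (nrm n)"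
    unfolding nrm_def by (intro continuous_intros continuous_coordinate) auto
  then have "closedin (Euclidean_space n) {x \<in> esp n. nrm n x \<in> {..R}}"
    by (rule closedin_continuous_map_preimage) auto
  then have "closedin (powertop_real UNIV) ?B"
    using closedin_Euclidean_imp_closed [of n ?B] by (simp add: euclidean_product_topology)
  moreover have "compactin (powertop_real UNIV) ?P" by (simp add: compactin_PiE)
  ultimately have "compactin (powertop_real UNIV) (?B \<inter> ?P)" by (rule closed_Int_compactin)
  moreover have "?B \<subseteq> ?P"
  proof
    fix x assume x: "x \<in> ?B"
    have "\<bar>x i\<bar> \<le> \<bar>R\<bar>" for i
      using component_le_nrm [of i n x] x by (cases "i < n") (auto simp: topspace_Euclidean_space)
    then have "x i \<in> {-\<bar>R\<bar>..\<bar>R\<bar>}" for i by (metis abs_le_iff atLeastAtMost_iff minus_le_iff)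
    then show "x \<in> ?P" by (simp add: PiE_iff)
  qed
  ultimately have "compactin (powertop_real UNIV) ?B" by (simp only: Int_absorb2)
  then have "compactin (subtopology (powertop_real UNIV) (esp n)) ?B"
    unfolding compactin_subtopology by blast
  then show ?thesis unfolding Euclidean_space_subtopology [symmetric] .
qed

text \<open>Convergence in the product topology is coordinatewise, and the norm involves finitely
  many coordinates, so a convergent subsequence converges in norm.\<close>

lemma unit_sequence_subsequence:
  fixes w :: "nat \<Rightarrow> nat \<Rightarrow> real"
  assumes w: "\<And>k. w k \<in> esp n" "\<And>k. nrm n (w k) = 1"
  obtains v \<phi> where "v \<in> esp n" "strict_mono (\<phi> :: nat \<Rightarrow> nat)"
    "(\<lambda>k. nrm n (\<lambda>i. w (\<phi> k) i - v i)) \<longlonglongrightarrow> 0"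
proof -
  have "compactin (subtopology (powertop_real UNIV) (esp n)) {x \<in> esp n. nrm n x \<le> 1}"
    unfolding Euclidean_space_subtopology [symmetric] by (rule compactin_nrm_ball)
  then have "compact {x \<in> esp n. nrm n x \<le> 1}"
    by (simp add: compactin_subtopology euclidean_product_topology)
  then have "seq_compact {x \<in> esp n. nrm n x \<le> 1}"
    by (rule compact_imp_seq_compact)
  moreover have "\<forall>k. w k \<in> {x \<in> esp n. nrm n x \<le> 1}" using w by simp
  ultimately obtain v \<phi> where v: "strict_mono (\<phi> :: nat \<Rightarrow> nat)" "(w \<circ> \<phi>) \<longlonglongrightarrow> v"
    by (rule seq_compactE)
  have c: "(\<lambda>k. w (\<phi> k) i) \<longlonglongrightarrow> v i" for i
  proof -
    have "continuous_on UNIV (\<lambda>x :: nat \<Rightarrow> real. x i)" by simp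
    from continuous_on_tendsto_compose [OF this v(2)] show ?thesis by (simp add: o_def)
  qed
  show thesis
  proof (rule that [OF _ v(1)])
    have "v i = 0" if "i \<ge> n" for i
    proof -
      have "w (\<phi> k) i = 0" for k using w(1) that by (auto simp: topspace_Euclidean_space)
      then show ?thesis using c [of i] by (simp add: LIMSEQ_const_iff)
    qed
    then show "v \<in> esp n" by (simp add: topspace_Euclidean_space)
    have "(\<lambda>k. nrm n (\<lambda>i. w (\<phi> k) i - v i)) \<longlonglongrightarrow> (\<Sum>i<n. \<bar>v i - v i\<bar>)"
      unfolding nrm_def by (intro tendsto_intros c)
    then show "(\<lambda>k. nrm n (\<lambda>i. w (\<phi> k) i - v i)) \<longlonglongrightarrow> 0" by simp
  qed
qed

section \<open>The local subgroup as a Lipschitz graph over its tangent space\<close>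

locale local_subgroup_coordinates = local_subgroup +
  fixes J :: "nat set" and e :: "nat \<Rightarrow> nat \<Rightarrow> real"
  assumes J: "J \<subseteq> {..<n}" and e: "\<And>j. j \<in> J \<Longrightarrow> e j \<in> tangent"
    and e_J: "\<And>j k. j \<in> J \<Longrightarrow> k \<in> J \<Longrightarrow> e j k = (if j = k then 1 else 0)"
    and tangent_e: "\<And>v. v \<in> tangent \<Longrightarrow> v = (\<lambda>i. \<Sum>j\<in>J. v j * e j i)"
begin

lemma finite_J: "finite J"
  using J finite_subset by blast

definition nrmJ :: "(nat \<Rightarrow> real) \<Rightarrow> real" where
  "nrmJ v = (\<Sum>j\<in>J. \<bar>v j\<bar>)"

text \<open>The linear projection onto the tangent space that keeps the coordinates in
  \<open>J\<close>; the vectors \<open>e j\<close> are the basis dual to these coordinates. It is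
  not orthogonal in general, hence the constant \<open>C\<close>.\<close>

definition pr :: "(nat \<Rightarrow> real) \<Rightarrow> nat \<Rightarrow> real" where
  "pr v = (\<lambda>i. \<Sum>j\<in>J. v j * e j i)"

text \<open>A bound for the operator norm of \<open>pr\<close>; the summand 1 makes it safe to
  divide by.\<close>

definition C :: real where
  "C = 1 + (\<Sum>j\<in>J. nrm n (e j))"

lemma C: "C \<ge> 1"
  by (simp add: C_def sum_nonneg)

lemma nrmJ_le: "nrmJ v \<le> nrm n v"
  unfolding nrmJ_def nrm_def by (rule sum_mono2) (use J in auto)

lemma nrmJ_nonneg [simp]: "0 \<le> nrmJ v"
  by (simp add: nrmJ_def sum_nonneg)

lemma pr_le_J: "nrm n (pr v) \<le> C * nrmJ v"
proof -
  have "nrm n (pr v) \<le> (\<Sum>i<n. \<Sum>j\<in>J. \<bar>v j\<bar> * \<bar>e j i\<bar>)"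
    unfolding nrm_def pr_def abs_mult [symmetric] by (intro sum_mono sum_abs)
  also have "\<dots> = (\<Sum>j\<in>J. \<bar>v j\<bar> * nrm n (e j))"
    unfolding nrm_def sum_distrib_left by (rule sum.swap)
  also have "\<dots> \<le> (\<Sum>j\<in>J. \<bar>v j\<bar> * C)"
  proof (intro sum_mono mult_left_mono)
    fix j assume "j \<in> J"
    then have "nrm n (e j) \<le> (\<Sum>j\<in>J. nrm n (e j))" using finite_J by (intro member_le_sum) auto
    then show "nrm n (e j) \<le> C" by (simp add: C_def)
  qed auto
  finally show ?thesis by (simp add: nrmJ_def sum_distrib_left mult.commute)
qed

lemma pr_le: "nrm n (pr v) \<le> C * nrm n v"
  using pr_le_J [of v] nrmJ_le [of v] C by (meson mult_left_mono order_trans zero_le_one)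

lemma pr_J: "k \<in> J \<Longrightarrow> pr v k = v k"
proof -
  assume k: "k \<in> J"
  have "(\<Sum>j\<in>J. v j * e j k) = (\<Sum>j\<in>J. if j = k then v k else 0)"
    by (rule sum.cong) (auto simp: e_J k)
  then show ?thesis using k finite_J by (simp add: pr_def)
qed

lemma pr_tangent: "pr v \<in> tangent"
proof -
  have "(\<lambda>i. \<Sum>j\<in>I. v j * e j i) \<in> tangent" if "finite I" "I \<subseteq> J" for I
    using that
  proof (induction I)
    case (insert j I)
    then show ?case using tangent_add [OF tangent_scale [OF e, of j "v j"]] by simp
  qed (simp add: tangent_zero)
  then show ?thesis using finite_J by (simp add: pr_def)
qed

lemma pr_diff: "pr (\<lambda>i. v i - w i) = (\<lambda>i. pr v i - pr w i)"
  by (simp add: pr_def left_diff_distrib sum_subtractf)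

lemma pr_scale: "pr (\<lambda>i. c * v i) = (\<lambda>i. c * pr v i)"
  by (simp add: pr_def sum_distrib_left mult.assoc)

text \<open>Near the origin \<open>L\<close> is tangent to its tangent space: otherwise a limit of unit vectors violates this.\<close>

lemma L_tangential:
  assumes \<epsilon>: "\<epsilon> > 0"
  obtains \<delta> where "\<delta> > 0"
    "\<And>u. \<lbrakk>u \<in> L; nrm n u < \<delta>\<rbrakk> \<Longrightarrow> nrm n (\<lambda>i. u i - pr u i) \<le> \<epsilon> * nrm n u"
proof (rule ccontr)
  note that
  moreover assume "\<not> thesis"
  ultimately have "\<exists>u\<in>L. nrm n u < \<delta> \<and> \<epsilon> * nrm n u < nrm n (\<lambda>i. u i - pr u i)" if "\<delta> > 0" for \<delta>
    using \<open>\<delta> > 0\<close> by (meson not_le)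
  then have "\<exists>u\<in>L. nrm n u < inverse (real (Suc k)) \<and> \<epsilon> * nrm n u < nrm n (\<lambda>i. u i - pr u i)" for k
    by simp
  then obtain u where u: "\<And>k. u k \<in> L" "\<And>k. nrm n (u k) < inverse (real (Suc k))"
    "\<And>k. \<epsilon> * nrm n (u k) < nrm n (\<lambda>i. u k i - pr (u k) i)"
    by metis
  \<comment> \<open>For a vector of norm 0 both sides vanish and the strict inequality
    fails.\<close>
  have pos: "nrm n (u k) > 0" for k
  proof (rule ccontr)
    assume "\<not> 0 < nrm n (u k)"
    then have z: "nrm n (u k) = 0" by (simp add: order_antisym)
    have "nrm n (\<lambda>i. u k i - pr (u k) i) \<le> nrm n (u k) + nrm n (pr (u k))"
      by (rule nrm_le_add) linarith
    then show False using u(3) [of k] pr_le [of "u k"] z by simp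
  qed
  define w where "w = (\<lambda>k i. (1 / nrm n (u k)) * u k i)"
  have w1: "w k \<in> esp n" for k unfolding w_def by (rule esp_scale [OF L_esp [OF u(1)]])
  have w2: "nrm n (w k) = 1" for k unfolding w_def nrm_scale using pos [of k] by simp
  have w3: "\<epsilon> \<le> nrm n (\<lambda>i. w k i - pr (w k) i)" for k
  proof -
    have "(\<lambda>i. w k i - pr (w k) i) = (\<lambda>i. (1 / nrm n (u k)) * (u k i - pr (u k) i))"
      unfolding w_def pr_scale by (simp add: algebra_simps)
    then have "nrm n (\<lambda>i. w k i - pr (w k) i) = (1 / nrm n (u k)) * nrm n (\<lambda>i. u k i - pr (u k) i)"
      using pos [of k] by (simp only: nrm_scale) simp
    then have "nrm n (u k) * \<epsilon> < nrm n (u k) * nrm n (\<lambda>i. w k i - pr (w k) i)"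
      using u(3) [of k] pos [of k] by (simp add: mult.commute)
    then show ?thesis using pos [of k] by simp
  qed
  obtain v \<phi> where v: "v \<in> esp n" "strict_mono (\<phi> :: nat \<Rightarrow> nat)" "(\<lambda>k. nrm n (\<lambda>i. w (\<phi> k) i - v i)) \<longlonglongrightarrow> 0"
    using unit_sequence_subsequence [of w n] w1 w2 by blast
  have "v \<in> tangent"
  proof (rule limit_direction_tangent [OF v(1)])
    fix \<eta> :: real assume \<eta>: "\<eta> > 0"
    have "\<forall>\<^sub>F k in sequentially. nrm n (\<lambda>i. w (\<phi> k) i - v i) < \<eta>"
      using order_tendstoD(2) [OF v(3) \<eta>] .
    moreover have "\<forall>\<^sub>F k in sequentially. inverse (real (Suc k)) < \<eta>"
      using order_tendstoD(2) [OF LIMSEQ_inverse_real_of_nat \<eta>] .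
    ultimately have "\<forall>\<^sub>F k in sequentially. nrm n (\<lambda>i. w (\<phi> k) i - v i) < \<eta> \<and> inverse (real (Suc k)) < \<eta>"
      by (rule eventually_conj)
    then obtain k where k: "nrm n (\<lambda>i. w (\<phi> k) i - v i) < \<eta>" "inverse (real (Suc k)) < \<eta>"
      using eventually_happens' sequentially_bot by blast
    have "inverse (real (Suc (\<phi> k))) \<le> inverse (real (Suc k))"
      using seq_suble [OF v(2), of k] by (intro le_imp_inverse_le) auto
    then have "nrm n (u (\<phi> k)) < \<eta>" using u(2) [of "\<phi> k"] k(2) by linarith
    then show "\<exists>h\<in>L. 0 < nrm n h \<and> nrm n h < \<eta> \<and> nrm n (\<lambda>i. h i / nrm n h - v i) \<le> \<eta>"
      using k(1) u(1) pos by (intro bexI[of _ "u (\<phi> k)"]) (auto simp: w_def)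
  qed
  then have pv: "pr v = v" using tangent_e by (simp add: pr_def)
  \<comment> \<open>Since \<open>pr\<close> fixes the limit \<open>v\<close>, the normalized defect
    is at most \<open>1 + C\<close> times the distance to \<open>v\<close>; it tends to 0 and yet
    stays above \<epsilon>.\<close>
  have "\<epsilon> \<le> (1 + C) * nrm n (\<lambda>i. w (\<phi> k) i - v i)" for k
  proof -
    have "nrm n (\<lambda>i. w (\<phi> k) i - pr (w (\<phi> k)) i) \<le>
        nrm n (\<lambda>i. w (\<phi> k) i - v i) + nrm n (pr (\<lambda>i. w (\<phi> k) i - v i))"
      by (rule nrm_le_add) (simp add: pr_diff pv)
    then show ?thesis using w3 [of "\<phi> k"] pr_le [of "\<lambda>i. w (\<phi> k) i - v i"] by (simp add: algebra_simps)
  qed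
  moreover have "(\<lambda>k. (1 + C) * nrm n (\<lambda>i. w (\<phi> k) i - v i)) \<longlonglongrightarrow> (1 + C) * 0"
    by (intro tendsto_intros v(3))
  ultimately have "\<epsilon> \<le> (1 + C) * 0" by (intro LIMSEQ_le_const) auto
  then show False using \<epsilon> by simp
qed

text \<open>Translation moves the comparison to the origin: \<open>u = q x y\<close> is again in
  \<open>L\<close>, is nearly tangent by \<open>L_tangential\<close>, and equals
  \<open>y - x\<close> to first order.\<close>

lemma L_flat:
  assumes \<epsilon>: "\<epsilon> > 0"
  obtains \<delta> where "\<delta> > 0"
    "\<And>x y. \<lbrakk>x \<in> L; y \<in> L; nrm n x < \<delta>; nrm n y < \<delta>\<rbrakk> \<Longrightarrow>
      nrm n (\<lambda>i. y i - x i - pr (\<lambda>i. y i - x i) i) \<le> \<epsilon> * nrm n (\<lambda>i. y i - x i)"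
proof -
  \<comment> \<open>Budget: \<eta> for replacing \<open>y - x\<close> by \<open>u\<close>,
    \<open>C * \<eta>\<close> for the projection of that error, and \<open>2 * \<eta>\<close> for
    the tangency of \<open>u\<close>.\<close>
  define \<eta> where "\<eta> = \<epsilon> / (3 + C)"
  have \<eta>: "\<eta> > 0" "(1 + C) * \<eta> + 2 * \<eta> = \<epsilon>"
  proof -
    show "\<eta> > 0" unfolding \<eta>_def using \<epsilon> C by simp
    have "(1 + C) * \<eta> + 2 * \<eta> = (3 + C) * \<eta>" by (simp add: algebra_simps)
    then show "(1 + C) * \<eta> + 2 * \<eta> = \<epsilon>" unfolding \<eta>_def using C by simp
  qed
  obtain a where a: "a > 0" "\<And>u. \<lbrakk>u \<in> L; nrm n u < a\<rbrakk> \<Longrightarrow> nrm n (\<lambda>i. u i - pr u i) \<le> \<eta> * nrm n u"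
    using L_tangential [OF \<eta>(1)] by blast
  obtain b where b: "b > 0" "b \<le> r"
    "\<And>x y. \<lbrakk>x \<in> esp n; y \<in> esp n; nrm n x < b; nrm n y < b\<rbrakk> \<Longrightarrow>
       nrm n (\<lambda>i. y i - x i - q x y i) \<le> \<eta> * nrm n (\<lambda>i. y i - x i) \<and>
       nrm n (q x y) \<le> 2 * nrm n (\<lambda>i. y i - x i)"
    using q_near_diff [OF \<eta>(1)] by blast
  show thesis
  \<comment> \<open>A quarter, because \<open>nrm n u\<close> is at most twice the norm of
    \<open>y - x\<close>, which is below \<open>a / 2\<close>.\<close>
  proof (rule that [of "min b (a / 4)"])
    fix x y assume h: "x \<in> L" "y \<in> L" "nrm n x < min b (a / 4)" "nrm n y < min b (a / 4)"
    define D u where "D = (\<lambda>i. y i - x i)" and "u = q x y"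
    have u: "nrm n (\<lambda>i. D i - u i) \<le> \<eta> * nrm n D" "nrm n u \<le> 2 * nrm n D" "u \<in> L"
      using b(3) [OF L_esp [OF h(1)] L_esp [OF h(2)]] L_q [OF h(1,2)] h b(2) by (auto simp: D_def u_def)
    have "nrm n D \<le> nrm n y + nrm n x" unfolding D_def by (rule nrm_le_add) linarith
    then have "nrm n u < a" using u(2) h by simp
    then have u': "nrm n (\<lambda>i. u i - pr u i) \<le> \<eta> * (2 * nrm n D)"
      using a(2) [OF u(3)] mult_left_mono [OF u(2), of \<eta>] \<eta>(1) by linarith
    have "nrm n (\<lambda>i. D i - pr D i) \<le> nrm n (\<lambda>i. D i - u i) + nrm n (pr (\<lambda>i. D i - u i)) + nrm n (\<lambda>i. u i - pr u i)"
      by (rule nrm_le_add3) (simp add: pr_diff)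
    also have "\<dots> \<le> \<eta> * nrm n D + C * (\<eta> * nrm n D) + \<eta> * (2 * nrm n D)"
      using u u' pr_le [of "\<lambda>i. D i - u i"] mult_left_mono [OF u(1), of C] C by linarith
    also have "\<dots> = ((1 + C) * \<eta> + 2 * \<eta>) * nrm n D" by (simp add: algebra_simps)
    finally show "nrm n (\<lambda>i. y i - x i - pr (\<lambda>i. y i - x i) i) \<le> \<epsilon> * nrm n (\<lambda>i. y i - x i)"
      unfolding \<eta>(2) D_def .
  qed (use a b in auto)
qed

text \<open>With \<epsilon> = 1/2 in \<open>L_flat\<close>, half of \<open>y - x\<close> is absorbed
  and the rest is its projection. So near the origin the coordinates in \<open>J\<close> determine
  the points of \<open>L\<close>, in a Lipschitz way.\<close>

lemma L_lipschitz:
  obtains \<delta> where "\<delta> > 0"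
    "\<And>x y. \<lbrakk>x \<in> L; y \<in> L; nrm n x < \<delta>; nrm n y < \<delta>\<rbrakk> \<Longrightarrow>
      nrm n (\<lambda>i. y i - x i) \<le> 2 * C * nrmJ (\<lambda>i. y i - x i)"
proof -
  obtain \<delta> where \<delta>: "\<delta> > 0" "\<And>x y. \<lbrakk>x \<in> L; y \<in> L; nrm n x < \<delta>; nrm n y < \<delta>\<rbrakk> \<Longrightarrow>
      nrm n (\<lambda>i. y i - x i - pr (\<lambda>i. y i - x i) i) \<le> 1 / 2 * nrm n (\<lambda>i. y i - x i)"
    using L_flat [of "1 / 2"] by auto
  show thesis
  proof (rule that [OF \<delta>(1)])
    fix x y assume h: "x \<in> L" "y \<in> L" "nrm n x < \<delta>" "nrm n y < \<delta>"
    have "nrm n (\<lambda>i. y i - x i) \<le> nrm n (\<lambda>i. y i - x i - pr (\<lambda>i. y i - x i) i) + nrm n (pr (\<lambda>i. y i - x i))"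
      by (rule nrm_le_add) linarith
    then show "nrm n (\<lambda>i. y i - x i) \<le> 2 * C * nrmJ (\<lambda>i. y i - x i)"
      using \<delta>(2) [OF h] pr_le_J [of "\<lambda>i. y i - x i"] by simp
  qed
qed

text \<open>
  The point of \<open>L\<close> whose projection is closest to \<open>w\<close> projects onto \<open>w\<close>, since otherwise it could
  be moved towards \<open>w\<close> by multiplication with an element of \<open>L\<close>.
\<close>

lemma L_projection_onto:
  assumes \<rho>: "\<rho> > 0"
  obtains \<delta> where "\<delta> > 0"
    "\<And>w. nrmJ w < \<delta> \<Longrightarrow> \<exists>h\<in>L. nrm n h < \<rho> \<and> (\<forall>j\<in>J. h j = w j)"
proof -
  obtain a where a: "a > 0" "\<And>x y. \<lbrakk>x \<in> L; y \<in> L; nrm n x < a; nrm n y < a\<rbrakk> \<Longrightarrow>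
      nrm n (\<lambda>i. y i - x i) \<le> 2 * C * nrmJ (\<lambda>i. y i - x i)"
    using L_lipschitz by blast
  \<comment> \<open>Chosen so that the error of the product \<open>m h k\<close> is at most a
    quarter of the intended gain \<open>s * d\<close>.\<close>
  define \<eta> where "\<eta> = 1 / (4 * (C + 1))"
  have \<eta>: "\<eta> > 0" "\<eta> \<le> 1" "\<eta> * (C + 1) = 1 / 4" unfolding \<eta>_def using C by (auto simp: field_simps)
  obtain b where b: "b > 0" "b \<le> r" "\<And>x y. \<lbrakk>x \<in> esp n; y \<in> esp n; nrm n x < b; nrm n y < b\<rbrakk> \<Longrightarrow>
       nrm n (\<lambda>i. m x y i - x i - y i) \<le> \<eta> * nrm n y"
    using m_near_add [OF \<eta>(1)] by blast
  define \<rho>' where "\<rho>' = min (min a b) \<rho> / 2"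
  have \<rho>': "\<rho>' > 0" "\<rho>' < a" "\<rho>' < b" "\<rho>' < \<rho>" unfolding \<rho>'_def using a b \<rho> by auto
  \<comment> \<open>The origin competes with the nearest point \<open>h\<close>, so \<open>h\<close>
    has \<open>nrmJ\<close> at most \<open>2 * \<delta>\<close>, hence norm at most
    \<open>\<rho>' / 2\<close> by the Lipschitz bound. This leaves room to move \<open>h\<close>
    inside the ball of radius \<rho>'.\<close>
  define \<delta> where "\<delta> = \<rho>' / (8 * C)"
  have \<delta>: "\<delta> > 0" "2 * C * (2 * \<delta>) = \<rho>' / 2" unfolding \<delta>_def using \<rho>' C by auto
  show thesis
  proof (rule that [OF \<delta>(1)])
    fix w assume w: "nrmJ w < \<delta>"
    define K where "K = L \<inter> {x \<in> esp n. nrm n x \<in> {..\<rho>'}}"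
    have "continuous_map (Euclidean_space n) euclideanreal (nrm n)"
      unfolding nrm_def by (intro continuous_intros continuous_coordinate) auto
    then have "closedin (Euclidean_space n) {x \<in> esp n. nrm n x \<in> {..\<rho>'}}"
      by (rule closedin_continuous_map_preimage) auto
    then have "compactin (Euclidean_space n) K"
      unfolding K_def by (metis compact_Int_closedin L_compact)
    moreover have cf: "continuous_map (Euclidean_space n) euclideanreal (\<lambda>x. nrmJ (\<lambda>i. w i - x i))"
      unfolding nrmJ_def by (intro continuous_intros continuous_coordinate) (use finite_J in auto)
    ultimately have "compact ((\<lambda>x. nrmJ (\<lambda>i. w i - x i)) ` K)"
      using image_compactin compactin_euclidean_iff by blast
    moreover have K0: "(\<lambda>_. 0) \<in> K" unfolding K_def using L_zero \<rho>' by simp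
    ultimately obtain h where h: "h \<in> K" "\<And>x. x \<in> K \<Longrightarrow> nrmJ (\<lambda>i. w i - h i) \<le> nrmJ (\<lambda>i. w i - x i)"
      using compact_attains_inf [of "(\<lambda>x. nrmJ (\<lambda>i. w i - x i)) ` K"] by auto
    have hL: "h \<in> L" "h \<in> esp n" "nrm n h \<le> \<rho>'" using h(1) unfolding K_def by auto
    define d where "d = nrmJ (\<lambda>i. w i - h i)"
    have d\<delta>: "d < \<delta>" using h(2) [OF K0] w unfolding d_def by simp
    have "d = 0"
    proof (rule ccontr)
      assume "d \<noteq> 0"
      then have d0: "d > 0" unfolding d_def using nrmJ_nonneg by (simp add: less_le)
      have "nrmJ h \<le> nrmJ (\<lambda>i. w i - h i) + nrmJ w"
        unfolding nrmJ_def sum.distrib [symmetric] by (rule sum_mono) linarith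
      then have "nrmJ h \<le> 2 * \<delta>" using d\<delta> w by (simp add: d_def)
      then have "2 * C * nrmJ h \<le> \<rho>' / 2" using \<delta>(2) C
        by (metis mult_left_mono mult_nonneg_nonneg order_trans zero_le_numeral zero_le_one)
      moreover have "nrm n h \<le> 2 * C * nrmJ h"
        using a(2) [OF L_zero hL(1)] hL(3) \<rho>' a(1) by simp
      ultimately have hn: "nrm n h \<le> \<rho>' / 2" by linarith
      \<comment> \<open>The tangent vector whose coordinates in \<open>J\<close> are exactly the gap
        between \<open>h\<close> and \<open>w\<close>.\<close>
      define v where "v = pr (\<lambda>i. w i - h i)"
      have v: "v \<in> tangent" "nrm n v \<le> C * d" "\<And>j. j \<in> J \<Longrightarrow> v j = w j - h j"
        unfolding v_def d_def by (auto simp: pr_tangent pr_le_J pr_J)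
      have "d / 4 > 0" using d0 by simp
      then obtain s0 where s0: "s0 > 0" "\<And>s. 0 < s \<Longrightarrow> s < s0 \<Longrightarrow> \<exists>h\<in>L. nrm n (\<lambda>i. h i - s * v i) \<le> d / 4 * s"
        using tangentD [OF v(1)] by blast
      define M where "M = C * d + d"
      have M: "M > 0" unfolding M_def using d0 C by (simp add: add_nonneg_pos)
      \<comment> \<open>\<open>s < s0\<close> provides an element \<open>k\<close> of
        \<open>L\<close> near \<open>s v\<close>, \<open>s \<le> 1\<close> keeps
        \<open>1 - s\<close> nonnegative, and the last bound keeps \<open>m h k\<close> within norm
        \<rho>'.\<close>
      define s where "s = min (min (s0 / 2) 1) (\<rho>' / (8 * M))"
      have s: "0 < s" "s < s0" "s \<le> 1" "s * M \<le> \<rho>' / 8"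
      proof -
        show "0 < s" "s < s0" "s \<le> 1" using s0(1) \<rho>' M by (auto simp: s_def)
        have "s \<le> \<rho>' / (8 * M)" by (simp add: s_def)
        then have "s * M \<le> \<rho>' / (8 * M) * M" using M by (intro mult_right_mono) auto
        then show "s * M \<le> \<rho>' / 8" using M by simp
      qed
      obtain k where k: "k \<in> L" "nrm n (\<lambda>i. k i - s * v i) \<le> d / 4 * s"
        using s0(2) [OF s(1,2)] by blast
      have "nrm n k \<le> s * (nrm n v + d / 4)" by (rule nrm_le_of_close [OF k(2) s(1)])
      also have "\<dots> \<le> s * M" unfolding M_def using v(2) d0 s(1) by (intro mult_left_mono) auto
      finally have kn: "nrm n k \<le> s * M" .
      have kb: "nrm n k < b" "nrm n h < b" using kn s(4) hL(3) \<rho>' by linarith+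
      have mk: "nrm n (\<lambda>i. m h k i - h i - k i) \<le> \<eta> * nrm n k"
        by (rule b(3) [OF hL(2) L_esp [OF k(1)] kb(2,1)])
      have mL: "m h k \<in> L" using L_m [OF hL(1) k(1)] kb b(2) by simp
      have "nrm n (m h k) \<le> nrm n (\<lambda>i. m h k i - h i - k i) + nrm n h + nrm n k"
        by (rule nrm_le_add3) linarith
      also have "\<dots> \<le> nrm n k + nrm n h + nrm n k"
        using mk mult_right_mono [OF \<eta>(2) nrm_nonneg, of n k] by simp
      also have "\<dots> \<le> \<rho>'" using kn s(4) hn \<rho>'(1) by linarith
      finally have "m h k \<in> K" using mL L_esp [OF mL] unfolding K_def by simp
      then have "d \<le> nrmJ (\<lambda>i. w i - m h k i)" unfolding d_def by (rule h(2))
      \<comment> \<open>Multiplication by \<open>k\<close> shrinks the gap to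
        \<open>(1 - s) * d\<close>, up to two errors of size \<open>d / 4 * s\<close>; half of the
        gain remains, against the choice of \<open>h\<close>.\<close>
      also have "\<dots> \<le> nrmJ (\<lambda>i. (1 - s) * (w i - h i)) + nrmJ (\<lambda>i. k i - s * v i) + nrmJ (\<lambda>i. m h k i - h i - k i)"
        unfolding nrmJ_def sum.distrib [symmetric]
      proof (rule sum_mono)
        fix j assume "j \<in> J"
        have "w j - m h k j = (1 - s) * (w j - h j) - (k j - s * v j) - (m h k j - h j - k j)"
          unfolding v(3) [OF \<open>j \<in> J\<close>] by (simp add: algebra_simps)
        then show "\<bar>w j - m h k j\<bar> \<le> \<bar>(1 - s) * (w j - h j)\<bar> + \<bar>k j - s * v j\<bar> + \<bar>m h k j - h j - k j\<bar>"
          by linarith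
      qed
      also have "\<dots> \<le> (1 - s) * d + d / 4 * s + d / 4 * s"
      proof -
        have 1: "nrmJ (\<lambda>i. (1 - s) * (w i - h i)) = (1 - s) * d"
          using s(3) by (simp add: nrmJ_def d_def abs_mult sum_distrib_left)
        have "\<eta> * nrm n k \<le> \<eta> * (s * M)" using kn \<eta>(1) by (intro mult_left_mono) auto
        also have "\<dots> = (\<eta> * (C + 1)) * (s * d)" by (simp add: M_def algebra_simps)
        also have "\<dots> = d / 4 * s" unfolding \<eta>(3) by simp
        finally have "nrmJ (\<lambda>i. m h k i - h i - k i) \<le> d / 4 * s"
          using mk nrmJ_le [of "\<lambda>i. m h k i - h i - k i"] by linarith
        then show ?thesis using 1 k(2) nrmJ_le [of "\<lambda>i. k i - s * v i"] by linarith
      qed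
      also have "\<dots> < d" using mult_pos_pos [OF s(1) d0] by (simp add: algebra_simps)
      finally show False by simp
    qed
    then have "\<forall>j\<in>J. h j = w j"
      unfolding d_def nrmJ_def using finite_J by (simp add: sum_nonneg_eq_0_iff)
    then show "\<exists>h\<in>L. nrm n h < \<rho> \<and> (\<forall>j\<in>J. h j = w j)" using hL \<rho>' by force
  qed
qed

end

section \<open>Smoothness of a closed local subgroup\<close>

lemma Ck_on_det:
  assumes U: "openin (Euclidean_space n) U"
    and P: "\<And>i j. i < d \<Longrightarrow> j < d \<Longrightarrow> Ck_on k n U (P i j)"
  shows "Ck_on k n U (\<lambda>x. det (mat d d (\<lambda>(i, j). P i j x)))"
proof -
  have "det (mat d d (\<lambda>(i, j). P i j x)) =
      (\<Sum>p | p permutes {0..<d}. signof p * (\<Prod>i = 0..<d. P i (p i) x))" for x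
  proof -
    have "(\<Prod>i = 0..<d. mat d d (\<lambda>(i, j). P i j x) $$ (i, p i)) = (\<Prod>i = 0..<d. P i (p i) x)"
      if "p permutes {0..<d}" for p
      using permutes_in_image [OF that] by (intro prod.cong) auto
    then show ?thesis by (simp add: det_def' [of _ d])
  qed
  moreover have "Ck_on k n U (\<lambda>x. \<Sum>p | p permutes {0..<d}. signof p * (\<Prod>i = 0..<d. P i (p i) x))"
  proof (intro Ck_on_sum Ck_on_mult Ck_on_const Ck_on_prod U)
    fix p i assume "p \<in> {p. p permutes {0..<d}}" "i \<in> {0..<d}"
    then show "Ck_on k n U (P i (p i))" using permutes_in_image [of p "{0..<d}" i] P by auto
  qed
  ultimately show ?thesis by simp
qed

text \<open>Cramer's rule: the inverse is the adjugate over the determinant, both polynomial in the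
  entries. Invertibility enters as a trivial kernel, the form in which it is verified for matrices
  near the identity.\<close>

lemma smooth_matrix_inverse:
  fixes P :: "nat \<Rightarrow> nat \<Rightarrow> (nat \<Rightarrow> real) \<Rightarrow> real"
  assumes U: "openin (Euclidean_space n) U"
    and P: "\<And>i j k. i < d \<Longrightarrow> j < d \<Longrightarrow> Ck_on k n U (P i j)"
    and inj: "\<And>x w. x \<in> U \<Longrightarrow> (\<forall>i<d. (\<Sum>j<d. P i j x * w j) = 0) \<Longrightarrow> \<forall>j<d. w j = 0"
  obtains Q where "\<And>i j k. i < d \<Longrightarrow> j < d \<Longrightarrow> Ck_on k n U (Q i j)"
    "\<And>x i j. x \<in> U \<Longrightarrow> i < d \<Longrightarrow> j < d \<Longrightarrow> (\<Sum>k<d. Q i k x * P k j x) = (if i = j then 1 else 0)"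
proof -
  define M where "M = (\<lambda>x. mat d d (\<lambda>(i, j). P i j x))"
  have M: "M x \<in> carrier_mat d d" for x unfolding M_def by simp
  have det: "det (M x) \<noteq> 0" if x: "x \<in> U" for x
  proof
    assume "det (M x) = 0"
    then obtain v where v: "v \<in> carrier_vec d" "v \<noteq> 0\<^sub>v d" "M x *\<^sub>v v = 0\<^sub>v d"
      using det_0_iff_vec_prod_zero_field [OF M] by blast
    have "(\<Sum>j<d. P i j x * vec_index v j) = 0" if i: "i < d" for i
    proof -
      have "vec_index (M x *\<^sub>v v) i = 0" using v(3) i by simp
      moreover have "vec_index (M x *\<^sub>v v) i = (\<Sum>j = 0..<d. P i j x * vec_index v j)"
        using i v(1) by (simp add: M_def scalar_prod_def row_def)
      ultimately show ?thesis by (simp add: lessThan_atLeast0)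
    qed
    then have "\<forall>j<d. vec_index v j = 0" using inj [OF x] by blast
    then have "v = 0\<^sub>v d" using v(1) by (intro eq_vecI) auto
    with v(2) show False by simp
  qed
  define Q where "Q = (\<lambda>i j x. inverse (det (M x)) * adj_mat (M x) $$ (i, j))"
  have detM: "Ck_on k n U (\<lambda>x. det (M x))" for k
    unfolding M_def by (rule Ck_on_det [OF U P])
  have adj: "Ck_on k n U (\<lambda>x. adj_mat (M x) $$ (i, j))" if ij: "i < d" "j < d" for i j k
  proof -
    \<comment> \<open>The entries of the minor without row \<open>j\<close> and column
      \<open>i\<close>; the indices are exchanged because the adjugate is the transposed cofactor
      matrix.\<close>
    let ?P = "\<lambda>a b x. P (if a < j then a else Suc a) (if b < i then b else Suc b) x"
    have "mat_delete (M x) j i = mat (d - 1) (d - 1) (\<lambda>(a, b). ?P a b x)" for x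
      unfolding mat_delete_def M_def using ij by (intro eq_matI) auto
    then have "adj_mat (M x) $$ (i, j) = (- 1) ^ (j + i) * det (mat (d - 1) (d - 1) (\<lambda>(a, b). ?P a b x))" for x
      using ij M [of x] by (simp add: adj_mat_def cofactor_def)
    moreover have "Ck_on k n U (\<lambda>x. (- 1) ^ (j + i) * det (mat (d - 1) (d - 1) (\<lambda>(a, b). ?P a b x)))"
      by (intro Ck_on_mult Ck_on_const Ck_on_det U P) (use ij in auto)
    ultimately show ?thesis by simp
  qed
  show thesis
  proof (rule that [of Q])
    show "Ck_on k n U (Q i j)" if "i < d" "j < d" for i j k
      unfolding Q_def by (intro Ck_on_mult Ck_on_inverse U detM adj that det)
    fix x i j assume x: "x \<in> U" and ij: "i < d" "j < d"
    have "(adj_mat (M x) * M x) $$ (i, j) = (det (M x) \<cdot>\<^sub>m 1\<^sub>m d) $$ (i, j)"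
      using adj_mat(3) [OF M] by simp
    moreover have "(adj_mat (M x) * M x) $$ (i, j) = (\<Sum>k<d. adj_mat (M x) $$ (i, k) * P k j x)"
      using ij adj_mat(1) [OF M, of x] M [of x]
      by (simp add: scalar_prod_def lessThan_atLeast0) (intro sum.cong, auto simp: M_def)
    ultimately have "(\<Sum>k<d. adj_mat (M x) $$ (i, k) * P k j x) = det (M x) * (if i = j then 1 else 0)"
      using ij by simp
    then show "(\<Sum>k<d. Q i k x * P k j x) = (if i = j then 1 else 0)"
      using det [OF x] by (simp add: Q_def mult.assoc sum_distrib_left [symmetric])
  qed
qed

text \<open>\<open>A i k x\<close> is the matrix of the differential at the origin of left
  translation by \<open>x\<close>. The map \<sigma> numbers the coordinates in \<open>J\<close>, so
  that the graph is parametrized by d-space.\<close>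

locale local_lie_subgroup = local_subgroup_coordinates +
  fixes A :: "nat \<Rightarrow> nat \<Rightarrow> (nat \<Rightarrow> real) \<Rightarrow> real" and \<sigma> :: "nat \<Rightarrow> nat" and d :: nat
  assumes \<sigma>: "bij_betw \<sigma> {..<d} J"
    and A_smooth: "\<And>i k l. \<lbrakk>i < n; k < n\<rbrakk> \<Longrightarrow> Ck_on l n {x \<in> esp n. nrm n x < r} (A i k)"
    and A_deriv: "\<lbrakk>x \<in> esp n; nrm n x < r; \<epsilon> > 0\<rbrakk> \<Longrightarrow> \<exists>\<delta>>0. \<forall>u\<in>esp n. nrm n u < \<delta> \<longrightarrow>
        (\<forall>i<n. \<bar>m x u i - x i - (\<Sum>k<n. A i k x * u k)\<bar> \<le> \<epsilon> * nrm n u)"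
    and A_zero: "\<And>i k. \<lbrakk>i < n; k < n\<rbrakk> \<Longrightarrow> A i k (\<lambda>_. 0) = (if i = k then 1 else 0)"
begin

lemma \<sigma>_J: "a < d \<Longrightarrow> \<sigma> a \<in> J"
  using \<sigma> by (auto simp: bij_betw_def)

lemma \<sigma>_n: "a < d \<Longrightarrow> \<sigma> a < n"
  using \<sigma>_J J by auto

lemma \<sigma>_eq: "\<lbrakk>a < d; b < d\<rbrakk> \<Longrightarrow> \<sigma> a = \<sigma> b \<longleftrightarrow> a = b"
  using \<sigma> by (auto simp: bij_betw_def inj_on_def)

lemma sum_J: "(\<Sum>j\<in>J. f j) = (\<Sum>a<d. f (\<sigma> a))"
  using sum.reindex_bij_betw [OF \<sigma>] by metis

definition proj :: "(nat \<Rightarrow> real) \<Rightarrow> nat \<Rightarrow> real" where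
  "proj x = (\<lambda>a. if a < d then x (\<sigma> a) else 0)"

lemma proj_esp: "proj x \<in> esp d"
  by (simp add: proj_def topspace_Euclidean_space)

lemma nrmJ_proj: "nrmJ (\<lambda>i. y i - x i) = nrm d (\<lambda>a. proj y a - proj x a)"
  by (simp add: nrmJ_def nrm_def proj_def sum_J)

lemma proj_onto:
  assumes "\<rho> > 0"
  obtains \<delta> where "\<delta> > 0" "\<And>w. w \<in> esp d \<Longrightarrow> nrm d w < \<delta> \<Longrightarrow> \<exists>h\<in>L. nrm n h < \<rho> \<and> proj h = w"
proof -
  obtain \<delta> where \<delta>: "\<delta> > 0" "\<And>w. nrmJ w < \<delta> \<Longrightarrow> \<exists>h\<in>L. nrm n h < \<rho> \<and> (\<forall>j\<in>J. h j = w j)"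
    using L_projection_onto [OF assms] by blast
  show thesis
  proof (rule that [OF \<delta>(1)])
    fix w assume w: "w \<in> esp d" "nrm d w < \<delta>"
    define w' where "w' = (\<lambda>i. w (inv_into {..<d} \<sigma> i))"
    have w': "w' (\<sigma> a) = w a" if "a < d" for a
      using that \<sigma> by (simp add: w'_def bij_betw_def inv_into_f_f)
    then have "nrmJ w' = nrm d w" by (simp add: nrmJ_def nrm_def sum_J)
    then obtain h where h: "h \<in> L" "nrm n h < \<rho>" "\<forall>j\<in>J. h j = w' j" using \<delta>(2) [of w'] w by auto
    have "proj h = w"
      by (rule esp_eqI [OF proj_esp w(1)]) (simp add: proj_def h(3) \<sigma>_J w')
    then show "\<exists>h\<in>L. nrm n h < \<rho> \<and> proj h = w" using h by blast
  qed
qed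

text \<open>Column \<open>b\<close> is the tangent vector \<open>e (\<sigma> b)\<close> translated
  to \<open>x\<close>; the columns span the expected tangent space of \<open>L\<close> at
  \<open>x\<close>.\<close>

definition B :: "nat \<Rightarrow> nat \<Rightarrow> (nat \<Rightarrow> real) \<Rightarrow> real" where
  "B i b x = (\<Sum>k<n. A i k x * e (\<sigma> b) k)"

lemma B_smooth: "i < n \<Longrightarrow> b < d \<Longrightarrow> Ck_on l n {x \<in> esp n. nrm n x < r} (B i b)"
  unfolding B_def by (intro Ck_on_sum Ck_on_mult Ck_on_const nrm_ball_open A_smooth) auto

lemma B_zero: "a < d \<Longrightarrow> b < d \<Longrightarrow> B (\<sigma> a) b (\<lambda>_. 0) = (if a = b then 1 else 0)"
proof -
  assume ab: "a < d" "b < d"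
  have "B (\<sigma> a) b (\<lambda>_. 0) = (\<Sum>k<n. if \<sigma> a = k then e (\<sigma> b) k else 0)"
    unfolding B_def by (rule sum.cong) (auto simp: A_zero \<sigma>_n ab)
  also have "\<dots> = e (\<sigma> b) (\<sigma> a)" using \<sigma>_n [OF ab(1)] by simp
  finally show ?thesis using ab by (auto simp: e_J \<sigma>_J \<sigma>_eq)
qed

text \<open>At the origin the block of \<open>B\<close> in the coordinates of \<open>J\<close> is
  the identity. As long as the entries of its deviation have absolute sum below 1, a kernel vector
  would be shorter than itself.\<close>

lemma B_inverse:
  obtains \<rho> Q where "\<rho> > 0" "\<rho> \<le> r"
    "\<And>a b l. a < d \<Longrightarrow> b < d \<Longrightarrow> Ck_on l n {x \<in> esp n. nrm n x < \<rho>} (Q a b)"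
    "\<And>x a b. \<lbrakk>x \<in> esp n; nrm n x < \<rho>; a < d; b < d\<rbrakk> \<Longrightarrow>
       (\<Sum>c<d. Q a c x * B (\<sigma> c) b x) = (if a = b then 1 else 0)"
proof -
  let ?f = "\<lambda>x. \<Sum>a<d. \<Sum>b<d. \<bar>B (\<sigma> a) b x - (if a = b then 1 else 0)\<bar>"
  have "continuous_map (subtopology (Euclidean_space n) {x \<in> esp n. nrm n x < r}) euclideanreal (B (\<sigma> a) b)"
    if "a < d" "b < d" for a b
    using B_smooth [OF \<sigma>_n [OF that(1)] that(2), of 0] by simp
  then have "Ck_on 0 n {x \<in> esp n. nrm n x < r} ?f"
    by (auto intro!: continuous_intros)
  moreover have "?f (\<lambda>_. 0) = 0" by (simp add: B_zero)
  ultimately obtain \<delta> where \<delta>: "\<delta> > 0"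
    "\<And>y. y \<in> esp n \<Longrightarrow> nrm n (\<lambda>i. y i - 0) < \<delta> \<Longrightarrow> y \<in> {x \<in> esp n. nrm n x < r} \<and> \<bar>?f y - 0\<bar> < 1"
    using Ck_on_ball [OF nrm_ball_open [of n r], of 0 ?f "\<lambda>_. 0" 1] r by auto
  define \<rho> where "\<rho> = min \<delta> r"
  have sub: "{x \<in> esp n. nrm n x < \<rho>} \<subseteq> {x \<in> esp n. nrm n x < r}" by (auto simp: \<rho>_def)
  have inj: "\<forall>j<d. w j = 0"
    if x: "x \<in> {x \<in> esp n. nrm n x < \<rho>}" and w: "\<forall>a<d. (\<Sum>b<d. B (\<sigma> a) b x * w b) = 0" for x w
  proof -
    have f1: "?f x < 1" using \<delta>(2) [of x] x by (simp add: \<rho>_def)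
    have "(\<Sum>a<d. \<bar>w a\<bar>) \<le> (\<Sum>a<d. \<Sum>b<d. \<bar>B (\<sigma> a) b x - (if a = b then 1 else 0)\<bar> * (\<Sum>a<d. \<bar>w a\<bar>))"
    proof (rule sum_mono)
      fix a assume a: "a \<in> {..<d}"
      have "(\<Sum>b<d. (if a = b then 1 else 0) * w b) = (\<Sum>b<d. if a = b then w b else 0)"
        by (rule sum.cong) auto
      then have "(\<Sum>b<d. (B (\<sigma> a) b x - (if a = b then 1 else 0)) * w b) = - w a"
        using w a by (simp add: left_diff_distrib sum_subtractf)
      then have "\<bar>w a\<bar> = \<bar>\<Sum>b<d. (B (\<sigma> a) b x - (if a = b then 1 else 0)) * w b\<bar>" by simp
      also have "\<dots> \<le> (\<Sum>b<d. \<bar>B (\<sigma> a) b x - (if a = b then 1 else 0)\<bar> * \<bar>w b\<bar>)"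
        unfolding abs_mult [symmetric] by (rule sum_abs)
      also have "\<dots> \<le> (\<Sum>b<d. \<bar>B (\<sigma> a) b x - (if a = b then 1 else 0)\<bar> * (\<Sum>a<d. \<bar>w a\<bar>))"
        by (intro sum_mono mult_left_mono member_le_sum) auto
      finally show "\<bar>w a\<bar> \<le> (\<Sum>b<d. \<bar>B (\<sigma> a) b x - (if a = b then 1 else 0)\<bar> * (\<Sum>a<d. \<bar>w a\<bar>))" .
    qed
    then have le: "(\<Sum>a<d. \<bar>w a\<bar>) \<le> ?f x * (\<Sum>a<d. \<bar>w a\<bar>)"
      by (simp add: sum_distrib_right)
    have "(\<Sum>a<d. \<bar>w a\<bar>) = 0"
    proof (rule ccontr)
      assume "(\<Sum>a<d. \<bar>w a\<bar>) \<noteq> 0"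
      then have "(\<Sum>a<d. \<bar>w a\<bar>) > 0" by (simp add: less_le sum_nonneg)
      with f1 have "?f x * (\<Sum>a<d. \<bar>w a\<bar>) < 1 * (\<Sum>a<d. \<bar>w a\<bar>)" by (rule mult_strict_right_mono)
      with le show False by simp
    qed
    then show ?thesis by (simp add: sum_nonneg_eq_0_iff)
  qed
  obtain Q where Q: "\<And>i j k. i < d \<Longrightarrow> j < d \<Longrightarrow> Ck_on k n {x \<in> esp n. nrm n x < \<rho>} (Q i j)"
    "\<And>x i j. x \<in> {x \<in> esp n. nrm n x < \<rho>} \<Longrightarrow> i < d \<Longrightarrow> j < d \<Longrightarrow>
      (\<Sum>k<d. Q i k x * B (\<sigma> k) j x) = (if i = j then 1 else 0)"
  proof (rule smooth_matrix_inverse [OF nrm_ball_open [of _ \<rho>], where P = "\<lambda>a b. B (\<sigma> a) b" and d = d])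
    show "Ck_on k n {x \<in> esp n. nrm n x < \<rho>} (B (\<sigma> a) b)" if "a < d" "b < d" for a b k
      by (rule Ck_on_subset [OF B_smooth [OF \<sigma>_n [OF that(1)] that(2)] sub])
  qed (use inj in blast)+
  show thesis by (rule that [of \<rho> Q]) (use \<delta> r Q in \<open>auto simp: \<rho>_def\<close>)
qed

text \<open>The map \<open>\<Gamma>\<close> inverts the projection of \<open>L\<close>. To
  differentiate it at \<open>w\<close>, write \<open>\<Gamma> (w(j := t)) = m h u\<close> with
  \<open>h = \<Gamma> w\<close>. The element \<open>u\<close> lies in \<open>L\<close> and is nearly
  tangent, so the increment is nearly \<open>B h\<close> applied to the coordinates of
  \<open>u\<close> in \<open>J\<close>. The increment is known in those coordinates, and
  \<open>Q h\<close> inverts that block; hence \<partial>_j of \<open>\<Gamma>\<close> is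
  \<open>B\<close> times column \<open>j\<close> of \<open>Q\<close>, both taken at
  \<open>\<Gamma> w\<close>.\<close>

theorem graph:
  assumes R: "R > 0"
  obtains \<rho> D \<Gamma> where "0 < \<rho>" "\<rho> \<le> R" "openin (Euclidean_space d) D" "(\<lambda>_. 0) \<in> D"
    "\<And>w. w \<in> D \<Longrightarrow> \<Gamma> w \<in> L \<and> nrm n (\<Gamma> w) < \<rho> \<and> proj (\<Gamma> w) = w"
    "\<And>x. \<lbrakk>x \<in> L; nrm n x < \<rho>; proj x \<in> D\<rbrakk> \<Longrightarrow> \<Gamma> (proj x) = x"
    "\<And>i k. i < n \<Longrightarrow> Ck_on k d D (\<lambda>w. \<Gamma> w i)"
proof -
  obtain \<rho>1 Q where \<rho>1: "\<rho>1 > 0" "\<rho>1 \<le> r"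
    and Q: "\<And>a b l. a < d \<Longrightarrow> b < d \<Longrightarrow> Ck_on l n {x \<in> esp n. nrm n x < \<rho>1} (Q a b)"
    and QB: "\<And>x a b. \<lbrakk>x \<in> esp n; nrm n x < \<rho>1; a < d; b < d\<rbrakk> \<Longrightarrow>
       (\<Sum>c<d. Q a c x * B (\<sigma> c) b x) = (if a = b then 1 else 0)"
    by (rule B_inverse) blast
  obtain \<rho>2 where \<rho>2: "\<rho>2 > 0" and lip0: "\<And>x y. \<lbrakk>x \<in> L; y \<in> L; nrm n x < \<rho>2; nrm n y < \<rho>2\<rbrakk> \<Longrightarrow>
      nrm n (\<lambda>i. y i - x i) \<le> 2 * C * nrmJ (\<lambda>i. y i - x i)"
    using L_lipschitz by blast
  obtain \<rho>3 where \<rho>3: "\<rho>3 > 0" "\<rho>3 \<le> r"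
    and q2: "\<And>x y. \<lbrakk>x \<in> esp n; y \<in> esp n; nrm n x < \<rho>3; nrm n y < \<rho>3\<rbrakk> \<Longrightarrow>
       nrm n (\<lambda>i. y i - x i - q x y i) \<le> 1 * nrm n (\<lambda>i. y i - x i) \<and>
       nrm n (q x y) \<le> 2 * nrm n (\<lambda>i. y i - x i)"
  proof -
    have "(1 :: real) > 0" by simp
    from q_near_diff [OF this] show thesis using that by blast
  qed
  define \<rho> where "\<rho> = min (min \<rho>1 \<rho>2) (min \<rho>3 R)"
  have \<rho>: "\<rho> > 0" "\<rho> \<le> \<rho>1" "\<rho> \<le> \<rho>2" "\<rho> \<le> \<rho>3" "\<rho> \<le> R" "\<rho> \<le> r"
    unfolding \<rho>_def using \<rho>1 \<rho>2 \<rho>3 R by auto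
  have lip: "nrm n (\<lambda>i. y i - x i) \<le> 2 * C * nrm d (\<lambda>a. proj y a - proj x a)"
    if "x \<in> L" "y \<in> L" "nrm n x < \<rho>" "nrm n y < \<rho>" for x y
    using lip0 [OF that(1,2)] that(3,4) \<rho>(3) by (simp add: nrmJ_proj)
  have uniq: "x = y" if "x \<in> L" "y \<in> L" "nrm n x < \<rho>" "nrm n y < \<rho>" "proj x = proj y" for x y
  proof -
    have "nrm n (\<lambda>i. y i - x i) \<le> 0" using lip [OF that(1-4)] that(5) by simp
    then have "nrm n (\<lambda>i. y i - x i) = 0" using nrm_nonneg order_antisym by blast
    then show ?thesis using nrm_eq_0 [OF L_esp [OF that(2)] L_esp [OF that(1)]] by simp
  qed
  obtain \<delta> where \<delta>: "\<delta> > 0" "\<And>w. w \<in> esp d \<Longrightarrow> nrm d w < \<delta> \<Longrightarrow> \<exists>h\<in>L. nrm n h < \<rho> \<and> proj h = w"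
    using proj_onto [OF \<rho>(1)] by blast
  define D where "D = {w \<in> esp d. nrm d w < \<delta>}"
  have D: "openin (Euclidean_space d) D" using openin_nrm_ball [of d "\<lambda>_. 0" \<delta>] by (simp add: D_def)
  \<comment> \<open>On \<open>D\<close> such a point exists by \<open>proj_onto\<close> and is
    unique by \<open>uniq\<close>; elsewhere the value is arbitrary.\<close>
  define \<Gamma> where "\<Gamma> = (\<lambda>w. SOME h. h \<in> L \<and> nrm n h < \<rho> \<and> proj h = w)"
  have \<Gamma>: "\<Gamma> w \<in> L \<and> nrm n (\<Gamma> w) < \<rho> \<and> proj (\<Gamma> w) = w" if "w \<in> D" for w
  proof -
    have "\<exists>h. h \<in> L \<and> nrm n h < \<rho> \<and> proj h = w" using \<delta>(2) [of w] that unfolding D_def by blast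
    then show ?thesis unfolding \<Gamma>_def by (rule someI_ex)
  qed
  have \<Gamma>_lip: "nrm n (\<lambda>i. \<Gamma> w' i - \<Gamma> w i) \<le> 2 * C * nrm d (\<lambda>a. w' a - w a)" if "w \<in> D" "w' \<in> D" for w w'
    using lip [of "\<Gamma> w" "\<Gamma> w'"] \<Gamma> that by simp
  have deriv: "((\<lambda>t. \<Gamma> (w(j := t)) i) has_real_derivative (\<Sum>b<d. B i b (\<Gamma> w) * Q b j (\<Gamma> w))) (at (w j))"
    if w: "w \<in> D" and j: "j < d" and i: "i < n" for w i j
  proof -
    define h X where "h = \<Gamma> w" and "X = (\<Sum>b<d. B i b h * Q b j h)"
    have h: "h \<in> L" "h \<in> esp n" "nrm n h < \<rho>" "proj h = w" unfolding h_def using \<Gamma> [OF w] L_esp by auto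
    let ?R = "\<lambda>t. \<Gamma> (w(j := t)) i - h i - X * (t - w j)"
    \<comment> \<open>\<open>M\<close> and \<open>N\<close> bound the amplification of errors by
      \<open>A h\<close> and by \<open>B h\<close> after \<open>Q h\<close>. The 1 in each stands
      for the error that is passed on unchanged.\<close>
    define M where "M = 1 + (\<Sum>i<n. \<Sum>k<n. \<bar>A i k h\<bar>)"
    define N where "N = 1 + (\<Sum>b<d. \<bar>B i b h\<bar> * (\<Sum>a<d. \<bar>Q b a h\<bar>))"
    have MN: "M \<ge> 1" "N \<ge> 1" unfolding M_def N_def by (auto intro!: sum_nonneg mult_nonneg_nonneg)
    have "(?R has_real_derivative 0) (at (w j))"
    proof (rule has_real_derivative_0I)
      fix \<epsilon> :: real assume \<epsilon>: "\<epsilon> > 0"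
      \<comment> \<open>The factor \<open>4 * C\<close> comes from
        \<open>nrm n u \<le> 4 * C * \<bar>t - w j\<bar>\<close>, the factor \<open>N * M\<close>
        from the two matrix estimates.\<close>
      define \<eta> where "\<eta> = \<epsilon> / (N * M * (4 * C))"
      have \<eta>: "\<eta> > 0" "N * (M * \<eta>) * (4 * C) = \<epsilon>" unfolding \<eta>_def using \<epsilon> MN C by auto
      have "nrm n h < r" using h \<rho> by simp
      then obtain a where a: "a > 0" "\<And>u. u \<in> esp n \<Longrightarrow> nrm n u < a \<Longrightarrow>
          \<forall>i<n. \<bar>m h u i - h i - (\<Sum>k<n. A i k h * u k)\<bar> \<le> \<eta> * nrm n u"
        using A_deriv [OF h(2) _ \<eta>(1)] by blast
      obtain b where b: "b > 0" "\<And>u. \<lbrakk>u \<in> L; nrm n u < b\<rbrakk> \<Longrightarrow> nrm n (\<lambda>i. u i - pr u i) \<le> \<eta> * nrm n u"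
        using L_tangential [OF \<eta>(1)] by blast
      have "\<forall>\<^sub>F t in nhds (w j). \<bar>t - w j\<bar> < min a b / (4 * C)"
        unfolding eventually_nhds_metric using a(1) b(1) C
        by (intro exI[of _ "min a b / (4 * C)"]) (auto simp: dist_real_def)
      then show "\<forall>\<^sub>F t in nhds (w j). \<bar>?R t\<bar> \<le> \<epsilon> * \<bar>t - w j\<bar>"
        using eventually_fun_upd [OF D w j]
      proof eventually_elim
        case (elim t)
        define h' where "h' = \<Gamma> (w(j := t))"
        have h': "h' \<in> L" "h' \<in> esp n" "nrm n h' < \<rho>" "proj h' = w(j := t)"
          unfolding h'_def using \<Gamma> [OF elim(2)] L_esp by auto
        define u where "u = q h h'"
        have u: "u \<in> L" "u \<in> esp n" "m h u = h'"
          unfolding u_def using L_q [OF h(1) h'(1)] q_esp [OF h(2) h'(2)] h h' \<rho> by auto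
        have "nrm n u \<le> 2 * nrm n (\<lambda>i. h' i - h i)"
          unfolding u_def using q2 [OF h(2) h'(2)] h h' \<rho> by simp
        also have "\<dots> \<le> 2 * (2 * C * nrm d (\<lambda>a. (w(j := t)) a - w a))"
          using \<Gamma>_lip [OF w elim(2)] unfolding h'_def h_def by simp
        also have "\<dots> = (4 * C) * \<bar>t - w j\<bar>" by (simp only: nrm_fun_upd [OF j])
        finally have un: "nrm n u \<le> (4 * C) * \<bar>t - w j\<bar>" .
        have "(4 * C) * \<bar>t - w j\<bar> < min a b" using elim(1) C by (simp add: field_simps)
        then have uab: "nrm n u < a" "nrm n u < b" using un by auto
        define E where "E = M * \<eta> * nrm n u"
        \<comment> \<open>Expand \<open>m h u\<close> to first order and replace \<open>u\<close> by
          \<open>pr u\<close>, which depends only on the coordinates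
          \<open>u (\<sigma> b)\<close>.\<close>
        have F: "\<bar>h' l - h l - (\<Sum>b<d. B l b h * u (\<sigma> b))\<bar> \<le> E" if l: "l < n" for l
        proof -
          have "(\<Sum>b<d. B l b h * u (\<sigma> b)) = (\<Sum>b<d. \<Sum>k<n. A l k h * (u (\<sigma> b) * e (\<sigma> b) k))"
            by (simp add: B_def sum_distrib_right sum_distrib_left mult_ac)
          also have "\<dots> = (\<Sum>k<n. A l k h * pr u k)"
            unfolding pr_def sum_J sum_distrib_left by (rule sum.swap)
          finally have "h' l - h l - (\<Sum>b<d. B l b h * u (\<sigma> b)) =
              (m h u l - h l - (\<Sum>k<n. A l k h * u k)) + (\<Sum>k<n. A l k h * (u k - pr u k))"
            by (simp add: u(3) right_diff_distrib sum_subtractf)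
          moreover have "\<bar>m h u l - h l - (\<Sum>k<n. A l k h * u k)\<bar> \<le> \<eta> * nrm n u"
            using a(2) [OF u(2) uab(1)] l by blast
          moreover have "\<bar>\<Sum>k<n. A l k h * (u k - pr u k)\<bar> \<le> (M - 1) * (\<eta> * nrm n u)"
          proof -
            have "\<bar>\<Sum>k<n. A l k h * (u k - pr u k)\<bar> \<le> (\<Sum>k<n. \<bar>A l k h\<bar> * \<bar>u k - pr u k\<bar>)"
              unfolding abs_mult [symmetric] by (rule sum_abs)
            also have "\<dots> \<le> (\<Sum>k<n. \<bar>A l k h\<bar> * (\<eta> * nrm n u))"
            proof (intro sum_mono mult_left_mono)
              fix k assume "k \<in> {..<n}"
              then have "\<bar>u k - pr u k\<bar> \<le> nrm n (\<lambda>i. u i - pr u i)" using component_le_nrm [of k n "\<lambda>i. u i - pr u i"] by simp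
              then show "\<bar>u k - pr u k\<bar> \<le> \<eta> * nrm n u" using b(2) [OF u(1) uab(2)] by linarith
            qed auto
            also have "\<dots> = (\<Sum>k<n. \<bar>A l k h\<bar>) * (\<eta> * nrm n u)" by (simp add: sum_distrib_right)
            also have "\<dots> \<le> (M - 1) * (\<eta> * nrm n u)"
            proof (rule mult_right_mono)
              show "(\<Sum>k<n. \<bar>A l k h\<bar>) \<le> M - 1"
                unfolding M_def using member_le_sum [of l "{..<n}" "\<lambda>i. \<Sum>k<n. \<bar>A i k h\<bar>"] l
                by (simp add: sum_nonneg)
            qed (use \<eta> in simp)
            finally show ?thesis .
          qed
          ultimately show ?thesis unfolding E_def by (simp add: algebra_simps)
        qed
        have E0: "E \<ge> 0" unfolding E_def using \<eta> MN by simp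
        \<comment> \<open>In the coordinates of \<open>J\<close> the increment \<open>h' - h\<close>
          is exactly \<open>t - w j\<close> in direction \<open>j\<close>. Applying
          \<open>Q h\<close> to the expansion \<open>F\<close> in these coordinates recovers
          \<open>u (\<sigma> c)\<close>.\<close>
        have G: "\<bar>Q c j h * (t - w j) - u (\<sigma> c)\<bar> \<le> (\<Sum>a<d. \<bar>Q c a h\<bar>) * E" if c: "c < d" for c
        proof -
          let ?\<tau> = "\<lambda>a. h' (\<sigma> a) - h (\<sigma> a)"
          have \<tau>: "?\<tau> a = (if a = j then t - w j else 0)" if "a < d" for a
          proof -
            have "?\<tau> a = proj h' a - proj h a" using that by (simp add: proj_def)
            then show ?thesis by (simp add: h'(4) h(4))
          qed
          have 1: "(\<Sum>a<d. Q c a h * ?\<tau> a) = Q c j h * (t - w j)"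
          proof -
            have "(\<Sum>a<d. Q c a h * ?\<tau> a) = (\<Sum>a<d. if a = j then Q c j h * (t - w j) else 0)"
              by (rule sum.cong) (auto simp: \<tau>)
            then show ?thesis using j by simp
          qed
          have 2: "(\<Sum>a<d. Q c a h * (\<Sum>b<d. B (\<sigma> a) b h * u (\<sigma> b))) = u (\<sigma> c)"
          proof -
            have "(\<Sum>a<d. Q c a h * (\<Sum>b<d. B (\<sigma> a) b h * u (\<sigma> b))) =
                (\<Sum>a<d. \<Sum>b<d. Q c a h * B (\<sigma> a) b h * u (\<sigma> b))"
              by (simp add: sum_distrib_left mult.assoc)
            also have "\<dots> = (\<Sum>b<d. \<Sum>a<d. Q c a h * B (\<sigma> a) b h * u (\<sigma> b))" by (rule sum.swap)
            also have "\<dots> = (\<Sum>b<d. (\<Sum>a<d. Q c a h * B (\<sigma> a) b h) * u (\<sigma> b))"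
              by (simp add: sum_distrib_right)
            also have "\<dots> = (\<Sum>b<d. if c = b then u (\<sigma> b) else 0)"
              by (rule sum.cong) (use QB [OF h(2)] h(3) \<rho>(2) c in auto)
            finally show ?thesis using c by simp
          qed
          have eq: "Q c j h * (t - w j) - u (\<sigma> c) = (\<Sum>a<d. Q c a h * (?\<tau> a - (\<Sum>b<d. B (\<sigma> a) b h * u (\<sigma> b))))"
          proof -
            have "Q c j h * (t - w j) - u (\<sigma> c) =
                (\<Sum>a<d. Q c a h * ?\<tau> a - Q c a h * (\<Sum>b<d. B (\<sigma> a) b h * u (\<sigma> b)))"
              unfolding sum_subtractf 1 2 ..
            then show ?thesis by (simp only: right_diff_distrib)
          qed
          have "\<bar>Q c j h * (t - w j) - u (\<sigma> c)\<bar> \<le> (\<Sum>a<d. \<bar>Q c a h\<bar> * \<bar>?\<tau> a - (\<Sum>b<d. B (\<sigma> a) b h * u (\<sigma> b))\<bar>)"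
            unfolding eq abs_mult [symmetric] by (rule sum_abs)
          also have "\<dots> \<le> (\<Sum>a<d. \<bar>Q c a h\<bar> * E)"
            by (intro sum_mono mult_left_mono F \<sigma>_n) auto
          finally show ?thesis by (simp add: sum_distrib_right)
        qed
        have "?R t = (h' i - h i - (\<Sum>b<d. B i b h * u (\<sigma> b))) - (\<Sum>b<d. B i b h * (Q b j h * (t - w j) - u (\<sigma> b)))"
          unfolding h'_def X_def by (simp add: right_diff_distrib sum_subtractf sum_distrib_right mult.assoc)
        moreover have "\<bar>\<Sum>b<d. B i b h * (Q b j h * (t - w j) - u (\<sigma> b))\<bar> \<le> (N - 1) * E"
        proof -
          have "\<bar>\<Sum>b<d. B i b h * (Q b j h * (t - w j) - u (\<sigma> b))\<bar> \<le>
              (\<Sum>b<d. \<bar>B i b h\<bar> * \<bar>Q b j h * (t - w j) - u (\<sigma> b)\<bar>)"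
            unfolding abs_mult [symmetric] by (rule sum_abs)
          also have "\<dots> \<le> (\<Sum>b<d. \<bar>B i b h\<bar> * ((\<Sum>a<d. \<bar>Q b a h\<bar>) * E))"
            by (intro sum_mono mult_left_mono G) auto
          finally show ?thesis by (simp add: N_def sum_distrib_right mult.assoc)
        qed
        ultimately have "\<bar>?R t\<bar> \<le> E + (N - 1) * E" using F [OF i] by linarith
        also have "\<dots> = N * (M * \<eta>) * nrm n u" by (simp add: E_def algebra_simps)
        also have "\<dots> \<le> N * (M * \<eta>) * ((4 * C) * \<bar>t - w j\<bar>)"
          using un MN \<eta> by (intro mult_left_mono) auto
        also have "\<dots> = \<epsilon> * \<bar>t - w j\<bar>" using \<eta>(2) by (simp add: mult.assoc)
        finally show ?case .
      qed
    qed (simp add: h_def)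
    moreover have "((\<lambda>t. h i + X * (t - w j)) has_real_derivative X) (at (w j))"
      by (auto intro!: derivative_eq_intros)
    ultimately have "((\<lambda>t. ?R t + (h i + X * (t - w j))) has_real_derivative 0 + X) (at (w j))"
      by (rule DERIV_add)
    then show ?thesis by (simp add: X_def h_def)
  qed
  \<comment> \<open>Bootstrapping: the right-hand side of the differential equation is a smooth
    function of \<open>\<Gamma> w\<close>, so \<open>\<Gamma>\<close> of class C^k has derivatives
    of class C^k. The Lipschitz bound starts the induction.\<close>
  have smooth: "\<forall>i<n. Ck_on k d D (\<lambda>w. \<Gamma> w i)" for k
  proof (induction k)
    case 0
    show ?case
      unfolding Ck_on_0_iff [OF D]
    proof (intro allI impI ballI)
      fix i w and \<epsilon> :: real assume i: "i < n" and w: "w \<in> D" and \<epsilon>: "\<epsilon> > 0"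
      obtain a where a: "a > 0" "\<And>y. y \<in> esp d \<Longrightarrow> nrm d (\<lambda>i. y i - w i) < a \<Longrightarrow> y \<in> D"
        using openin_esp_ball [OF D w] by blast
      show "\<exists>\<delta>>0. \<forall>y\<in>esp d. nrm d (\<lambda>i. y i - w i) < \<delta> \<longrightarrow> y \<in> D \<and> \<bar>\<Gamma> y i - \<Gamma> w i\<bar> < \<epsilon>"
      proof (intro exI[of _ "min a (\<epsilon> / (2 * C))"] conjI ballI impI)
        show "0 < min a (\<epsilon> / (2 * C))" using a \<epsilon> C by simp
        fix y assume y: "y \<in> esp d" "nrm d (\<lambda>i. y i - w i) < min a (\<epsilon> / (2 * C))"
        then show yD: "y \<in> D" using a(2) by simp
        have "\<bar>\<Gamma> y i - \<Gamma> w i\<bar> \<le> nrm n (\<lambda>i. \<Gamma> y i - \<Gamma> w i)"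
          using component_le_nrm [OF i, of "\<lambda>i. \<Gamma> y i - \<Gamma> w i"] .
        also have "\<dots> \<le> 2 * C * nrm d (\<lambda>a. y a - w a)" by (rule \<Gamma>_lip [OF w yD])
        also have "\<dots> < \<epsilon>" using y(2) C by (simp add: field_simps)
        finally show "\<bar>\<Gamma> y i - \<Gamma> w i\<bar> < \<epsilon>" .
      qed
    qed
  next
    case (Suc k)
    show ?case
    proof (intro allI impI)
      fix i assume i: "i < n"
      show "Ck_on (Suc k) d D (\<lambda>w. \<Gamma> w i)"
      proof (rule Ck_on_SucI [OF D])
        show "Ck_on 0 d D (\<lambda>w. \<Gamma> w i)" using Ck_on_imp_0 Suc i by blast
        show "((\<lambda>t. \<Gamma> (w(j := t)) i) has_real_derivative (\<Sum>b<d. B i b (\<Gamma> w) * Q b j (\<Gamma> w))) (at (w j))"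
          if "w \<in> D" "j < d" for w j using deriv [OF that i] .
        show "Ck_on k d D (\<lambda>w. \<Sum>b<d. B i b (\<Gamma> w) * Q b j (\<Gamma> w))" if j: "j < d" for j
        proof (rule Ck_on_compose [OF D nrm_ball_open [of _ \<rho>], where g = \<Gamma> and f = "\<lambda>x. \<Sum>b<d. B i b x * Q b j x"])
          show "\<Gamma> w \<in> {x \<in> esp n. nrm n x < \<rho>}" if "w \<in> D" for w using \<Gamma> [OF that] L_esp by auto
          show "Ck_on k d D (\<lambda>w. \<Gamma> w l)" if "l < n" for l using Suc that by blast
          have s1: "{x \<in> esp n. nrm n x < \<rho>} \<subseteq> {x \<in> esp n. nrm n x < r}"
            and s2: "{x \<in> esp n. nrm n x < \<rho>} \<subseteq> {x \<in> esp n. nrm n x < \<rho>1}" using \<rho> by auto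
          show "Ck_on k n {x \<in> esp n. nrm n x < \<rho>} (\<lambda>x. \<Sum>b<d. B i b x * Q b j x)"
            by (intro Ck_on_sum Ck_on_mult nrm_ball_open Ck_on_subset [OF B_smooth s1] Ck_on_subset [OF Q s2] i j) auto
        qed
      qed
    qed
  qed
  show thesis
  proof (rule that [OF \<rho>(1,5) D])
    show "(\<lambda>_. 0) \<in> D" using \<delta>(1) by (simp add: D_def)
    show "\<Gamma> (proj x) = x" if "x \<in> L" "nrm n x < \<rho>" "proj x \<in> D" for x
      using uniq [of "\<Gamma> (proj x)" x] \<Gamma> [OF that(3)] that by blast
  qed (use \<Gamma> smooth in auto)
qed

end

section \<open>Topological groups\<close>

context topological_group
begin

lemma openin_carrier: "openin T W \<Longrightarrow> x \<in> W \<Longrightarrow> x \<in> carrier G"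
  using openin_subset topspace_eq_carrier by blast

lemma openin_carrier_all: "openin T (carrier G)"
  using openin_topspace [of T] by (simp only: topspace_eq_carrier)

lemma continuous_mult_maps:
  assumes "continuous_map X T f" "continuous_map X T g"
  shows "continuous_map X T (\<lambda>x. f x \<otimes> g x)"
proof -
  have "continuous_map X (prod_topology T T) (\<lambda>x. (f x, g x))"
    using assms by (rule continuous_map_pairedI)
  from continuous_map_compose [OF this continuous_mult] show ?thesis by (simp add: o_def)
qed

lemma continuous_lmult: "g \<in> carrier G \<Longrightarrow> continuous_map T T (\<lambda>x. g \<otimes> x)"
  using continuous_mult_maps [of T "\<lambda>_. g" "\<lambda>x. x"] topspace_eq_carrier by simp

lemma continuous_conj: "g \<in> carrier G \<Longrightarrow> continuous_map T T (\<lambda>x. g \<otimes> x \<otimes> inv g)"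
  using continuous_mult_maps [OF continuous_lmult, of g "\<lambda>_. inv g"] topspace_eq_carrier by simp

lemma openin_translate:
  assumes "openin T W" "g \<in> carrier G"
  shows "openin T {x \<in> carrier G. inv g \<otimes> x \<in> W}"
  using openin_continuous_map_preimage [OF continuous_lmult assms(1), of "inv g"] assms(2)
    topspace_eq_carrier by simp

lemma nhd_mult:
  assumes "openin T W" "\<one> \<in> W"
  obtains V where "openin T V" "\<one> \<in> V" "V \<subseteq> W" "\<And>x y. x \<in> V \<Longrightarrow> y \<in> V \<Longrightarrow> x \<otimes> y \<in> W"
proof -
  let ?P = "{z \<in> topspace (prod_topology T T). (\<lambda>(x, y). x \<otimes> y) z \<in> W}"
  have "openin (prod_topology T T) ?P"
    by (rule openin_continuous_map_preimage [OF continuous_mult assms(1)])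
  moreover have "(\<one>, \<one>) \<in> ?P" using assms(2) by (simp add: topspace_eq_carrier)
  ultimately have "\<exists>A B. openin T A \<and> openin T B \<and> \<one> \<in> A \<and> \<one> \<in> B \<and> A \<times> B \<subseteq> ?P"
    by (simp only: openin_prod_topology_alt)
  then obtain A B where AB: "openin T A" "openin T B" "\<one> \<in> A" "\<one> \<in> B" "A \<times> B \<subseteq> ?P"
    by blast
  show thesis
  proof (rule that [of "A \<inter> B \<inter> W"])
    show "openin T (A \<inter> B \<inter> W)" using AB assms by (intro openin_Int)
    show "x \<otimes> y \<in> W" if "x \<in> A \<inter> B \<inter> W" "y \<in> A \<inter> B \<inter> W" for x y
    proof -
      have "(x, y) \<in> A \<times> B" using that by simp
      with AB(5) show ?thesis by auto
    qed
  qed (use AB assms in auto)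
qed

lemma nhd_preimage:
  assumes "openin T W" "continuous_map T T f" "f \<one> \<in> W"
  obtains V where "openin T V" "\<one> \<in> V" "V \<subseteq> carrier G" "\<And>x. x \<in> V \<Longrightarrow> f x \<in> W"
proof (rule that [of "{x \<in> topspace T. f x \<in> W}"])
  show "openin T {x \<in> topspace T. f x \<in> W}"
    by (rule openin_continuous_map_preimage [OF assms(2,1)])
qed (use assms topspace_eq_carrier in auto)

text \<open>Left translations carry a compact neighbourhood of the unit to every point.\<close>

lemma locally_compact_from_one:
  assumes "openin T U" "compactin T K" "\<one> \<in> U" "U \<subseteq> K"
  shows "locally_compact_space T"
  unfolding locally_compact_space_def
proof
  fix x assume "x \<in> topspace T"
  then have x: "x \<in> carrier G" by (simp add: topspace_eq_carrier)
  show "\<exists>U K. openin T U \<and> compactin T K \<and> x \<in> U \<and> U \<subseteq> K"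
  proof (intro exI conjI)
    show "openin T {y \<in> carrier G. inv x \<otimes> y \<in> U}" by (rule openin_translate [OF assms(1) x])
    show "compactin T ((\<lambda>y. x \<otimes> y) ` K)" by (rule image_compactin [OF assms(2) continuous_lmult [OF x]])
    show "x \<in> {y \<in> carrier G. inv x \<otimes> y \<in> U}" using x assms(3) by simp
    show "{y \<in> carrier G. inv x \<otimes> y \<in> U} \<subseteq> (\<lambda>y. x \<otimes> y) ` K"
    proof
      fix y assume "y \<in> {y \<in> carrier G. inv x \<otimes> y \<in> U}"
      then have "y = x \<otimes> (inv x \<otimes> y)" "inv x \<otimes> y \<in> K"
        using x assms(4) by (auto simp: m_assoc [symmetric])
      then show "y \<in> (\<lambda>y. x \<otimes> y) ` K" by blast
    qed
  qed
qed

end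

section \<open>Group topologies from neighbourhoods of the unit\<close>

text \<open>The classical axioms for a base of neighbourhoods of the unit. The members of the base
  are not assumed to be open.\<close>

locale group_nhd_base = group G for G (structure) +
  fixes \<N> :: "'a set set"
  assumes nhd_nonempty: "\<N> \<noteq> {}"
    and nhd_subset: "N \<in> \<N> \<Longrightarrow> N \<subseteq> carrier G" and nhd_one: "N \<in> \<N> \<Longrightarrow> \<one> \<in> N"
    and nhd_Int: "M \<in> \<N> \<Longrightarrow> N \<in> \<N> \<Longrightarrow> \<exists>K\<in>\<N>. K \<subseteq> M \<inter> N"
    and nhd_mult: "N \<in> \<N> \<Longrightarrow> \<exists>M\<in>\<N>. \<forall>x\<in>M. \<forall>y\<in>M. x \<otimes> y \<in> N"
    and nhd_inv: "N \<in> \<N> \<Longrightarrow> \<exists>M\<in>\<N>. \<forall>x\<in>M. inv x \<in> N"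
    and nhd_conj: "N \<in> \<N> \<Longrightarrow> g \<in> carrier G \<Longrightarrow> \<exists>M\<in>\<N>. \<forall>x\<in>M. g \<otimes> x \<otimes> inv g \<in> N"
begin

definition topo :: "'a topology" where
  "topo = topology (\<lambda>S. S \<subseteq> carrier G \<and> (\<forall>x\<in>S. \<exists>N\<in>\<N>. \<forall>y\<in>N. x \<otimes> y \<in> S))"

lemma openin_topo: "openin topo S \<longleftrightarrow> S \<subseteq> carrier G \<and> (\<forall>x\<in>S. \<exists>N\<in>\<N>. \<forall>y\<in>N. x \<otimes> y \<in> S)"
proof -
  have "istopology (\<lambda>S. S \<subseteq> carrier G \<and> (\<forall>x\<in>S. \<exists>N\<in>\<N>. \<forall>y\<in>N. x \<otimes> y \<in> S))"
    unfolding istopology_def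
  proof (rule conjI; intro allI impI conjI ballI)
    fix S S' x
    assume S: "S \<subseteq> carrier G \<and> (\<forall>x\<in>S. \<exists>N\<in>\<N>. \<forall>y\<in>N. x \<otimes> y \<in> S)"
      and S': "S' \<subseteq> carrier G \<and> (\<forall>x\<in>S'. \<exists>N\<in>\<N>. \<forall>y\<in>N. x \<otimes> y \<in> S')"
    show "S \<inter> S' \<subseteq> carrier G" using S by blast
    assume x: "x \<in> S \<inter> S'"
    obtain M where M: "M \<in> \<N>" "\<forall>y\<in>M. x \<otimes> y \<in> S" using S x by blast
    obtain N where N: "N \<in> \<N>" "\<forall>y\<in>N. x \<otimes> y \<in> S'" using S' x by blast
    obtain K where "K \<in> \<N>" "K \<subseteq> M \<inter> N" using nhd_Int M N by blast
    then show "\<exists>N\<in>\<N>. \<forall>y\<in>N. x \<otimes> y \<in> S \<inter> S'" using M N by blast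
  next
    fix \<K> assume "\<forall>S\<in>\<K>. S \<subseteq> carrier G \<and> (\<forall>x\<in>S. \<exists>N\<in>\<N>. \<forall>y\<in>N. x \<otimes> y \<in> S)"
    then show "\<Union>\<K> \<subseteq> carrier G" "\<And>x. x \<in> \<Union>\<K> \<Longrightarrow> \<exists>N\<in>\<N>. \<forall>y\<in>N. x \<otimes> y \<in> \<Union>\<K>"
      by (blast, meson UnionE UnionI)
  qed
  then show ?thesis by (simp add: topo_def)
qed

lemma topspace_topo: "topspace topo = carrier G"
proof
  show "topspace topo \<subseteq> carrier G" using openin_topo openin_topspace by blast
  have "openin topo (carrier G)"
    unfolding openin_topo using nhd_nonempty nhd_subset by (meson ex_in_conv m_closed order_refl subsetD)
  then show "carrier G \<subseteq> topspace topo" by (rule openin_subset)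
qed

text \<open>The translate \<open>x N\<close> need not be open. Its interior consists of the points
  \<open>z\<close> with \<open>z M \<subseteq> x N\<close> for some \<open>M\<close> in the base,
  and \<open>nhd_mult\<close> shows that this set is open.\<close>

lemma topo_nhd:
  assumes x: "x \<in> carrier G" and N: "N \<in> \<N>"
  obtains S where "openin topo S" "x \<in> S" "S \<subseteq> (\<lambda>y. x \<otimes> y) ` N"
proof -
  let ?A = "(\<lambda>y. x \<otimes> y) ` N"
  have A: "?A \<subseteq> carrier G" using x nhd_subset [OF N] by blast
  define S where "S = {z \<in> carrier G. \<exists>M\<in>\<N>. \<forall>y\<in>M. z \<otimes> y \<in> ?A}"
  show thesis
  proof (rule that)
    show "S \<subseteq> ?A"
    proof
      fix z assume "z \<in> S"
      then obtain M where "z \<in> carrier G" "M \<in> \<N>" "\<forall>y\<in>M. z \<otimes> y \<in> ?A" unfolding S_def by blast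
      then show "z \<in> ?A" using nhd_one by force
    qed
    show "x \<in> S" unfolding S_def using x N by blast
    show "openin topo S" unfolding openin_topo
    proof (intro conjI ballI)
      fix z assume z: "z \<in> S"
      then obtain M where M: "M \<in> \<N>" "\<forall>y\<in>M. z \<otimes> y \<in> ?A" and zG: "z \<in> carrier G" unfolding S_def by blast
      obtain K where K: "K \<in> \<N>" "\<forall>a\<in>K. \<forall>b\<in>K. a \<otimes> b \<in> M" using nhd_mult [OF M(1)] by blast
      have "z \<otimes> a \<in> S" if a: "a \<in> K" for a
        unfolding S_def
      proof (intro CollectI conjI bexI [OF _ K(1)] ballI)
        have aG: "a \<in> carrier G" using a nhd_subset [OF K(1)] by blast
        show "z \<otimes> a \<in> carrier G" using zG aG by simp
        fix b assume b: "b \<in> K"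
        then have "b \<in> carrier G" using nhd_subset [OF K(1)] by blast
        then show "z \<otimes> a \<otimes> b \<in> ?A" using K(2) a b M(2) zG aG by (simp add: m_assoc)
      qed
      then show "\<exists>N\<in>\<N>. \<forall>y\<in>N. z \<otimes> y \<in> S" using K(1) by blast
    qed (auto simp: S_def)
  qed
qed

lemma topological_group_topo: "topological_group G topo"
proof (unfold_locales)
  show "topspace topo = carrier G" by (rule topspace_topo)
  show "continuous_map topo topo (\<lambda>x. inv x)"
    unfolding continuous_map_def topspace_topo
  proof (intro conjI allI impI)
    show "(\<lambda>x. inv x) \<in> carrier G \<rightarrow> carrier G" by simp
    fix S assume S: "openin topo S"
    show "openin topo {x \<in> carrier G. inv x \<in> S}"
      unfolding openin_topo
    proof (intro conjI ballI)
      fix x assume x: "x \<in> {x \<in> carrier G. inv x \<in> S}"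
      then obtain N where N: "N \<in> \<N>" "\<forall>y\<in>N. inv x \<otimes> y \<in> S" using S unfolding openin_topo by blast
      obtain M where M: "M \<in> \<N>" "\<forall>y\<in>M. x \<otimes> y \<otimes> inv x \<in> N" using nhd_conj [OF N(1)] x by blast
      obtain K where K: "K \<in> \<N>" "\<forall>y\<in>K. inv y \<in> M" using nhd_inv [OF M(1)] by blast
      have "x \<otimes> y \<in> {x \<in> carrier G. inv x \<in> S}" if y: "y \<in> K" for y
      proof -
        have yG: "y \<in> carrier G" using y nhd_subset [OF K(1)] by blast
        \<comment> \<open>Open sets are tested by right multiplication, so \<open>inv y\<close> has
          to pass to the right of \<open>inv x\<close>; this conjugates it by
          \<open>x\<close>.\<close>
        have "inv (x \<otimes> y) = inv x \<otimes> (x \<otimes> inv y \<otimes> inv x)"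
          using x yG by (simp add: inv_mult_group m_assoc [symmetric])
        then show ?thesis using N(2) M(2) K(2) y x yG by auto
      qed
      then show "\<exists>N\<in>\<N>. \<forall>y\<in>N. x \<otimes> y \<in> {x \<in> carrier G. inv x \<in> S}" using K(1) by blast
    qed auto
  qed
  show "continuous_map (prod_topology topo topo) topo (\<lambda>(x, y). x \<otimes> y)"
    unfolding continuous_map_def topspace_prod_topology topspace_topo
  proof (intro conjI allI impI)
    show "(\<lambda>(x, y). x \<otimes> y) \<in> carrier G \<times> carrier G \<rightarrow> carrier G" by auto
    fix S assume S: "openin topo S"
    show "openin (prod_topology topo topo) {z \<in> carrier G \<times> carrier G. (case z of (x, y) \<Rightarrow> x \<otimes> y) \<in> S}"
      unfolding openin_prod_topology_alt
    proof (intro allI impI)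
      fix x y assume "(x, y) \<in> {z \<in> carrier G \<times> carrier G. (case z of (x, y) \<Rightarrow> x \<otimes> y) \<in> S}"
      then have xy: "x \<in> carrier G" "y \<in> carrier G" "x \<otimes> y \<in> S" by auto
      then obtain N where N: "N \<in> \<N>" "\<forall>z\<in>N. x \<otimes> y \<otimes> z \<in> S" using S unfolding openin_topo by blast
      obtain M where M: "M \<in> \<N>" "\<forall>a\<in>M. \<forall>b\<in>M. a \<otimes> b \<in> N" using nhd_mult [OF N(1)] by blast
      obtain K where K: "K \<in> \<N>" "\<forall>a\<in>K. inv y \<otimes> a \<otimes> inv (inv y) \<in> M" using nhd_conj [OF M(1), of "inv y"] xy by blast
      obtain U where U: "openin topo U" "x \<in> U" "U \<subseteq> (\<lambda>a. x \<otimes> a) ` K" using topo_nhd [OF xy(1) K(1)] .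
      obtain V where V: "openin topo V" "y \<in> V" "V \<subseteq> (\<lambda>a. y \<otimes> a) ` M" using topo_nhd [OF xy(2) M(1)] .
      \<comment> \<open>Moving \<open>a\<close> to the right past \<open>y\<close> conjugates it by
        \<open>inv y\<close>; the set \<open>K\<close> is chosen for this.\<close>
      have ab_mem: "x \<otimes> a \<otimes> (y \<otimes> b) \<in> S" if ab: "a \<in> K" "b \<in> M" for a b
      proof -
        have G: "a \<in> carrier G" "b \<in> carrier G" using ab nhd_subset K(1) M(1) by blast+
        have "y \<otimes> (inv y \<otimes> a \<otimes> y \<otimes> b) = a \<otimes> (y \<otimes> b)"
          using xy G by (simp add: m_assoc [symmetric])
        then have "x \<otimes> a \<otimes> (y \<otimes> b) = x \<otimes> y \<otimes> ((inv y \<otimes> a \<otimes> inv (inv y)) \<otimes> b)"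
          using xy G by (simp add: m_assoc)
        then show ?thesis using N(2) M(2) K(2) ab by simp
      qed
      have "U \<times> V \<subseteq> {z \<in> carrier G \<times> carrier G. (case z of (x, y) \<Rightarrow> x \<otimes> y) \<in> S}"
      proof (intro subsetI)
        fix z assume "z \<in> U \<times> V"
        then obtain a b where z: "z = (a, b)" "a \<in> U" "b \<in> V" by blast
        obtain a' where a': "a' \<in> K" "a = x \<otimes> a'" using U(3) z(2) by blast
        obtain b' where b': "b' \<in> M" "b = y \<otimes> b'" using V(3) z(3) by blast
        have "a' \<in> carrier G" "b' \<in> carrier G" using a' b' nhd_subset K(1) M(1) by auto
        with ab_mem [OF a'(1) b'(1)] show "z \<in> {z \<in> carrier G \<times> carrier G. (case z of (x, y) \<Rightarrow> x \<otimes> y) \<in> S}"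
          using xy by (simp add: z(1) a'(2) b'(2))
      qed
      then show "\<exists>U V. openin topo U \<and> openin topo V \<and> x \<in> U \<and> y \<in> V \<and>
          U \<times> V \<subseteq> {z \<in> carrier G \<times> carrier G. (case z of (x, y) \<Rightarrow> x \<otimes> y) \<in> S}"
        using U V by blast
    qed
  qed
qed

end

section \<open>The group generated by a closed approximate subgroup\<close>

locale closed_approximate_subgroup = locally_compact_group +
  fixes \<Lambda> :: "'a set"
  assumes approx: "approximate_subgroup G \<Lambda>" and closed: "closedin T \<Lambda>"
begin

lemma \<Lambda>_carrier: "x \<in> \<Lambda> \<Longrightarrow> x \<in> carrier G" and \<Lambda>_one: "\<one> \<in> \<Lambda>"
  using approx by (auto simp: approximate_subgroup_def)

lemma \<Lambda>_inv: "x \<in> \<Lambda> \<Longrightarrow> inv x \<in> \<Lambda>"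
proof -
  assume "x \<in> \<Lambda>"
  then have "inv x \<in> set_inv \<Lambda>" by (auto simp: SET_INV_def)
  then show ?thesis using approx by (simp add: approximate_subgroup_def)
qed

definition H :: "'a set" where "H = generate G \<Lambda>"

definition HG :: "'a monoid" where
  "HG = \<lparr>carrier = H, monoid.mult = mult G, one = one G\<rparr>"

definition \<Lambda>2 :: "'a set" where "\<Lambda>2 = \<Lambda> <#> \<Lambda>"

lemma H_subgroup: "subgroup H G"
  unfolding H_def by (rule generate_is_subgroup) (use \<Lambda>_carrier in blast)

lemma H_carrier: "x \<in> H \<Longrightarrow> x \<in> carrier G"
  using subgroup.mem_carrier [OF H_subgroup] .

lemma H_mult: "x \<in> H \<Longrightarrow> y \<in> H \<Longrightarrow> x \<otimes> y \<in> H"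
  using subgroup.m_closed [OF H_subgroup] .

lemma H_inv: "x \<in> H \<Longrightarrow> inv x \<in> H"
  using subgroup.m_inv_closed [OF H_subgroup] .

lemma H_one: "\<one> \<in> H"
  using subgroup.one_closed [OF H_subgroup] .

lemma \<Lambda>_H: "x \<in> \<Lambda> \<Longrightarrow> x \<in> H"
  unfolding H_def by (rule generate.incl)

lemma \<Lambda>2_iff: "x \<in> \<Lambda>2 \<longleftrightarrow> (\<exists>a\<in>\<Lambda>. \<exists>b\<in>\<Lambda>. x = a \<otimes> b)"
  by (auto simp: \<Lambda>2_def set_mult_def)

lemma \<Lambda>2I: "a \<in> \<Lambda> \<Longrightarrow> b \<in> \<Lambda> \<Longrightarrow> a \<otimes> b \<in> \<Lambda>2"
  unfolding \<Lambda>2_iff by blast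

lemma \<Lambda>2_H: "x \<in> \<Lambda>2 \<Longrightarrow> x \<in> H"
  using \<Lambda>2_iff \<Lambda>_H H_mult by auto

lemma \<Lambda>2_one: "\<one> \<in> \<Lambda>2"
  unfolding \<Lambda>2_iff using \<Lambda>_one by (intro bexI[of _ \<one>]) auto

lemma \<Lambda>2_inv: "x \<in> \<Lambda>2 \<Longrightarrow> inv x \<in> \<Lambda>2"
  unfolding \<Lambda>2_iff using \<Lambda>_inv \<Lambda>_carrier by (metis inv_mult_group)

lemma HG_simps [simp]: "carrier HG = H" "mult HG = mult G" "one HG = one G"
  by (simp_all add: HG_def)

lemma HG_group: "group HG"
proof (rule groupI)
  show "\<exists>y\<in>carrier HG. y \<otimes>\<^bsub>HG\<^esub> x = \<one>\<^bsub>HG\<^esub>" if "x \<in> carrier HG" for x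
    using that H_inv H_carrier by (intro bexI[of _ "inv x"]) auto
qed (use H_mult H_one H_carrier m_assoc in auto)

lemma HG_inv: "x \<in> H \<Longrightarrow> inv\<^bsub>HG\<^esub> x = inv x"
  using group.inv_equality [OF HG_group, of "inv x" x] H_inv H_carrier by simp

text \<open>Contained in finitely many left translates of \<Lambda>. The translating elements are
  taken in \<open>H\<close>, so that covered sets lie in \<open>H\<close> and can be multiplied
  again.\<close>

definition covered :: "'a set \<Rightarrow> bool" where
  "covered S \<longleftrightarrow> (\<exists>F. finite F \<and> F \<subseteq> H \<and> (\<forall>s\<in>S. \<exists>f\<in>F. \<exists>l\<in>\<Lambda>. s = f \<otimes> l))"

lemma coveredE:
  assumes "covered S"
  obtains F where "finite F" "F \<subseteq> H" "\<And>s. s \<in> S \<Longrightarrow> \<exists>f\<in>F. \<exists>l\<in>\<Lambda>. s = f \<otimes> l"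
  using assms unfolding covered_def by blast

lemma covered_H: "covered S \<Longrightarrow> s \<in> S \<Longrightarrow> s \<in> H"
  by (elim coveredE) (metis H_mult \<Lambda>_H subsetD)

lemma covered_subset: "covered S \<Longrightarrow> S' \<subseteq> S \<Longrightarrow> covered S'"
  unfolding covered_def by (meson subsetD)

lemma covered_singleton: "g \<in> H \<Longrightarrow> covered {g}"
  unfolding covered_def using \<Lambda>_one H_carrier
  by (intro exI[of _ "{g}"] conjI ballI bexI[of _ g] bexI[of _ \<one>]) auto

lemma covered_\<Lambda>: "covered \<Lambda>"
  unfolding covered_def using H_one \<Lambda>_carrier 
  by (intro exI[of _ "{\<one>}"] conjI ballI bexI[of _ \<one>] bexI) auto

lemma covered_\<Lambda>2: "covered \<Lambda>2"
proof -
  obtain F where F: "finite F" "F \<subseteq> carrier G" "\<Lambda>2 \<subseteq> F <#> \<Lambda>"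
    using approx unfolding approximate_subgroup_def \<Lambda>2_def by blast
  \<comment> \<open>The finite set is given in \<open>G\<close>. An element \<open>f\<close> that is
    actually used equals \<open>(f \<otimes> l) \<otimes> inv l\<close> and so lies in
    \<open>H\<close>; the others are dropped.\<close>
  have "f \<in> H" if f: "f \<in> F" "l \<in> \<Lambda>" "f \<otimes> l \<in> \<Lambda>2" for f l
  proof -
    have "f = (f \<otimes> l) \<otimes> inv l" using f F(2) \<Lambda>_carrier by (simp add: m_assoc subsetD)
    then show ?thesis using H_mult [OF \<Lambda>2_H [OF f(3)] H_inv [OF \<Lambda>_H [OF f(2)]]] by simp
  qed
  moreover have "\<exists>f\<in>F. \<exists>l\<in>\<Lambda>. s = f \<otimes> l" if "s \<in> \<Lambda>2" for s
    using F(3) that unfolding set_mult_def by blast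
  ultimately show ?thesis
    unfolding covered_def using F(1) by (intro exI[of _ "F \<inter> H"]) blast
qed

lemma covered_UN:
  assumes "finite F" "\<And>f. f \<in> F \<Longrightarrow> covered (S f)"
  shows "covered (\<Union>f\<in>F. S f)"
proof -
  obtain K where K: "\<And>f. f \<in> F \<Longrightarrow> finite (K f) \<and> K f \<subseteq> H \<and> (\<forall>s\<in>S f. \<exists>k\<in>K f. \<exists>l\<in>\<Lambda>. s = k \<otimes> l)"
    using assms(2) unfolding covered_def by metis
  then show ?thesis
    unfolding covered_def using assms(1) by (intro exI[of _ "\<Union>f\<in>F. K f"]) blast
qed

lemma covered_lmult:
  assumes g: "g \<in> H" and S: "covered S"
  shows "covered ((\<lambda>s. g \<otimes> s) ` S)"
proof -
  obtain F where F: "finite F" "F \<subseteq> H" "\<And>s. s \<in> S \<Longrightarrow> \<exists>f\<in>F. \<exists>l\<in>\<Lambda>. s = f \<otimes> l"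
    using coveredE [OF S] by blast
  show ?thesis unfolding covered_def
  proof (intro exI[of _ "(\<lambda>f. g \<otimes> f) ` F"] conjI ballI)
    show "(\<lambda>f. g \<otimes> f) ` F \<subseteq> H" using F(2) g H_mult by blast
    fix s assume "s \<in> (\<lambda>s. g \<otimes> s) ` S"
    then obtain f l where "f \<in> F" "l \<in> \<Lambda>" "s = g \<otimes> (f \<otimes> l)" using F(3) by blast
    then show "\<exists>f\<in>(\<lambda>f. g \<otimes> f) ` F. \<exists>l\<in>\<Lambda>. s = f \<otimes> l"
      using g F(2) H_carrier \<Lambda>_carrier by (intro bexI[of _ "g \<otimes> f"] bexI[of _ l]) (auto simp: m_assoc subsetD)
  qed (use F in auto)
qed

text \<open>A cover of \<open>S\<close> gives \<Lambda>F\<Lambda>, and \<open>F\<close> has to get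
  out to the left. This is possible since \<Lambda>h is covered for each h in the generated group:
  it lies in \<Lambda>\<Lambda> for generators, and \<Lambda>h \<subseteq> F\<Lambda> gives
  \<Lambda>hh' \<subseteq> F\<Lambda>h' for products. What remains is a finite union of translates
  of \<Lambda>\<Lambda>.\<close>

lemma covered_\<Lambda>_mult:
  assumes "covered S"
  shows "covered (\<Lambda> <#> S)"
proof -
  have *: "covered ((\<lambda>l. l \<otimes> h) ` \<Lambda>)" if "h \<in> generate G \<Lambda>" for h
    using that
  proof induction
    case one
    have "(\<lambda>l. l \<otimes> \<one>) ` \<Lambda> \<subseteq> \<Lambda>" using \<Lambda>_carrier by auto
    then show ?case using covered_subset [OF covered_\<Lambda>] by blast
  next
    case (incl h)
    then show ?case by (intro covered_subset [OF covered_\<Lambda>2]) (auto intro: \<Lambda>2I)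
  next
    case (inv h)
    then show ?case by (intro covered_subset [OF covered_\<Lambda>2]) (auto intro: \<Lambda>2I \<Lambda>_inv)
  next
    case (eng h1 h2)
    obtain F where F: "finite F" "F \<subseteq> H" "\<And>s. s \<in> (\<lambda>l. l \<otimes> h1) ` \<Lambda> \<Longrightarrow> \<exists>f\<in>F. \<exists>l\<in>\<Lambda>. s = f \<otimes> l"
      using coveredE [OF eng.IH(1)] by blast
    have "(\<lambda>l. l \<otimes> (h1 \<otimes> h2)) ` \<Lambda> \<subseteq> (\<Union>f\<in>F. (\<lambda>s. f \<otimes> s) ` (\<lambda>l. l \<otimes> h2) ` \<Lambda>)"
    proof
      fix s assume "s \<in> (\<lambda>l. l \<otimes> (h1 \<otimes> h2)) ` \<Lambda>"
      then obtain l where l: "l \<in> \<Lambda>" "s = l \<otimes> (h1 \<otimes> h2)" by blast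
      obtain f k where f: "f \<in> F" "k \<in> \<Lambda>" "l \<otimes> h1 = f \<otimes> k" using F(3) l(1) by blast
      have G: "l \<in> carrier G" "h1 \<in> carrier G" "h2 \<in> carrier G" "f \<in> carrier G" "k \<in> carrier G"
        using l(1) f F(2) eng.hyps \<Lambda>_carrier H_carrier unfolding H_def by auto
      then have "s = f \<otimes> (k \<otimes> h2)" unfolding l(2) by (metis f(3) m_assoc)
      then show "s \<in> (\<Union>f\<in>F. (\<lambda>s. f \<otimes> s) ` (\<lambda>l. l \<otimes> h2) ` \<Lambda>)" using f by blast
    qed
    moreover have "covered (\<Union>f\<in>F. (\<lambda>s. f \<otimes> s) ` (\<lambda>l. l \<otimes> h2) ` \<Lambda>)"
      using F(1,2) eng.IH(2) by (intro covered_UN covered_lmult) auto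
    ultimately show ?case using covered_subset by blast
  qed
  obtain F where F: "finite F" "F \<subseteq> H" "\<And>s. s \<in> S \<Longrightarrow> \<exists>f\<in>F. \<exists>l\<in>\<Lambda>. s = f \<otimes> l"
    using coveredE [OF assms] by blast
  have "covered (\<Union>f\<in>F. (\<lambda>l. l \<otimes> f) ` \<Lambda>)"
    using F(1,2) * unfolding H_def by (intro covered_UN) auto
  then obtain K where K: "finite K" "K \<subseteq> H" "\<And>s. s \<in> (\<Union>f\<in>F. (\<lambda>l. l \<otimes> f) ` \<Lambda>) \<Longrightarrow> \<exists>f\<in>K. \<exists>l\<in>\<Lambda>. s = f \<otimes> l"
    using coveredE by blast
  have "\<Lambda> <#> S \<subseteq> (\<Union>k\<in>K. (\<lambda>s. k \<otimes> s) ` \<Lambda>2)"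
  proof
    fix x assume "x \<in> \<Lambda> <#> S"
    then obtain l s where ls: "l \<in> \<Lambda>" "s \<in> S" "x = l \<otimes> s" unfolding set_mult_def by blast
    obtain f l' where f: "f \<in> F" "l' \<in> \<Lambda>" "s = f \<otimes> l'" using F(3) ls(2) by blast
    obtain k l'' where k: "k \<in> K" "l'' \<in> \<Lambda>" "l \<otimes> f = k \<otimes> l''" using K(3) f(1) ls(1) by blast
    have G: "l \<in> carrier G" "f \<in> carrier G" "l' \<in> carrier G" "k \<in> carrier G" "l'' \<in> carrier G"
      using ls(1) f(1,2) k(1,2) F(2) K(2) \<Lambda>_carrier H_carrier by auto
    then have "x = k \<otimes> (l'' \<otimes> l')" unfolding ls(3) f(3) by (metis k(3) m_assoc)
    then show "x \<in> (\<Union>k\<in>K. (\<lambda>s. k \<otimes> s) ` \<Lambda>2)" using k f(2) \<Lambda>2_iff by blast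
  qed
  moreover have "covered (\<Union>k\<in>K. (\<lambda>s. k \<otimes> s) ` \<Lambda>2)"
    using K(1,2) by (intro covered_UN covered_lmult covered_\<Lambda>2) auto
  ultimately show ?thesis using covered_subset by blast
qed

lemma covered_mult:
  assumes S: "covered S" and S': "covered S'"
  shows "covered (S <#> S')"
proof -
  obtain F where F: "finite F" "F \<subseteq> H" "\<And>s. s \<in> S \<Longrightarrow> \<exists>f\<in>F. \<exists>l\<in>\<Lambda>. s = f \<otimes> l"
    using coveredE [OF S] by blast
  have "S <#> S' \<subseteq> (\<Union>f\<in>F. (\<lambda>s. f \<otimes> s) ` (\<Lambda> <#> S'))"
  proof
    fix x assume "x \<in> S <#> S'"
    then obtain s s' where s: "s \<in> S" "s' \<in> S'" "x = s \<otimes> s'" unfolding set_mult_def by blast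
    obtain f l where f: "f \<in> F" "l \<in> \<Lambda>" "s = f \<otimes> l" using F(3) s(1) by blast
    have "x = f \<otimes> (l \<otimes> s')"
      unfolding s(3) f(3) using f F(2) H_carrier \<Lambda>_carrier covered_H [OF S' s(2)] by (intro m_assoc) auto
    moreover have "l \<otimes> s' \<in> \<Lambda> <#> S'" using f(2) s(2) unfolding set_mult_def by blast
    ultimately show "x \<in> (\<Union>f\<in>F. (\<lambda>s. f \<otimes> s) ` (\<Lambda> <#> S'))" using f(1) by blast
  qed
  moreover have "covered (\<Union>f\<in>F. (\<lambda>s. f \<otimes> s) ` (\<Lambda> <#> S'))"
    using F(1,2) by (intro covered_UN covered_lmult covered_\<Lambda>_mult S') auto
  ultimately show ?thesis using covered_subset by blast
qed

lemma closedin_translate: "f \<in> carrier G \<Longrightarrow> closedin T ((\<lambda>l. f \<otimes> l) ` \<Lambda>)"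
proof -
  assume f: "f \<in> carrier G"
  have "closedin T {x \<in> topspace T. inv f \<otimes> x \<in> \<Lambda>}"
    by (rule closedin_continuous_map_preimage [OF continuous_lmult closed]) (use f in simp)
  moreover have "{x \<in> topspace T. inv f \<otimes> x \<in> \<Lambda>} = (\<lambda>l. f \<otimes> l) ` \<Lambda>"
  proof (intro equalityI subsetI)
    fix x assume "x \<in> {x \<in> topspace T. inv f \<otimes> x \<in> \<Lambda>}"
    then have "x = f \<otimes> (inv f \<otimes> x)" "inv f \<otimes> x \<in> \<Lambda>" using f by (auto simp: topspace_eq_carrier m_assoc [symmetric])
    then show "x \<in> (\<lambda>l. f \<otimes> l) ` \<Lambda>" by blast
  qed (use f \<Lambda>_carrier in \<open>auto simp: topspace_eq_carrier m_assoc [symmetric]\<close>)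
  ultimately show ?thesis by simp
qed

text \<open>The translates \<open>f \<Lambda>\<close> are closed, and those that contain the unit satisfy \<open>f \<in> \<Lambda>\<close>.\<close>

lemma covered_near_one:
  assumes "covered S"
  obtains W where "openin T W" "\<one> \<in> W" "S \<inter> W \<subseteq> \<Lambda>2"
proof -
  obtain F where F: "finite F" "F \<subseteq> H" "\<And>s. s \<in> S \<Longrightarrow> \<exists>f\<in>F. \<exists>l\<in>\<Lambda>. s = f \<otimes> l"
    using coveredE [OF assms] by blast
  let ?C = "\<Union>f\<in>F - \<Lambda>. (\<lambda>l. f \<otimes> l) ` \<Lambda>"
  show thesis
  proof (rule that)
    have "closedin T ?C" using F(1,2) H_carrier by (intro closedin_Union) (auto intro!: closedin_translate)
    then show "openin T (topspace T - ?C)" by blast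
    have "\<one> \<noteq> f \<otimes> l" if f: "f \<in> F - \<Lambda>" and l: "l \<in> \<Lambda>" for f l
    proof
      assume "\<one> = f \<otimes> l"
      then have "inv l = f" using f l F(2) H_carrier \<Lambda>_carrier by (intro inv_equality) auto
      then show False using \<Lambda>_inv [OF l] f by simp
    qed
    then show "\<one> \<in> topspace T - ?C" by (auto simp: topspace_eq_carrier)
    show "S \<inter> (topspace T - ?C) \<subseteq> \<Lambda>2"
    proof
      fix s assume s: "s \<in> S \<inter> (topspace T - ?C)"
      then have "s \<in> S" by blast
      from F(3) [OF this] obtain f l where fl: "f \<in> F" "l \<in> \<Lambda>" "s = f \<otimes> l" by blast
      then have "f \<in> \<Lambda>" using s by blast
      then show "s \<in> \<Lambda>2" unfolding fl(3) using fl(2) by (rule \<Lambda>2I)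
    qed
  qed
qed

section \<open>The topology of the generated group\<close>

definition base :: "'a set set" where
  "base = {\<Lambda>2 \<inter> W | W. openin T W \<and> \<one> \<in> W}"

lemma baseI: "openin T W \<Longrightarrow> \<one> \<in> W \<Longrightarrow> \<Lambda>2 \<inter> W \<in> base"
  unfolding base_def by blast

text \<open>Continuity in \<open>G\<close> brings products and conjugates close to the unit; that
  they are again in \<open>\<Lambda>2\<close> holds because the products of
  \<open>\<Lambda>2\<close> with itself and its conjugates by elements of \<open>H\<close> are
  covered, so that \<open>covered_near_one\<close> applies.\<close>

sublocale HG: group_nhd_base HG base
proof (intro group_nhd_base.intro HG_group group_nhd_base_axioms.intro)
  show "base \<noteq> {}" using baseI [OF openin_carrier_all one_closed] by blast
  show "N \<subseteq> carrier HG" "\<one>\<^bsub>HG\<^esub> \<in> N" if "N \<in> base" for N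
    using that \<Lambda>2_H \<Lambda>2_one by (auto simp: base_def)
  show "\<exists>K\<in>base. K \<subseteq> M \<inter> N" if MN: "M \<in> base" "N \<in> base" for M N
  proof -
    obtain V W where V: "openin T V" "\<one> \<in> V" "M = \<Lambda>2 \<inter> V" and W: "openin T W" "\<one> \<in> W" "N = \<Lambda>2 \<inter> W"
      using MN unfolding base_def by blast
    have "\<Lambda>2 \<inter> (V \<inter> W) \<in> base" using V W by (intro baseI) auto
    then show ?thesis unfolding V(3) W(3) by (intro bexI[of _ "\<Lambda>2 \<inter> (V \<inter> W)"]) auto
  qed
next
  fix N assume "N \<in> base"
  then obtain W where W: "openin T W" "\<one> \<in> W" "N = \<Lambda>2 \<inter> W" unfolding base_def by blast
  obtain W0 where W0: "openin T W0" "\<one> \<in> W0" "(\<Lambda>2 <#> \<Lambda>2) \<inter> W0 \<subseteq> \<Lambda>2"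
    using covered_near_one [OF covered_mult [OF covered_\<Lambda>2 covered_\<Lambda>2]] .
  obtain V where V: "openin T V" "\<one> \<in> V" "\<And>x y. x \<in> V \<Longrightarrow> y \<in> V \<Longrightarrow> x \<otimes> y \<in> W \<inter> W0"
    using nhd_mult [of "W \<inter> W0"] W W0 by (metis IntI openin_Int)
  have "x \<otimes> y \<in> N" if "x \<in> \<Lambda>2 \<inter> V" "y \<in> \<Lambda>2 \<inter> V" for x y
  proof -
    have "x \<otimes> y \<in> \<Lambda>2 <#> \<Lambda>2" using that unfolding set_mult_def by blast
    then show ?thesis using V(3) [of x y] that W0(3) W(3) by blast
  qed
  then show "\<exists>M\<in>base. \<forall>x\<in>M. \<forall>y\<in>M. x \<otimes>\<^bsub>HG\<^esub> y \<in> N"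
    using baseI [OF V(1,2)] by (intro bexI[of _ "\<Lambda>2 \<inter> V"]) auto
  obtain V where V: "openin T V" "\<one> \<in> V" "\<And>x. x \<in> V \<Longrightarrow> inv x \<in> W"
    using nhd_preimage [OF W(1) continuous_inv] W(2) by (metis inv_one)
  have "inv\<^bsub>HG\<^esub> x \<in> N" if "x \<in> \<Lambda>2 \<inter> V" for x
    using that V(3) \<Lambda>2_inv \<Lambda>2_H W(3) by (auto simp: HG_inv)
  then show "\<exists>M\<in>base. \<forall>x\<in>M. inv\<^bsub>HG\<^esub> x \<in> N"
    using baseI [OF V(1,2)] by (intro bexI[of _ "\<Lambda>2 \<inter> V"]) auto
  fix g assume "g \<in> carrier HG"
  then have g: "g \<in> H" by simp
  have "covered (({g} <#> \<Lambda>2) <#> {inv g})"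
    using g H_inv by (intro covered_mult covered_\<Lambda>2 covered_singleton)
  then obtain W0 where W0: "openin T W0" "\<one> \<in> W0" "(({g} <#> \<Lambda>2) <#> {inv g}) \<inter> W0 \<subseteq> \<Lambda>2"
    using covered_near_one by blast
  have "g \<otimes> \<one> \<otimes> inv g \<in> W \<inter> W0" using g H_carrier W W0 by simp
  moreover define V where "V = {x \<in> topspace T. g \<otimes> x \<otimes> inv g \<in> W \<inter> W0}"
  ultimately have V: "openin T V" "\<one> \<in> V" "\<And>x. x \<in> V \<Longrightarrow> g \<otimes> x \<otimes> inv g \<in> W \<inter> W0"
    using openin_continuous_map_preimage [OF continuous_conj [OF H_carrier [OF g]] openin_Int [OF W(1) W0(1)]]
    by (simp_all add: topspace_eq_carrier)
  have "g \<otimes> x \<otimes> inv g \<in> N" if "x \<in> \<Lambda>2 \<inter> V" for x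
  proof -
    have "g \<otimes> x \<otimes> inv g \<in> ({g} <#> \<Lambda>2) <#> {inv g}" using that unfolding set_mult_def by blast
    then show ?thesis using V(3) [of x] that W0(3) W(3) by blast
  qed
  then show "\<exists>M\<in>base. \<forall>x\<in>M. g \<otimes>\<^bsub>HG\<^esub> x \<otimes>\<^bsub>HG\<^esub> inv\<^bsub>HG\<^esub> g \<in> N"
    using baseI [OF V(1,2)] by (intro bexI[of _ "\<Lambda>2 \<inter> V"]) (auto simp: HG_inv g)
qed

abbreviation TH :: "'a topology" where "TH \<equiv> HG.topo"

lemma topspace_TH: "topspace TH = H"
  using HG.topspace_topo by simp

lemma openin_TH:
  "openin TH S \<longleftrightarrow> S \<subseteq> H \<and> (\<forall>x\<in>S. \<exists>W. openin T W \<and> \<one> \<in> W \<and> (\<forall>y\<in>\<Lambda>2 \<inter> W. x \<otimes> y \<in> S))"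
proof -
  have "(\<exists>N\<in>base. \<forall>y\<in>N. x \<otimes> y \<in> S) \<longleftrightarrow>
      (\<exists>W. openin T W \<and> \<one> \<in> W \<and> (\<forall>y\<in>\<Lambda>2 \<inter> W. x \<otimes> y \<in> S))" for x
    unfolding base_def by (simp add: Bex_def) metis
  then show ?thesis by (simp add: HG.openin_topo)
qed

lemma openin_T_Int_H:
  assumes "openin T U"
  shows "openin TH (U \<inter> H)"
  unfolding openin_TH
proof (intro conjI ballI)
  fix x assume x: "x \<in> U \<inter> H"
  have "openin T {y \<in> carrier G. inv (inv x) \<otimes> y \<in> U}"
    using x H_inv H_carrier by (intro openin_translate [OF assms]) auto
  then show "\<exists>W. openin T W \<and> \<one> \<in> W \<and> (\<forall>y\<in>\<Lambda>2 \<inter> W. x \<otimes> y \<in> U \<inter> H)"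
    using x H_carrier H_mult \<Lambda>2_H by (intro exI[of _ "{y \<in> carrier G. inv (inv x) \<otimes> y \<in> U}"]) auto
qed auto

lemma continuous_TH_T: "continuous_map TH T (\<lambda>x. x)"
proof -
  have "{x \<in> H. x \<in> U} = U \<inter> H" for U by blast
  then show ?thesis
    using openin_T_Int_H H_carrier by (auto simp: continuous_map_def topspace_TH topspace_eq_carrier)
qed

text \<open>For \<open>x\<close> in \<open>S\<close> the set \<open>inv x \<otimes> S\<close> is
  covered and so lies in \<open>\<Lambda>2\<close> near the unit. Therefore \<open>S\<close> near
  \<open>x\<close>, in the sense of \<open>G\<close>, lies in \<open>x \<otimes> \<Lambda>2\<close>,
  where the two topologies have the same neighbourhoods of \<open>x\<close>. Compactness, properness
  and charts are all transferred from \<open>G\<close> by this lemma.\<close>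

lemma subtopology_TH_covered:
  assumes S: "covered S"
  shows "subtopology TH S = subtopology T S"
  unfolding topology_eq
proof (intro allI iffI)
  fix U assume "openin (subtopology T S) U"
  then obtain V where "openin T V" "U = V \<inter> S" unfolding openin_subtopology by blast
  then have "openin TH (V \<inter> H)" "U = (V \<inter> H) \<inter> S" using openin_T_Int_H covered_H [OF S] by auto
  then show "openin (subtopology TH S) U" unfolding openin_subtopology by blast
next
  fix U assume "openin (subtopology TH S) U"
  then obtain V where V: "openin TH V" "U = V \<inter> S" unfolding openin_subtopology by blast
  show "openin (subtopology T S) U"
  proof (subst openin_subopen, intro ballI)
    fix x assume x: "x \<in> U"
    then have xH: "x \<in> H" using covered_H [OF S] V(2) by blast
    obtain W1 where W1: "openin T W1" "\<one> \<in> W1" "\<forall>y\<in>\<Lambda>2 \<inter> W1. x \<otimes> y \<in> V"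
      using V x unfolding openin_TH by blast
    obtain W2 where W2: "openin T W2" "\<one> \<in> W2" "(\<lambda>s. inv x \<otimes> s) ` S \<inter> W2 \<subseteq> \<Lambda>2"
      using covered_near_one [OF covered_lmult [OF H_inv [OF xH] S]] .
    let ?O = "{y \<in> carrier G. inv x \<otimes> y \<in> W1 \<inter> W2}"
    have "openin T ?O" using W1 W2 xH H_carrier by (intro openin_translate) auto
    moreover have "x \<in> ?O \<inter> S" using x V(2) W1 W2 xH H_carrier by simp
    moreover have "?O \<inter> S \<subseteq> U"
    proof
      fix y assume y: "y \<in> ?O \<inter> S"
      then have "inv x \<otimes> y \<in> \<Lambda>2 \<inter> W1" using W2(3) by blast
      then have "x \<otimes> (inv x \<otimes> y) \<in> V" using W1(3) by blast
      moreover have "x \<otimes> (inv x \<otimes> y) = y" using y H_carrier [OF xH] by (simp add: m_assoc [symmetric])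
      ultimately show "y \<in> U" using y V(2) by simp
    qed
    ultimately show "\<exists>V. openin (subtopology T S) V \<and> x \<in> V \<and> V \<subseteq> U"
      unfolding openin_subtopology by blast
  qed
qed

lemma TH_topological_group: "topological_group HG TH"
  by (rule HG.topological_group_topo)

lemma TH_Hausdorff: "Hausdorff_space TH"
  by (rule Hausdorff_space_injective_preimage [OF Hausdorff continuous_TH_T]) (simp add: inj_on_def)

text \<open>A closed substitute for \<open>\<Lambda>2\<close>, which itself need not be
  closed.\<close>

lemma closed_cover:
  obtains Z where "closedin T Z" "covered Z" "\<Lambda>2 \<subseteq> Z"
proof -
  obtain F where F: "finite F" "F \<subseteq> H" "\<And>s. s \<in> \<Lambda>2 \<Longrightarrow> \<exists>f\<in>F. \<exists>l\<in>\<Lambda>. s = f \<otimes> l"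
    using coveredE [OF covered_\<Lambda>2] by blast
  show thesis
  proof (rule that [of "\<Union>f\<in>F. (\<lambda>l. f \<otimes> l) ` \<Lambda>"])
    show "closedin T (\<Union>f\<in>F. (\<lambda>l. f \<otimes> l) ` \<Lambda>)"
      using F(1,2) H_carrier by (intro closedin_Union) (auto intro!: closedin_translate)
    show "covered (\<Union>f\<in>F. (\<lambda>l. f \<otimes> l) ` \<Lambda>)"
      unfolding covered_def using F(1,2) by (intro exI[of _ F]) blast
  qed (use F(3) in blast)
qed

text \<open>The intersection of the closed cover \<open>Z\<close> with a compact neighbourhood
  \<open>K\<close> in \<open>G\<close> is compact in \<open>G\<close>; as \<open>Z\<close> is
  covered, it is compact in \<open>TH\<close> too, and it contains a neighbourhood of the unit of
  the form \<open>\<Lambda>2 \<inter> U\<close>.\<close>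

lemma TH_locally_compact: "locally_compact_space TH"
proof -
  obtain U K where UK: "openin T U" "compactin T K" "\<one> \<in> U" "U \<subseteq> K"
    using locally_compact unfolding locally_compact_space_def topspace_eq_carrier by blast
  obtain Z where Z: "closedin T Z" "covered Z" "\<Lambda>2 \<subseteq> Z" by (rule closed_cover)
  have ZK: "compactin T (Z \<inter> K)" using Z(1) UK(2) by (rule closed_Int_compactin)
  from Z(2) have "compactin (subtopology TH Z) (Z \<inter> K)"
    using ZK by (simp add: subtopology_TH_covered compactin_subtopology)
  then have c: "compactin TH (Z \<inter> K)" by (simp add: compactin_subtopology)
  obtain S where S: "openin TH S" "\<one> \<in> S" "S \<subseteq> (\<lambda>y. \<one> \<otimes> y) ` (\<Lambda>2 \<inter> U)"
    using HG.topo_nhd [OF _ baseI [OF UK(1,3)], of \<one>] H_one by auto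
  have "S \<subseteq> Z \<inter> K"
  proof
    fix s assume "s \<in> S"
    then have "s \<in> \<Lambda>2 \<inter> U" using S(3) \<Lambda>2_H H_carrier by auto
    then show "s \<in> Z \<inter> K" using UK(4) Z(3) by blast
  qed
  then show ?thesis
    using topological_group.locally_compact_from_one [OF TH_topological_group S(1) c] S(2) by simp
qed

text \<open>On \<Lambda> both topologies agree, and the inclusion of a closed set is proper.\<close>

lemma TH_proper: "proper_map (subtopology TH \<Lambda>) T (\<lambda>x. x)"
proof -
  have "proper_map (subtopology T \<Lambda>) T id"
    using closed closed_Int_compactin [OF closed]
    by (simp add: proper_map_inclusion closedin_subset)
  then show ?thesis by (simp add: subtopology_TH_covered [OF covered_\<Lambda>] id_def)
qed

section \<open>The open approximate subgroup\<close>

definition \<Xi> :: "'a set" where "\<Xi> = TH interior_of (\<Lambda> <#> \<Lambda> <#> \<Lambda>)"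

lemma \<Lambda>3_iff: "x \<in> \<Lambda> <#> \<Lambda> <#> \<Lambda> \<longleftrightarrow> (\<exists>a\<in>\<Lambda>. \<exists>b\<in>\<Lambda>. \<exists>c\<in>\<Lambda>. x = a \<otimes> b \<otimes> c)"
  by (auto simp: set_mult_def)

lemma \<Lambda>3_inv: "x \<in> \<Lambda> <#> \<Lambda> <#> \<Lambda> \<Longrightarrow> inv x \<in> \<Lambda> <#> \<Lambda> <#> \<Lambda>"
proof -
  assume "x \<in> \<Lambda> <#> \<Lambda> <#> \<Lambda>"
  then obtain a b c where abc: "a \<in> \<Lambda>" "b \<in> \<Lambda>" "c \<in> \<Lambda>" "x = a \<otimes> b \<otimes> c" unfolding \<Lambda>3_iff by blast
  then have "inv x = inv c \<otimes> inv b \<otimes> inv a"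
    using \<Lambda>_carrier by (simp add: inv_mult_group m_assoc)
  then show ?thesis unfolding \<Lambda>3_iff using abc(1-3) \<Lambda>_inv by blast
qed

text \<open>The translate of the neighbourhood \<open>\<Lambda>2\<close> of the unit by
  \<open>x\<close> is a neighbourhood of \<open>x\<close>, and for \<open>x\<close> in \<Lambda> it
  consists of products of three elements of \<Lambda>.\<close>

lemma \<Lambda>_\<Xi>: "\<Lambda> \<subseteq> \<Xi>"
proof
  fix x assume x: "x \<in> \<Lambda>"
  obtain S where S: "openin TH S" "x \<in> S" "S \<subseteq> (\<lambda>y. x \<otimes> y) ` (\<Lambda>2 \<inter> carrier G)"
    using HG.topo_nhd [OF _ baseI [OF openin_carrier_all one_closed], of x] x \<Lambda>_H by auto
  have "S \<subseteq> \<Lambda> <#> \<Lambda> <#> \<Lambda>"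
  proof
    fix s assume "s \<in> S"
    then obtain t where "t \<in> \<Lambda>2" "s = x \<otimes> t" using S(3) by blast
    then obtain a b where ab: "a \<in> \<Lambda>" "b \<in> \<Lambda>" "s = x \<otimes> (a \<otimes> b)" unfolding \<Lambda>2_iff by blast
    then have "s = x \<otimes> a \<otimes> b" using x \<Lambda>_carrier by (simp add: m_assoc)
    then show "s \<in> \<Lambda> <#> \<Lambda> <#> \<Lambda>" unfolding \<Lambda>3_iff using x ab by blast
  qed
  then show "x \<in> \<Xi>" unfolding \<Xi>_def using S interior_of_maximal by blast
qed

lemma \<Xi>_\<Lambda>3: "\<Xi> \<subseteq> \<Lambda> <#> \<Lambda> <#> \<Lambda>"
  unfolding \<Xi>_def by (rule interior_of_subset)

lemma \<Xi>_open: "openin TH \<Xi>"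
  unfolding \<Xi>_def by (rule openin_interior_of)

text \<open>Inversion is continuous for \<open>TH\<close> and preserves the triple product, hence
  also its interior.\<close>

lemma \<Xi>_inv: "x \<in> \<Xi> \<Longrightarrow> inv x \<in> \<Xi>"
proof -
  assume x: "x \<in> \<Xi>"
  have xH: "x \<in> H" using x openin_subset [OF \<Xi>_open] topspace_TH by blast
  have "continuous_map TH TH (\<lambda>x. inv\<^bsub>HG\<^esub> x)"
    using topological_group.continuous_inv [OF TH_topological_group] .
  then have "openin TH {x \<in> topspace TH. inv\<^bsub>HG\<^esub> x \<in> \<Xi>}"
    using \<Xi>_open by (rule openin_continuous_map_preimage)
  moreover have "{x \<in> topspace TH. inv\<^bsub>HG\<^esub> x \<in> \<Xi>} \<subseteq> \<Lambda> <#> \<Lambda> <#> \<Lambda>"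
  proof
    fix y assume "y \<in> {x \<in> topspace TH. inv\<^bsub>HG\<^esub> x \<in> \<Xi>}"
    then have "y \<in> H" "inv y \<in> \<Lambda> <#> \<Lambda> <#> \<Lambda>" using \<Xi>_\<Lambda>3 by (auto simp: topspace_TH HG_inv)
    then show "y \<in> \<Lambda> <#> \<Lambda> <#> \<Lambda>" using \<Lambda>3_inv [of "inv y"] H_carrier by simp
  qed
  ultimately have "{x \<in> topspace TH. inv\<^bsub>HG\<^esub> x \<in> \<Xi>} \<subseteq> TH interior_of (\<Lambda> <#> \<Lambda> <#> \<Lambda>)"
    by (intro interior_of_maximal)
  then have "{x \<in> topspace TH. inv\<^bsub>HG\<^esub> x \<in> \<Xi>} \<subseteq> \<Xi>" by (simp only: \<Xi>_def)
  moreover have "inv x \<in> {x \<in> topspace TH. inv\<^bsub>HG\<^esub> x \<in> \<Xi>}"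
    using x xH H_inv H_carrier by (simp add: topspace_TH HG_inv)
  ultimately show ?thesis by blast
qed

text \<open>The product of \<Xi> with itself is contained in a product of covered sets, so finitely
  many translates of \<Lambda>, and a fortiori of \<Xi>, contain it.\<close>

lemma \<Xi>_approximate_subgroup: "approximate_subgroup HG \<Xi>"
  unfolding approximate_subgroup_def
proof (intro conjI)
  have \<Xi>H: "\<Xi> \<subseteq> H" using openin_subset [OF \<Xi>_open] topspace_TH by simp
  then show "\<Xi> \<subseteq> carrier HG" by simp
  have "set_inv\<^bsub>HG\<^esub> \<Xi> = (\<lambda>x. inv x) ` \<Xi>"
    unfolding SET_INV_def using \<Xi>H HG_inv by (auto simp: subset_iff)
  moreover have "(\<lambda>x. inv x) ` \<Xi> = \<Xi>"
  proof
    show "(\<lambda>x. inv x) ` \<Xi> \<subseteq> \<Xi>" using \<Xi>_inv by auto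
    show "\<Xi> \<subseteq> (\<lambda>x. inv x) ` \<Xi>"
    proof
      fix x assume "x \<in> \<Xi>"
      then show "x \<in> (\<lambda>x. inv x) ` \<Xi>"
        using \<Xi>_inv \<Xi>H H_carrier by (intro image_eqI[of _ _ "inv x"]) auto
    qed
  qed
  ultimately show "\<Xi> = set_inv\<^bsub>HG\<^esub> \<Xi>" by simp
  show "\<one>\<^bsub>HG\<^esub> \<in> \<Xi>" using \<Lambda>_\<Xi> \<Lambda>_one by auto
  have "covered (\<Lambda> <#> \<Lambda> <#> \<Lambda>)" by (intro covered_mult covered_\<Lambda>)
  then have "covered (\<Xi> <#> \<Xi>)" using covered_subset [OF _ \<Xi>_\<Lambda>3] by (intro covered_mult)
  then obtain F where F: "finite F" "F \<subseteq> H" "\<And>s. s \<in> \<Xi> <#> \<Xi> \<Longrightarrow> \<exists>f\<in>F. \<exists>l\<in>\<Lambda>. s = f \<otimes> l"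
    using coveredE by blast
  have eq: "A <#>\<^bsub>HG\<^esub> B = A <#> B" for A B by (simp add: set_mult_def)
  have "\<Xi> <#> \<Xi> \<subseteq> F <#> \<Xi>"
  proof
    fix s assume "s \<in> \<Xi> <#> \<Xi>"
    then obtain f l where "f \<in> F" "l \<in> \<Lambda>" "s = f \<otimes> l" using F(3) by blast
    then show "s \<in> F <#> \<Xi>" using \<Lambda>_\<Xi> unfolding set_mult_def by blast
  qed
  then show "\<exists>F. finite F \<and> F \<subseteq> carrier HG \<and> \<Xi> <#>\<^bsub>HG\<^esub> \<Xi> \<subseteq> F <#>\<^bsub>HG\<^esub> \<Xi>"
    using F(1,2) eq by auto
qed

text \<open>In general the sets in \<open>base\<close> are only neighbourhoods of the unit and need not be open in \<open>TH\<close>.\<close>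

lemma openin_TH_\<Lambda>2:
  assumes W: "openin T W" and sub: "(\<Lambda>2 <#> \<Lambda>2) \<inter> W \<subseteq> \<Lambda>2"
  shows "openin TH (\<Lambda>2 \<inter> W)"
  unfolding openin_TH
proof (intro conjI ballI)
  show "\<Lambda>2 \<inter> W \<subseteq> H" using \<Lambda>2_H by blast
  fix x assume x: "x \<in> \<Lambda>2 \<inter> W"
  have xG: "x \<in> carrier G" using x \<Lambda>2_H H_carrier by blast
  have "openin T {y \<in> carrier G. inv (inv x) \<otimes> y \<in> W}"
    using xG by (intro openin_translate [OF W]) auto
  moreover have "x \<otimes> y \<in> \<Lambda>2 \<inter> W" if "y \<in> \<Lambda>2 \<inter> {y \<in> carrier G. inv (inv x) \<otimes> y \<in> W}" for y
  proof -
    have "x \<otimes> y \<in> \<Lambda>2 <#> \<Lambda>2" using x that unfolding set_mult_def by blast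
    moreover have "x \<otimes> y \<in> W" using that xG by simp
    ultimately show ?thesis using sub by blast
  qed
  ultimately show "\<exists>W'. openin T W' \<and> \<one> \<in> W' \<and> (\<forall>y\<in>\<Lambda>2 \<inter> W'. x \<otimes> y \<in> \<Lambda>2 \<inter> W)"
    using x xG by (intro exI[of _ "{y \<in> carrier G. inv (inv x) \<otimes> y \<in> W}"]) auto
qed

end

section \<open>Lie groups\<close>

lemma Ck_preimage_open:
  assumes W: "openin (Euclidean_space m) W" and V: "openin (Euclidean_space n) V"
    and g: "\<And>x. x \<in> W \<Longrightarrow> g x \<in> esp n" "\<And>j. j < n \<Longrightarrow> Ck_on k m W (\<lambda>x. g x j)"
  shows "openin (Euclidean_space m) {x \<in> W. g x \<in> V}"
proof -
  have "continuous_map (subtopology (Euclidean_space m) W) (Euclidean_space n) g"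
  proof (rule continuous_map_into_esp)
    show "continuous_map (subtopology (Euclidean_space m) W) euclideanreal (\<lambda>x. g x j)" if "j < n" for j
      using Ck_on_imp_0 [OF g(2) [OF that]] by simp
  qed (use g(1) in auto)
  then have "openin (subtopology (Euclidean_space m) W) {x \<in> topspace (subtopology (Euclidean_space m) W). g x \<in> V}"
    using V by (rule openin_continuous_map_preimage)
  then show ?thesis
    using openin_open_subtopology [OF W] openin_subset [OF W] by (simp add: Int_absorb1)
qed

text \<open>\<open>smooth_in_charts\<close> inverts charts by \<open>inv_into\<close>; on the image
  of a chart this agrees with the continuous inverse provided by the homeomorphism.\<close>

lemma chart_properties:
  assumes "is_chart n T (U, c)"
  shows "openin T U" "openin (Euclidean_space n) (c ` U)" "inj_on c U"
    "\<And>p. p \<in> U \<Longrightarrow> inv_into U c (c p) = p"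
    "continuous_map (subtopology T U) (Euclidean_space n) c"
    "continuous_map (subtopology (Euclidean_space n) (c ` U)) T (inv_into U c)"
proof -
  have h: "homeomorphic_map (subtopology T U) (subtopology (Euclidean_space n) (c ` U)) c"
    and U: "openin T U" and cU: "openin (Euclidean_space n) (c ` U)"
    using assms by (auto simp: is_chart_def)
  have tU: "topspace (subtopology T U) = U" using openin_subset [OF U] by auto
  have tcU: "topspace (subtopology (Euclidean_space n) (c ` U)) = c ` U" using openin_subset [OF cU] by auto
  show "openin T U" "openin (Euclidean_space n) (c ` U)" by fact+
  show inj: "inj_on c U" using homeomorphic_imp_injective_map [OF h] tU by simp
  show "inv_into U c (c p) = p" if "p \<in> U" for p using inj that by (rule inv_into_f_f)
  show "continuous_map (subtopology T U) (Euclidean_space n) c"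
    using homeomorphic_imp_continuous_map [OF h] continuous_map_into_fulltopology by blast
  obtain g where g: "homeomorphic_maps (subtopology T U) (subtopology (Euclidean_space n) (c ` U)) c g"
    using h homeomorphic_map_maps by blast
  then have "continuous_map (subtopology (Euclidean_space n) (c ` U)) (subtopology T U) g"
    by (simp add: homeomorphic_maps_def)
  then have "continuous_map (subtopology (Euclidean_space n) (c ` U)) T g"
    by (rule continuous_map_into_fulltopology)
  moreover have "g x = inv_into U c x" if "x \<in> topspace (subtopology (Euclidean_space n) (c ` U))" for x
  proof -
    from that have "x \<in> c ` U" unfolding tcU .
    then obtain p where p: "p \<in> U" "x = c p" by blast
    have "\<forall>p\<in>U. g (c p) = p" using g unfolding homeomorphic_maps_def tU by simp
    then show ?thesis using p inj by simp
  qed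
  ultimately show "continuous_map (subtopology (Euclidean_space n) (c ` U)) T (inv_into U c)"
    by (rule continuous_map_eq)
qed

text \<open>The map \<open>join\<close> concatenates coordinates as the charts in \<open>prod_atlas\<close> do.\<close>

definition fst_half :: "nat \<Rightarrow> (nat \<Rightarrow> real) \<Rightarrow> nat \<Rightarrow> real" where
  "fst_half n z = (\<lambda>i. if i < n then z i else 0)"

definition snd_half :: "nat \<Rightarrow> (nat \<Rightarrow> real) \<Rightarrow> nat \<Rightarrow> real" where
  "snd_half n z = (\<lambda>i. if i < n then z (i + n) else 0)"

definition join :: "nat \<Rightarrow> (nat \<Rightarrow> real) \<Rightarrow> (nat \<Rightarrow> real) \<Rightarrow> nat \<Rightarrow> real" where
  "join n x y = (\<lambda>i. if i < n then x i else y (i - n))"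

lemma half_esp: "fst_half n z \<in> esp n" "snd_half n z \<in> esp n"
  by (simp_all add: fst_half_def snd_half_def topspace_Euclidean_space)

lemma half_smooth:
  assumes "openin (Euclidean_space m) W" "j < n"
  shows "Ck_on k m W (\<lambda>z. fst_half n z j)" "Ck_on k m W (\<lambda>z. snd_half n z j)"
  using assms by (simp_all add: fst_half_def snd_half_def Ck_on_coordinate)

lemma join_esp: "y \<in> esp n \<Longrightarrow> join n x y \<in> esp (n + n)"
  by (auto simp: join_def topspace_Euclidean_space)

lemma join_smooth:
  assumes "\<And>j. j < n \<Longrightarrow> Ck_on k m W (\<lambda>x. f x j)" "\<And>j. j < n \<Longrightarrow> Ck_on k m W (\<lambda>x. g x j)" "j < n + n"
  shows "Ck_on k m W (\<lambda>x. join n (f x) (g x) j)"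
  using assms by (cases "j < n") (auto simp: join_def)

lemma half_join: "x \<in> esp n \<Longrightarrow> fst_half n (join n x y) = x" "y \<in> esp n \<Longrightarrow> snd_half n (join n x y) = y"
  by (auto simp: fst_half_def snd_half_def join_def topspace_Euclidean_space)

lemma join_half: "z \<in> esp (n + n) \<Longrightarrow> join n (fst_half n z) (snd_half n z) = z"
  by (rule ext) (auto simp: fst_half_def snd_half_def join_def topspace_Euclidean_space)

lemma sum_double: "(\<Sum>j<n + n. f j) = (\<Sum>j<n. f j) + (\<Sum>j<n. f (n + j))" for f :: "nat \<Rightarrow> real"
proof -
  have "(\<Sum>j<n + m. f j) = (\<Sum>j<n. f j) + (\<Sum>j<m. f (n + j))" for m by (induction m) auto
  then show ?thesis .
qed

section \<open>Smooth maps from n-space into a Lie group\<close>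

locale lie_structure = topological_group +
  fixes n :: nat and A :: "'a chart set"
  assumes atlas: "smooth_atlas n T A"
    and smooth_mult: "smooth_map (n + n) (prod_topology T T) (prod_atlas n A A) n T A (\<lambda>(x, y). x \<otimes> y)"
    and smooth_inv: "smooth_map n T A n T A (\<lambda>x. inv x)"
begin

lemma chart: "(U, c) \<in> A \<Longrightarrow> is_chart n T (U, c)"
  using atlas by (auto simp: smooth_atlas_def)

lemma chart_esp: "(U, c) \<in> A \<Longrightarrow> p \<in> U \<Longrightarrow> c p \<in> esp n"
  using chart_properties(2) [OF chart] openin_subset by blast

lemma chart_carrier: "(U, c) \<in> A \<Longrightarrow> p \<in> U \<Longrightarrow> p \<in> carrier G"
  using chart_properties(1) [OF chart] openin_carrier by blast

lemma chart_at:
  assumes "p \<in> carrier G"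
  obtains U c where "(U, c) \<in> A" "p \<in> U"
  using atlas assms unfolding smooth_atlas_def topspace_eq_carrier by blast

lemma chart_change:
  assumes "(U, c) \<in> A" "(V, d) \<in> A"
  shows "smooth_on n n (c ` (U \<inter> V)) (\<lambda>x. d (inv_into U c x))"
  using atlas assms unfolding smooth_atlas_def smooth_in_charts_def by fastforce

text \<open>Smoothness of a map into \<open>G\<close>, tested near each point in one suitable chart;
  by \<open>smooth_into_near\<close> any other chart then works too. Such parametrized maps can be
  multiplied and inverted pointwise, so chart expressions of the group operations need not be
  written out later.\<close>

definition smooth_into :: "nat \<Rightarrow> (nat \<Rightarrow> real) set \<Rightarrow> ((nat \<Rightarrow> real) \<Rightarrow> 'a) \<Rightarrow> bool" where
  "smooth_into m W F \<longleftrightarrow> openin (Euclidean_space m) W \<and>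
     (\<forall>x\<in>W. \<exists>W' U c. openin (Euclidean_space m) W' \<and> x \<in> W' \<and> W' \<subseteq> W \<and> (U, c) \<in> A \<and> F ` W' \<subseteq> U \<and>
        (\<forall>i<n. \<forall>k. Ck_on k m W' (\<lambda>y. c (F y) i)))"

lemma smooth_intoE:
  assumes "smooth_into m W F" "x \<in> W"
  obtains W' U c where "openin (Euclidean_space m) W'" "x \<in> W'" "W' \<subseteq> W" "(U, c) \<in> A"
    "\<And>y. y \<in> W' \<Longrightarrow> F y \<in> U" "\<And>i k. i < n \<Longrightarrow> Ck_on k m W' (\<lambda>y. c (F y) i)"
  using assms unfolding smooth_into_def image_subset_iff by meson

lemma smooth_intoI:
  assumes "openin (Euclidean_space m) W"
    and "\<And>x. x \<in> W \<Longrightarrow> \<exists>W' U c. openin (Euclidean_space m) W' \<and> x \<in> W' \<and> (U, c) \<in> A \<and>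
      (\<forall>y\<in>W'. F y \<in> U) \<and> (\<forall>i<n. \<forall>k. Ck_on k m W' (\<lambda>y. c (F y) i))"
  shows "smooth_into m W F"
  unfolding smooth_into_def
proof (intro conjI ballI assms(1))
  fix x assume x: "x \<in> W"
  from assms(2) [OF x] obtain W' U c where w: "openin (Euclidean_space m) W'" "x \<in> W'" "(U, c) \<in> A"
    "\<forall>y\<in>W'. F y \<in> U" "\<forall>i<n. \<forall>k. Ck_on k m W' (\<lambda>y. c (F y) i)" by blast
  show "\<exists>W' U c. openin (Euclidean_space m) W' \<and> x \<in> W' \<and> W' \<subseteq> W \<and> (U, c) \<in> A \<and> F ` W' \<subseteq> U \<and>
        (\<forall>i<n. \<forall>k. Ck_on k m W' (\<lambda>y. c (F y) i))"
    using w x assms(1) Ck_on_subset [of _ m W' _ "W' \<inter> W"]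
    by (intro exI[of _ "W' \<inter> W"] exI[of _ U] exI[of _ c]) auto
qed

lemma smooth_into_open: "smooth_into m W F \<Longrightarrow> openin (Euclidean_space m) W"
  by (simp add: smooth_into_def)

lemma smooth_into_carrier:
  assumes "smooth_into m W F" "x \<in> W"
  shows "F x \<in> carrier G"
proof -
  obtain W' U c where "x \<in> W'" "(U, c) \<in> A" "\<And>y. y \<in> W' \<Longrightarrow> F y \<in> U"
    using smooth_intoE [OF assms] by metis
  then show ?thesis using chart_carrier by blast
qed

text \<open>Pass from the given chart to the other one by the chart change, on the open set where
  the first chart takes values in the overlap.\<close>

lemma smooth_into_near:
  assumes "smooth_into m W F" "x \<in> W" "(V, d) \<in> A" "F x \<in> V"
  obtains W' where "openin (Euclidean_space m) W'" "x \<in> W'" "W' \<subseteq> W"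
    "\<And>y. y \<in> W' \<Longrightarrow> F y \<in> V" "\<And>i k. i < n \<Longrightarrow> Ck_on k m W' (\<lambda>y. d (F y) i)"
proof -
  obtain W0 U c where W0: "openin (Euclidean_space m) W0" "x \<in> W0" "W0 \<subseteq> W" "(U, c) \<in> A"
    "\<And>y. y \<in> W0 \<Longrightarrow> F y \<in> U" "\<And>i k. i < n \<Longrightarrow> Ck_on k m W0 (\<lambda>y. c (F y) i)"
    using smooth_intoE [OF assms(1,2)] by blast
  have t: "smooth_on n n (c ` (U \<inter> V)) (\<lambda>x. d (inv_into U c x))" by (rule chart_change [OF W0(4) assms(3)])
  then have Q0: "openin (Euclidean_space n) (c ` (U \<inter> V))" by (simp add: smooth_on_def)
  define W' where "W' = {y \<in> W0. c (F y) \<in> c ` (U \<inter> V)}"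
  have W': "openin (Euclidean_space m) W'"
    unfolding W'_def using W0(5) chart_esp [OF W0(4)]
    by (intro Ck_preimage_open [OF W0(1) Q0 _ W0(6)]) auto
  have FV: "F y \<in> V" if y: "y \<in> W'" for y
  proof -
    obtain p where p: "p \<in> U \<inter> V" "c (F y) = c p" using y unfolding W'_def by blast
    have "F y \<in> U" using y W0(5) unfolding W'_def by simp
    then have "F y = p"
      using inj_onD [OF chart_properties(3) [OF chart [OF W0(4)]] p(2)] p(1) by simp
    then show ?thesis using p(1) by simp
  qed
  show thesis
  proof (rule that [OF W' _ _ FV])
    show "x \<in> W'" unfolding W'_def using W0 assms(4) by blast
    show "W' \<subseteq> W" unfolding W'_def using W0(3) by blast
    fix i k assume i: "i < n"
    have "Ck_on k m W' (\<lambda>y. d (inv_into U c (c (F y))) i)"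
    proof (rule Ck_on_compose [OF W' Q0, where g = "\<lambda>y. c (F y)" and f = "\<lambda>x. d (inv_into U c x) i"])
      show "Ck_on k m W' (\<lambda>y. c (F y) j)" if "j < n" for j
        by (rule Ck_on_subset [OF W0(6) [OF that]]) (auto simp: W'_def)
      show "Ck_on k n (c ` (U \<inter> V)) (\<lambda>x. d (inv_into U c x) i)" using t i by (simp add: smooth_on_def)
    qed (simp add: W'_def)
    moreover have "d (inv_into U c (c (F y))) i = d (F y) i" if "y \<in> W'" for y
      using chart_properties(4) [OF chart [OF W0(4)]] W0(5) that unfolding W'_def by simp
    ultimately show "Ck_on k m W' (\<lambda>y. d (F y) i)"
      using Ck_on_cong [OF W', of "\<lambda>y. d (inv_into U c (c (F y))) i" "\<lambda>y. d (F y) i" k] by blast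
  qed
qed

lemma smooth_into_chart:
  assumes F: "smooth_into m W F" and d: "(V, d) \<in> A" "\<And>x. x \<in> W \<Longrightarrow> F x \<in> V" and i: "i < n"
  shows "Ck_on k m W (\<lambda>x. d (F x) i)"
proof (rule Ck_on_locally [OF smooth_into_open [OF F]])
  fix x assume x: "x \<in> W"
  obtain W' where W': "openin (Euclidean_space m) W'" "x \<in> W'" "\<And>i k. i < n \<Longrightarrow> Ck_on k m W' (\<lambda>y. d (F y) i)"
    by (rule smooth_into_near [OF F x d(1) d(2) [OF x]]) blast
  have "Ck_on k m W' (\<lambda>y. d (F y) i)" by (rule W'(3) [OF i])
  with W'(1,2) show "\<exists>W. openin (Euclidean_space m) W \<and> x \<in> W \<and> Ck_on k m W (\<lambda>x. d (F x) i)" by blast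
qed

lemma smooth_into_preimage_open:
  assumes F: "smooth_into m W F" and V: "openin T V"
  shows "openin (Euclidean_space m) {x \<in> W. F x \<in> V}"
proof (subst openin_subopen, intro ballI)
  fix x assume x: "x \<in> {x \<in> W. F x \<in> V}"
  then have xW: "x \<in> W" by simp
  obtain W0 U c where W0: "openin (Euclidean_space m) W0" "x \<in> W0" "W0 \<subseteq> W" "(U, c) \<in> A"
    "\<And>y. y \<in> W0 \<Longrightarrow> F y \<in> U" "\<And>i k. i < n \<Longrightarrow> Ck_on k m W0 (\<lambda>y. c (F y) i)"
    using smooth_intoE [OF F xW] by blast
  have cp: "continuous_map (subtopology (Euclidean_space n) (c ` U)) T (inv_into U c)"
    and cU: "openin (Euclidean_space n) (c ` U)"
    using chart_properties [OF chart [OF W0(4)]] by auto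
  let ?Q0 = "{y \<in> c ` U. inv_into U c y \<in> V}"
  have "openin (subtopology (Euclidean_space n) (c ` U)) {y \<in> topspace (subtopology (Euclidean_space n) (c ` U)). inv_into U c y \<in> V}"
    by (rule openin_continuous_map_preimage [OF cp V])
  then have Q0: "openin (Euclidean_space n) ?Q0"
    using openin_open_subtopology [OF cU] openin_subset [OF cU] by (simp add: Int_absorb1)
  let ?W' = "{y \<in> W0. c (F y) \<in> ?Q0}"
  have "openin (Euclidean_space m) ?W'"
    using W0(5) chart_esp [OF W0(4)]
    by (intro Ck_preimage_open [OF W0(1) Q0 _ W0(6)]) auto
  moreover have "y \<in> ?W' \<longleftrightarrow> F y \<in> V" if "y \<in> W0" for y
    using chart_properties(4) [OF chart [OF W0(4)] W0(5) [OF that]] that W0(5) [OF that] by auto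
  ultimately show "\<exists>W'. openin (Euclidean_space m) W' \<and> x \<in> W' \<and> W' \<subseteq> {x \<in> W. F x \<in> V}"
    using x W0(2,3) by (intro exI[of _ ?W']) auto
qed

lemma smooth_into_continuous:
  assumes "smooth_into m W F"
  shows "continuous_map (subtopology (Euclidean_space m) W) T F"
  using openin_subset [OF smooth_into_open [OF assms]] smooth_into_carrier [OF assms]
    smooth_into_preimage_open [OF assms] openin_open_subtopology [OF smooth_into_open [OF assms]]
  by (auto simp: continuous_map_def topspace_eq_carrier Int_absorb1)

lemma smooth_into_subset:
  assumes "smooth_into m W F" "openin (Euclidean_space m) W'" "W' \<subseteq> W"
  shows "smooth_into m W' F"
proof (rule smooth_intoI [OF assms(2)])
  fix x assume "x \<in> W'"
  then have "x \<in> W" using assms(3) by blast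
  from smooth_intoE [OF assms(1) this]
  show "\<exists>W' U c. openin (Euclidean_space m) W' \<and> x \<in> W' \<and> (U, c) \<in> A \<and>
      (\<forall>y\<in>W'. F y \<in> U) \<and> (\<forall>i<n. \<forall>k. Ck_on k m W' (\<lambda>y. c (F y) i))" by metis
qed

lemma smooth_into_cong:
  assumes F: "smooth_into m W F" and eq: "\<And>x. x \<in> W \<Longrightarrow> E x = F x"
  shows "smooth_into m W E"
proof (rule smooth_intoI [OF smooth_into_open [OF F]])
  fix x assume x: "x \<in> W"
  obtain W0 U c where W0: "openin (Euclidean_space m) W0" "x \<in> W0" "W0 \<subseteq> W" "(U, c) \<in> A"
    "\<And>y. y \<in> W0 \<Longrightarrow> F y \<in> U" "\<And>i k. i < n \<Longrightarrow> Ck_on k m W0 (\<lambda>y. c (F y) i)"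
    using smooth_intoE [OF F x] by blast
  have eq': "E y = F y" if "y \<in> W0" for y using eq that W0(3) by blast
  then have "Ck_on k m W0 (\<lambda>y. c (E y) i)" if "i < n" for i k
    using Ck_on_cong [OF W0(1), of "\<lambda>y. c (E y) i" "\<lambda>y. c (F y) i" k] W0(6) [OF that] by simp
  then show "\<exists>W' U c. openin (Euclidean_space m) W' \<and> x \<in> W' \<and> (U, c) \<in> A \<and>
      (\<forall>y\<in>W'. E y \<in> U) \<and> (\<forall>i<n. \<forall>k. Ck_on k m W' (\<lambda>y. c (E y) i))"
    using W0(1,2,4,5) eq' by (intro exI[of _ W0] exI[of _ U] exI[of _ c]) simp
qed

lemma smooth_into_compose:
  assumes F: "smooth_into m W F" and W': "openin (Euclidean_space l) W'"
    and g: "\<And>x. x \<in> W' \<Longrightarrow> g x \<in> W" "\<And>j k. j < m \<Longrightarrow> Ck_on k l W' (\<lambda>x. g x j)"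
  shows "smooth_into l W' (\<lambda>x. F (g x))"
proof (rule smooth_intoI [OF W'])
  fix x assume x: "x \<in> W'"
  obtain W0 U c where W0: "openin (Euclidean_space m) W0" "g x \<in> W0" "W0 \<subseteq> W" "(U, c) \<in> A"
    "\<And>y. y \<in> W0 \<Longrightarrow> F y \<in> U" "\<And>i k. i < n \<Longrightarrow> Ck_on k m W0 (\<lambda>y. c (F y) i)"
    using smooth_intoE [OF F g(1) [OF x]] by blast
  define W1 where "W1 = {y \<in> W'. g y \<in> W0}"
  have W1: "openin (Euclidean_space l) W1"
    unfolding W1_def using g(1) openin_subset [OF smooth_into_open [OF F]]
    by (intro Ck_preimage_open [OF W' W0(1) _ g(2)]) blast
  have "Ck_on k l W1 (\<lambda>y. c (F (g y)) i)" if "i < n" for i k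
  proof (rule Ck_on_compose [OF W1 W0(1), where g = g and f = "\<lambda>y. c (F y) i"])
    show "Ck_on k l W1 (\<lambda>y. g y j)" if "j < m" for j
      by (rule Ck_on_subset [OF g(2) [OF that]]) (auto simp: W1_def)
  qed (use W0(6) that in \<open>auto simp: W1_def\<close>)
  moreover have "F (g y) \<in> U" if "y \<in> W1" for y using that W0(5) by (simp add: W1_def)
  moreover have "x \<in> W1" using x W0(2) by (simp add: W1_def)
  ultimately show "\<exists>W1 U c. openin (Euclidean_space l) W1 \<and> x \<in> W1 \<and> (U, c) \<in> A \<and>
      (\<forall>y\<in>W1. F (g y) \<in> U) \<and> (\<forall>i<n. \<forall>k. Ck_on k l W1 (\<lambda>y. c (F (g y)) i))"
    using W1 W0(4) by (intro exI[of _ W1] exI[of _ U] exI[of _ c]) blast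
qed

lemma smooth_into_const:
  assumes "p \<in> carrier G" "openin (Euclidean_space m) W"
  shows "smooth_into m W (\<lambda>_. p)"
proof (rule smooth_intoI [OF assms(2)])
  fix x assume "x \<in> W"
  obtain U c where "(U, c) \<in> A" "p \<in> U" using chart_at [OF assms(1)] .
  then show "\<exists>W' U c. openin (Euclidean_space m) W' \<and> x \<in> W' \<and> (U, c) \<in> A \<and>
      (\<forall>y\<in>W'. p \<in> U) \<and> (\<forall>i<n. \<forall>k. Ck_on k m W' (\<lambda>y. c p i))"
    using \<open>x \<in> W\<close> assms(2) Ck_on_const [OF assms(2)]
    by (intro exI[of _ W] exI[of _ U] exI[of _ c]) blast
qed

lemma smooth_into_chart_inverse:
  assumes "(U, c) \<in> A"
  shows "smooth_into n (c ` U) (inv_into U c)"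
proof (rule smooth_intoI)
  show o: "openin (Euclidean_space n) (c ` U)" by (rule chart_properties(2) [OF chart [OF assms]])
  fix x assume x: "x \<in> c ` U"
  have "Ck_on k n (c ` U) (\<lambda>y. c (inv_into U c y) i)" for i k
    using Ck_on_cong [OF o, of "\<lambda>y. c (inv_into U c y) i" "\<lambda>y. y i" k] Ck_on_coordinate [OF o, of k i]
    by (simp add: f_inv_into_f)
  then show "\<exists>W' V d. openin (Euclidean_space n) W' \<and> x \<in> W' \<and> (V, d) \<in> A \<and>
      (\<forall>y\<in>W'. inv_into U c y \<in> V) \<and> (\<forall>i<n. \<forall>k. Ck_on k n W' (\<lambda>y. d (inv_into U c y) i))"
    using o x assms by (intro exI[of _ "c ` U"] exI[of _ U] exI[of _ c]) (simp add: inv_into_into)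
qed

lemma smooth_into_inv:
  assumes F: "smooth_into m W F"
  shows "smooth_into m W (\<lambda>x. inv (F x))"
proof (rule smooth_intoI [OF smooth_into_open [OF F]])
  fix x assume x: "x \<in> W"
  obtain W0 U c where W0: "openin (Euclidean_space m) W0" "x \<in> W0" "W0 \<subseteq> W" "(U, c) \<in> A"
    "\<And>y. y \<in> W0 \<Longrightarrow> F y \<in> U" "\<And>i k. i < n \<Longrightarrow> Ck_on k m W0 (\<lambda>y. c (F y) i)"
    using smooth_intoE [OF F x] by blast
  have "inv (F x) \<in> carrier G" using smooth_into_carrier [OF F x] by simp
  then obtain V d where V: "(V, d) \<in> A" "inv (F x) \<in> V" by (rule chart_at)
  define Q0 where "Q0 = c ` (U \<inter> (\<lambda>x. inv x) -` V)"
  have t: "smooth_on n n Q0 (\<lambda>x. d (inv (inv_into U c x)))"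
    using smooth_inv W0(4) V(1) unfolding smooth_map_def smooth_in_charts_def Q0_def by fast
  then have Q0: "openin (Euclidean_space n) Q0" by (simp add: smooth_on_def)
  define W1 where "W1 = {y \<in> W0. c (F y) \<in> Q0}"
  have W1: "openin (Euclidean_space m) W1"
    unfolding W1_def using W0(5) chart_esp [OF W0(4)]
    by (intro Ck_preimage_open [OF W0(1) Q0 _ W0(6)]) auto
  have cc: "inv_into U c (c (F y)) = F y" if "y \<in> W1" for y
    using chart_properties(4) [OF chart [OF W0(4)]] W0(5) that by (simp add: W1_def)
  have "Ck_on k m W1 (\<lambda>y. d (inv (F y)) i)" if i: "i < n" for i k
  proof -
    have "Ck_on k m W1 (\<lambda>y. d (inv (inv_into U c (c (F y)))) i)"
    proof (rule Ck_on_compose [OF W1 Q0, where g = "\<lambda>y. c (F y)" and f = "\<lambda>x. d (inv (inv_into U c x)) i"])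
      show "Ck_on k m W1 (\<lambda>y. c (F y) j)" if "j < n" for j
        by (rule Ck_on_subset [OF W0(6) [OF that]]) (auto simp: W1_def)
    qed (use t i in \<open>auto simp: W1_def smooth_on_def\<close>)
    then show ?thesis
      using Ck_on_cong [OF W1, of "\<lambda>y. d (inv (inv_into U c (c (F y)))) i" "\<lambda>y. d (inv (F y)) i" k] cc by simp
  qed
  moreover have "inv (F y) \<in> V" if y: "y \<in> W1" for y
  proof -
    obtain p where "p \<in> U" "inv p \<in> V" "c (F y) = c p" using y unfolding W1_def Q0_def by blast
    moreover have "F y = inv_into U c (c (F y))" using cc [OF y] by simp
    ultimately show ?thesis using chart_properties(4) [OF chart [OF W0(4)], of p] by simp
  qed
  moreover have "x \<in> W1" using W0(2,5) V(2) unfolding W1_def Q0_def by blast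
  ultimately show "\<exists>W' U c. openin (Euclidean_space m) W' \<and> x \<in> W' \<and> (U, c) \<in> A \<and>
      (\<forall>y\<in>W'. inv (F y) \<in> U) \<and> (\<forall>i<n. \<forall>k. Ck_on k m W' (\<lambda>y. c (inv (F y)) i))"
    using W1 V(1) by (intro exI[of _ W1] exI[of _ V] exI[of _ d]) blast
qed

text \<open>In a product chart the pair of \<open>F\<close> and \<open>E\<close> is the
  concatenation of their coordinate expressions, and multiplication read in that chart is smooth by
  \<open>smooth_mult\<close>; the claim is the composition of the two.\<close>

lemma smooth_into_mult:
  assumes F: "smooth_into m W F" and E: "smooth_into m W E"
  shows "smooth_into m W (\<lambda>x. F x \<otimes> E x)"
proof (rule smooth_intoI [OF smooth_into_open [OF F]])
  fix x assume x: "x \<in> W"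
  obtain WF U c where WF: "openin (Euclidean_space m) WF" "x \<in> WF" "WF \<subseteq> W" "(U, c) \<in> A"
    "\<And>y. y \<in> WF \<Longrightarrow> F y \<in> U" "\<And>i k. i < n \<Longrightarrow> Ck_on k m WF (\<lambda>y. c (F y) i)"
    using smooth_intoE [OF F x] by blast
  obtain WE U' c' where WE: "openin (Euclidean_space m) WE" "x \<in> WE" "WE \<subseteq> W" "(U', c') \<in> A"
    "\<And>y. y \<in> WE \<Longrightarrow> E y \<in> U'" "\<And>i k. i < n \<Longrightarrow> Ck_on k m WE (\<lambda>y. c' (E y) i)"
    using smooth_intoE [OF E x] by blast
  have "F x \<otimes> E x \<in> carrier G" using smooth_into_carrier F E x by blast
  then obtain V d where V: "(V, d) \<in> A" "F x \<otimes> E x \<in> V" by (rule chart_at)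
  \<comment> \<open>Written exactly as in \<open>prod_atlas\<close>, so that membership there is
    immediate; afterwards it is used as \<open>join\<close>.\<close>
  define cc where "cc = (\<lambda>(x, y) i. if i < n then c x i else c' y (i - n))"
  have cc_join: "cc (p, q) = join n (c p) (c' q)" for p q by (simp add: cc_def join_def)
  have mem: "(U \<times> U', cc) \<in> prod_atlas n A A"
    unfolding prod_atlas_def cc_def using WF(4) WE(4) by blast
  have inj: "inj_on cc (U \<times> U')"
  proof (rule inj_onI, clarify)
    fix p q p' q' assume h: "p \<in> U" "q \<in> U'" "p' \<in> U" "q' \<in> U'" "cc (p, q) = cc (p', q')"
    then have "c p = c p'" "c' q = c' q'"
      using half_join [of "c p" n "c' q"] half_join [of "c p'" n "c' q'"] half_join [of "c' q" n] 
        chart_esp [OF WF(4)] chart_esp [OF WE(4)]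
      by (metis cc_join half_join(1), metis cc_join half_join(2))
    then show "p = p' \<and> q = q'"
      using h chart_properties(3) [OF chart [OF WF(4)]] chart_properties(3) [OF chart [OF WE(4)]]
      by (simp add: inj_on_eq_iff)
  qed
  define Q0 where "Q0 = cc ` ((U \<times> U') \<inter> (\<lambda>(x, y). x \<otimes> y) -` V)"
  have t: "smooth_on (n + n) n Q0 (\<lambda>z. d ((\<lambda>(x, y). x \<otimes> y) (inv_into (U \<times> U') cc z)))"
    using smooth_mult mem V(1) unfolding smooth_map_def smooth_in_charts_def Q0_def by fast
  then have Q0: "openin (Euclidean_space (n + n)) Q0" by (simp add: smooth_on_def)
  let ?g = "\<lambda>y. join n (c (F y)) (c' (E y))"
  have W0: "openin (Euclidean_space m) (WF \<inter> WE)" using WF(1) WE(1) by blast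
  have g: "Ck_on k m (WF \<inter> WE) (\<lambda>y. ?g y j)" if "j < n + n" for k j
    using that by (intro join_smooth Ck_on_subset [OF WF(6)] Ck_on_subset [OF WE(6)]) auto
  define W1 where "W1 = {y \<in> WF \<inter> WE. ?g y \<in> Q0}"
  have W1: "openin (Euclidean_space m) W1"
    unfolding W1_def using WE(5) chart_esp [OF WE(4)]
    by (intro Ck_preimage_open [OF W0 Q0 _ g] join_esp) auto
  have cc: "inv_into (U \<times> U') cc (?g y) = (F y, E y)" if "y \<in> W1" for y
    using inv_into_f_f [OF inj, of "(F y, E y)"] WF(5) WE(5) that by (simp add: W1_def cc_join)
  have "Ck_on k m W1 (\<lambda>y. d (F y \<otimes> E y) i)" if i: "i < n" for i k
  proof -
    have "Ck_on k m W1 (\<lambda>y. d ((\<lambda>(x, y). x \<otimes> y) (inv_into (U \<times> U') cc (?g y))) i)"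
    proof (rule Ck_on_compose [OF W1 Q0, where g = ?g and
          f = "\<lambda>z. d ((\<lambda>(x, y). x \<otimes> y) (inv_into (U \<times> U') cc z)) i"])
      show "Ck_on k m W1 (\<lambda>y. ?g y j)" if "j < n + n" for j
        by (rule Ck_on_subset [OF g [OF that]]) (auto simp: W1_def)
    qed (use t i in \<open>auto simp: W1_def smooth_on_def\<close>)
    then show ?thesis
      using Ck_on_cong [OF W1, of "\<lambda>y. d ((\<lambda>(x, y). x \<otimes> y) (inv_into (U \<times> U') cc (?g y))) i" "\<lambda>y. d (F y \<otimes> E y) i" k] cc
      by simp
  qed
  moreover have "F y \<otimes> E y \<in> V" if y: "y \<in> W1" for y
  proof -
    obtain p where p: "p \<in> U \<times> U'" "(\<lambda>(x, y). x \<otimes> y) p \<in> V" "?g y = cc p" using y unfolding W1_def Q0_def by blast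
    have "(F y, E y) = p" using cc [OF y] inv_into_f_f [OF inj p(1)] p(3) by simp
    then show ?thesis using p(2) by auto
  qed
  moreover have "x \<in> W1"
  proof -
    have "?g x = cc (F x, E x)" by (simp add: cc_join)
    moreover have "(F x, E x) \<in> (U \<times> U') \<inter> (\<lambda>(x, y). x \<otimes> y) -` V" using WF(2,5) WE(2,5) V(2) by simp
    ultimately show ?thesis using WF(2) WE(2) unfolding W1_def Q0_def by blast
  qed
  ultimately show "\<exists>W' U c. openin (Euclidean_space m) W' \<and> x \<in> W' \<and> (U, c) \<in> A \<and>
      (\<forall>y\<in>W'. F y \<otimes> E y \<in> U) \<and> (\<forall>i<n. \<forall>k. Ck_on k m W' (\<lambda>y. c (F y \<otimes> E y) i))"
    using W1 V(1) by (intro exI[of _ W1] exI[of _ V] exI[of _ d]) blast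
qed

end

text \<open>
  A subgroup \<open>K\<close> with its own topology \<open>S\<close> and one chart \<open>\<psi>\<close> around the unit, with inverse
  \<open>\<iota>\<close>; the left translates of \<open>\<psi>\<close> form an atlas.
\<close>

locale immersed_subgroup = lie_structure G T n A + K: topological_group K S
  for G :: "('a, 'b) monoid_scheme" (structure) and T n A and K :: "'a monoid" and S +
  fixes d :: nat and V :: "'a set" and \<psi> :: "'a \<Rightarrow> nat \<Rightarrow> real" and D :: "(nat \<Rightarrow> real) set"
    and \<iota> :: "(nat \<Rightarrow> real) \<Rightarrow> 'a"
  assumes K_carrier: "carrier K \<subseteq> carrier G" and K_mult: "mult K = mult G"
    and K_inv: "\<And>x. x \<in> carrier K \<Longrightarrow> inv\<^bsub>K\<^esub> x = inv x"
    and S_Hausdorff: "Hausdorff_space S"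
    and V_open: "openin S V" and V_one: "\<one> \<in> V" and D_open: "openin (Euclidean_space d) D"
    and \<psi>: "homeomorphic_maps (subtopology S V) (subtopology (Euclidean_space d) D) \<psi> \<iota>"
    and \<iota>_smooth: "smooth_into d D \<iota>"
    and \<psi>_smooth: "\<And>m W F i k. \<lbrakk>smooth_into m W F; \<And>x. x \<in> W \<Longrightarrow> F x \<in> V; i < d\<rbrakk> \<Longrightarrow> Ck_on k m W (\<lambda>x. \<psi> (F x) i)"
begin

lemma topspace_V: "topspace (subtopology S V) = V"
  using openin_subset [OF V_open] by auto

lemma topspace_D: "topspace (subtopology (Euclidean_space d) D) = D"
  using openin_subset [OF D_open] by auto

lemma \<psi>_D: "p \<in> V \<Longrightarrow> \<psi> p \<in> D" and \<iota>_\<psi>: "p \<in> V \<Longrightarrow> \<iota> (\<psi> p) = p"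
  and \<iota>_V: "w \<in> D \<Longrightarrow> \<iota> w \<in> V" and \<psi>_\<iota>: "w \<in> D \<Longrightarrow> \<psi> (\<iota> w) = w"
  using \<psi> unfolding homeomorphic_maps_def continuous_map_def topspace_V topspace_D by auto

lemma \<psi>_continuous: "continuous_map (subtopology S V) (subtopology (Euclidean_space d) D) \<psi>"
  and \<iota>_continuous: "continuous_map (subtopology (Euclidean_space d) D) S \<iota>"
  using \<psi> continuous_map_into_fulltopology unfolding homeomorphic_maps_def by blast+

lemma D_esp: "w \<in> D \<Longrightarrow> w \<in> esp d"
  using openin_subset [OF D_open] by blast

lemma V_K: "p \<in> V \<Longrightarrow> p \<in> carrier K"
  using K.openin_carrier [OF V_open] .

lemma K_m_closed: "x \<in> carrier K \<Longrightarrow> y \<in> carrier K \<Longrightarrow> x \<otimes> y \<in> carrier K"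
  using K.m_closed by (simp add: K_mult)

lemma K_inv_closed: "x \<in> carrier K \<Longrightarrow> inv x \<in> carrier K"
  using K.inv_closed K_inv by metis

lemma K_G: "x \<in> carrier K \<Longrightarrow> x \<in> carrier G"
  using K_carrier by blast

text \<open>The translate of \<open>V\<close> by \<open>a\<close>; \<open>crd a\<close> is the chart
  \<psi> moved there, and \<open>par a\<close> is its inverse.\<close>

definition dom :: "'a \<Rightarrow> 'a set" where
  "dom a = {p \<in> carrier K. inv a \<otimes> p \<in> V}"

definition crd :: "'a \<Rightarrow> 'a \<Rightarrow> nat \<Rightarrow> real" where
  "crd a p = \<psi> (inv a \<otimes> p)"

definition par :: "'a \<Rightarrow> (nat \<Rightarrow> real) \<Rightarrow> 'a" where
  "par a w = a \<otimes> \<iota> w"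

definition translates :: "'a chart set" where
  "translates = {(dom a, crd a) | a. a \<in> carrier K}"

lemma dom_open: "a \<in> carrier K \<Longrightarrow> openin S (dom a)"
  using K.openin_translate [OF V_open] by (simp add: dom_def K_mult K_inv)

lemma crd_par:
  assumes a: "a \<in> carrier K"
  shows "p \<in> dom a \<Longrightarrow> crd a p \<in> D" "p \<in> dom a \<Longrightarrow> par a (crd a p) = p"
    "w \<in> D \<Longrightarrow> par a w \<in> dom a" "w \<in> D \<Longrightarrow> crd a (par a w) = w"
proof -
  show "p \<in> dom a \<Longrightarrow> crd a p \<in> D" using \<psi>_D by (simp add: dom_def crd_def)
  show "p \<in> dom a \<Longrightarrow> par a (crd a p) = p"
    using \<iota>_\<psi> a K_G by (simp add: dom_def crd_def par_def m_assoc [symmetric])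
  assume w: "w \<in> D"
  then have "\<iota> w \<in> carrier K" using \<iota>_V V_K by blast
  moreover have "inv a \<otimes> (a \<otimes> \<iota> w) = \<iota> w" using a calculation K_G by (simp add: m_assoc [symmetric])
  ultimately show "par a w \<in> dom a" "crd a (par a w) = w"
    using w a \<iota>_V \<psi>_\<iota> K_m_closed by (simp_all add: dom_def crd_def par_def)
qed

lemma crd_image: "a \<in> carrier K \<Longrightarrow> crd a ` dom a = D"
  using crd_par by (auto simp: image_iff) metis

lemma par_continuous:
  assumes "a \<in> carrier K"
  shows "continuous_map (subtopology (Euclidean_space d) D) S (par a)"
  using continuous_map_compose [OF \<iota>_continuous K.continuous_lmult [OF assms]]
  by (simp add: o_def par_def [abs_def] K_mult)

lemma par_smooth:
  assumes "a \<in> carrier K"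
  shows "smooth_into d D (par a)"
  unfolding par_def [abs_def]
  by (intro smooth_into_mult smooth_into_const \<iota>_smooth D_open K_G assms)

lemma translate_chart:
  assumes a: "a \<in> carrier K"
  shows "is_chart d S (dom a, crd a)"
proof -
  have "continuous_map S S (\<lambda>p. inv a \<otimes> p)"
    using K.continuous_lmult [of "inv a"] K_inv_closed [OF a] by (simp add: K_mult)
  then have "continuous_map (subtopology S (dom a)) (subtopology S V) (\<lambda>p. inv a \<otimes> p)"
    by (auto simp: continuous_map_in_subtopology dom_def continuous_map_from_subtopology)
  from continuous_map_compose [OF this \<psi>_continuous]
  have "continuous_map (subtopology S (dom a)) (subtopology (Euclidean_space d) D) (crd a)"
    by (simp add: o_def crd_def [abs_def])
  moreover have "continuous_map (subtopology (Euclidean_space d) D) (subtopology S (dom a)) (par a)"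
    using par_continuous [OF a] crd_par(3) [OF a] by (auto simp: continuous_map_in_subtopology)
  ultimately have "homeomorphic_maps (subtopology S (dom a)) (subtopology (Euclidean_space d) D) (crd a) (par a)"
    using crd_par [OF a] by (simp add: homeomorphic_maps_def)
  then have "homeomorphic_map (subtopology S (dom a)) (subtopology (Euclidean_space d) (crd a ` dom a)) (crd a)"
    unfolding crd_image [OF a] homeomorphic_map_maps by blast
  then show ?thesis
    using dom_open [OF a] D_open crd_image [OF a] by (simp add: is_chart_def)
qed

text \<open>Read in the chart at \<open>b\<close>, the map is \<psi> applied to
  \<open>inv b \<otimes> f (j w)\<close>, which is smooth into \<open>G\<close> and takes values in
  \<open>V\<close>. This is the situation of \<open>\<psi>_smooth\<close>, so \<psi> never has to be
  extended off \<open>V\<close>. Openness of the domain needs continuity into \<open>S\<close>,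
  which can be finer than the topology of \<open>G\<close>; hence the two separate conditions on
  \<open>f\<close>.\<close>

lemma smooth_in_chartsI:
  assumes W: "openin (Euclidean_space m) W"
    and c: "\<And>p. p \<in> U \<Longrightarrow> c p \<in> W \<and> j (c p) = p" "\<And>w. w \<in> W \<Longrightarrow> j w \<in> U \<and> c (j w) = w"
    and f: "continuous_map (subtopology (Euclidean_space m) W) S (\<lambda>w. f (j w))"
      "smooth_into m W (\<lambda>w. f (j w))"
    and b: "b \<in> carrier K"
  shows "smooth_in_charts m d (U, c) (dom b, crd b) f"
proof -
  have inj: "inj_on c U" using c(1) by (metis inj_onI)
  have j: "inv_into U c w = j w" if "w \<in> W" for w
    using inv_into_f_f [OF inj, of "j w"] c(2) [OF that] by simp
  define Q0 where "Q0 = {w \<in> W. f (j w) \<in> dom b}"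
  have O_eq: "c ` (U \<inter> f -` dom b) = Q0"
  proof (intro equalityI subsetI)
    fix w assume "w \<in> c ` (U \<inter> f -` dom b)"
    then obtain p where "p \<in> U" "f p \<in> dom b" "w = c p" by blast
    then show "w \<in> Q0" using c(1) [of p] by (simp add: Q0_def)
  next
    fix w assume "w \<in> Q0"
    then show "w \<in> c ` (U \<inter> f -` dom b)"
      using c(2) [of w] by (intro image_eqI[of _ _ "j w"]) (auto simp: Q0_def)
  qed
  have "openin (subtopology (Euclidean_space m) W) {w \<in> topspace (subtopology (Euclidean_space m) W). f (j w) \<in> dom b}"
    using f(1) dom_open [OF b] by (rule openin_continuous_map_preimage)
  then have Q0: "openin (Euclidean_space m) Q0"
    unfolding Q0_def using openin_open_subtopology [OF W] openin_subset [OF W] by (simp add: Int_absorb1)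
  have eq: "crd b (f (inv_into U c w)) = \<psi> (inv b \<otimes> f (j w))" if "w \<in> Q0" for w
    using j that by (simp add: Q0_def crd_def)
  have sm: "smooth_into m Q0 (\<lambda>w. inv b \<otimes> f (j w))"
    using b K_G by (intro smooth_into_mult smooth_into_const Q0 smooth_into_subset [OF f(2)]) (auto simp: Q0_def)
  have inV: "inv b \<otimes> f (j w) \<in> V" if "w \<in> Q0" for w using that by (simp add: Q0_def dom_def)
  have "Ck_on k m Q0 (\<lambda>w. crd b (f (inv_into U c w)) i)" if "i < d" for i k
    using Ck_on_cong [OF Q0, of "\<lambda>w. crd b (f (inv_into U c w)) i" "\<lambda>w. \<psi> (inv b \<otimes> f (j w)) i" k]
      \<psi>_smooth [OF sm inV that] eq by simp
  moreover have "crd b (f (inv_into U c w)) \<in> esp d" if "w \<in> Q0" for w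
    using eq [OF that] \<psi>_D inV [OF that] D_esp by simp
  ultimately show ?thesis
    unfolding smooth_in_charts_def smooth_on_def prod.case O_eq using Q0 by blast
qed

lemma translates_atlas: "smooth_atlas d S translates"
  unfolding smooth_atlas_def
proof (intro conjI ballI)
  show "is_chart d S p" if "p \<in> translates" for p
    using that translate_chart by (auto simp: translates_def)
  have "a \<in> dom a" if "a \<in> carrier K" for a
    using that V_one K_G by (simp add: dom_def)
  then show "topspace S = (\<Union>(U, c)\<in>translates. U)"
    by (auto simp: translates_def K.topspace_eq_carrier dom_def)
  fix p p' assume "p \<in> translates" "p' \<in> translates"
  then obtain a b where "a \<in> carrier K" "p = (dom a, crd a)" "b \<in> carrier K" "p' = (dom b, crd b)"
    unfolding translates_def by blast
  then show "smooth_in_charts d d p p' (\<lambda>x. x)"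
    using smooth_in_chartsI [OF D_open, of "dom a" "crd a" "par a" "\<lambda>x. x" b] crd_par [of a] par_continuous par_smooth
    by simp
qed

lemma translates_inv: "smooth_map d S translates d S translates (\<lambda>x. inv\<^bsub>K\<^esub> x)"
  unfolding smooth_map_def
proof (intro conjI ballI K.continuous_inv)
  fix p p' assume "p \<in> translates" "p' \<in> translates"
  then obtain a b where ab: "a \<in> carrier K" "p = (dom a, crd a)" "b \<in> carrier K" "p' = (dom b, crd b)"
    unfolding translates_def by blast
  have par_K: "par a w \<in> carrier K" if "w \<in> D" for w
    using crd_par(3) [OF ab(1) that] by (simp add: dom_def)
  have "continuous_map (subtopology (Euclidean_space d) D) S (\<lambda>w. inv\<^bsub>K\<^esub> (par a w))"
    using continuous_map_compose [OF par_continuous [OF ab(1)] K.continuous_inv] by (simp add: o_def)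
  moreover have "smooth_into d D (\<lambda>w. inv\<^bsub>K\<^esub> (par a w))"
    by (rule smooth_into_cong [OF smooth_into_inv [OF par_smooth [OF ab(1)]]]) (simp add: K_inv par_K)
  ultimately show "smooth_in_charts d d p p' (\<lambda>x. inv\<^bsub>K\<^esub> x)"
    unfolding ab(2,4) using crd_par [OF ab(1)] ab(3)
    by (intro smooth_in_chartsI [OF D_open, of "dom a" "crd a" "par a"]) auto
qed

text \<open>The set \<open>W\<close> is the square of \<open>D\<close> inside (d+d)-space, and the
  inverse of a product chart parametrizes the two factors by the two halves of the
  coordinates.\<close>

lemma translates_mult:
  "smooth_map (d + d) (prod_topology S S) (prod_atlas d translates translates) d S translates (\<lambda>(x, y). x \<otimes>\<^bsub>K\<^esub> y)"
  unfolding smooth_map_def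
proof (intro conjI ballI K.continuous_mult)
  fix p p' assume p: "p \<in> prod_atlas d translates translates" and p': "p' \<in> translates"
  obtain f where f: "f \<in> carrier K" "p' = (dom f, crd f)" using p' unfolding translates_def by blast
  obtain a b where a: "a \<in> carrier K" and b: "b \<in> carrier K"
    and p_eq: "p = (dom a \<times> dom b, \<lambda>(x, y) i. if i < d then crd a x i else crd b y (i - d))"
    using p unfolding prod_atlas_def translates_def by blast
  let ?c = "\<lambda>(x, y) i. if i < d then crd a x i else crd b y (i - d)"
  have c: "?c (x, y) = join d (crd a x) (crd b y)" for x y by (simp add: join_def)
  define W1 where "W1 = {z \<in> esp (d + d). fst_half d z \<in> D}"
  define W where "W = {z \<in> W1. snd_half d z \<in> D}"
  have W1: "openin (Euclidean_space (d + d)) W1"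
    unfolding W1_def by (intro Ck_preimage_open [OF openin_topspace D_open half_esp(1) half_smooth(1)] openin_topspace)
  have W: "openin (Euclidean_space (d + d)) W"
    unfolding W_def by (intro Ck_preimage_open [OF W1 D_open half_esp(2) half_smooth(2)] W1)
  have WD: "fst_half d z \<in> D" "snd_half d z \<in> D" "z \<in> esp (d + d)" if "z \<in> W" for z
    using that by (auto simp: W_def W1_def)
  let ?E = "subtopology (Euclidean_space (d + d)) W"
  have cont: "continuous_map ?E (subtopology (Euclidean_space d) D) g"
    if "\<And>z. z \<in> W \<Longrightarrow> g z \<in> D" "\<And>j. j < d \<Longrightarrow> Ck_on 0 (d + d) W (\<lambda>z. g z j)" for g
    using that D_esp by (auto simp: continuous_map_in_subtopology intro!: continuous_map_into_esp)
  have c1: "continuous_map ?E (subtopology (Euclidean_space d) D) (fst_half d)"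
    by (rule cont [OF WD(1) half_smooth(1) [OF W]])
  have c2: "continuous_map ?E (subtopology (Euclidean_space d) D) (snd_half d)"
    by (rule cont [OF WD(2) half_smooth(2) [OF W]])
  have "continuous_map ?E S (\<lambda>z. par a (fst_half d z))" "continuous_map ?E S (\<lambda>z. par b (snd_half d z))"
    using continuous_map_compose [OF c1 par_continuous [OF a]] continuous_map_compose [OF c2 par_continuous [OF b]]
    by (simp_all add: o_def)
  then have "continuous_map ?E S (\<lambda>z. par a (fst_half d z) \<otimes>\<^bsub>K\<^esub> par b (snd_half d z))"
    by (rule K.continuous_mult_maps)
  moreover have "smooth_into (d + d) W (\<lambda>z. par a (fst_half d z) \<otimes>\<^bsub>K\<^esub> par b (snd_half d z))"
    unfolding K_mult
    by (intro smooth_into_mult smooth_into_compose [OF par_smooth [OF a] W] smooth_into_compose [OF par_smooth [OF b] W]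
        WD half_smooth W)
  moreover have "?c q \<in> W \<and> (par a (fst_half d (?c q)), par b (snd_half d (?c q))) = q"
    if q_dom: "q \<in> dom a \<times> dom b" for q
  proof -
    obtain x y where q: "q = (x, y)" "x \<in> dom a" "y \<in> dom b" using q_dom by blast
    have D: "crd a x \<in> D" "crd b y \<in> D" using crd_par(1) a b q by auto
    have cq: "?c q = join d (crd a x) (crd b y)" unfolding q(1) by (rule c)
    have h: "fst_half d (?c q) = crd a x" "snd_half d (?c q) = crd b y"
      unfolding cq using half_join D D_esp by auto
    have "?c q \<in> esp (d + d)" unfolding cq using D D_esp join_esp by blast
    then have "?c q \<in> W" using D unfolding W_def W1_def mem_Collect_eq h by blast
    moreover have "(par a (fst_half d (?c q)), par b (snd_half d (?c q))) = q"
      unfolding h using crd_par(2) a b q by simp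
    ultimately show ?thesis by blast
  qed
  moreover have "(par a (fst_half d z), par b (snd_half d z)) \<in> dom a \<times> dom b \<and>
      ?c (par a (fst_half d z), par b (snd_half d z)) = z" if z: "z \<in> W" for z
    unfolding c using crd_par(3,4) a b WD [OF z] join_half by auto
  ultimately show "smooth_in_charts (d + d) d p p' (\<lambda>(x, y). x \<otimes>\<^bsub>K\<^esub> y)"
    unfolding p_eq f(2) using f(1)
    by (intro smooth_in_chartsI [OF W, where j = "\<lambda>z. (par a (fst_half d z), par b (snd_half d z))"]) simp_all
qed

lemma lie_group_K: "lie_group K S"
proof (intro lie_group.intro lie_group_axioms.intro)
  show "topological_group K S" by (rule K.topological_group_axioms)
qed (use S_Hausdorff translates_atlas translates_mult translates_inv in blast)+

end

section \<open>Charts of the generated group\<close>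

lemma uniform_delta:
  fixes P :: "nat \<Rightarrow> real \<Rightarrow> bool"
  assumes "\<And>i. i < n \<Longrightarrow> \<exists>\<delta>>0. P i \<delta>"
    and "\<And>i \<delta> \<delta>'. \<lbrakk>P i \<delta>; 0 < \<delta>'; \<delta>' \<le> \<delta>\<rbrakk> \<Longrightarrow> P i \<delta>'"
  shows "\<exists>\<delta>>0. \<forall>i<n. P i \<delta>"
  using assms(1)
proof (induction n)
  case (Suc n)
  then obtain a where a: "a > 0" "\<forall>i<n. P i a" by auto
  obtain b where b: "b > 0" "P n b" using Suc.prems [of n] by auto
  have "P i (min a b)" if "i < Suc n" for i
    using that a b assms(2) [of i a "min a b"] assms(2) [of n b "min a b"] by (cases "i = n") auto
  then show ?case using a(1) b(1) by (intro exI[of _ "min a b"]) auto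
qed (auto intro: exI[of _ 1])

lemma C1_strict_vec:
  fixes f :: "nat \<Rightarrow> (nat \<Rightarrow> real) \<Rightarrow> real"
  assumes U: "openin (Euclidean_space m) U" and f: "\<And>i. i < n \<Longrightarrow> Ck_on 1 m U (f i)" and x: "x \<in> U" and \<epsilon>: "\<epsilon> > 0"
  shows "\<exists>\<delta>>0. \<forall>i<n. \<forall>y\<in>esp m. \<forall>z\<in>esp m. nrm m (\<lambda>i. y i - x i) < \<delta> \<longrightarrow> nrm m (\<lambda>i. z i - x i) < \<delta> \<longrightarrow>
       \<bar>f i y - f i z - (\<Sum>j<m. partial_deriv j (f i) x * (y j - z j))\<bar> \<le> \<epsilon> * nrm m (\<lambda>i. y i - z i)"
    (is "\<exists>\<delta>>0. \<forall>i<n. ?P i \<delta>")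
proof (rule uniform_delta [where P = ?P])
  fix i assume i: "i < n"
  obtain \<delta> where "\<delta> > 0" "\<And>y z. \<lbrakk>y \<in> esp m; z \<in> esp m; nrm m (\<lambda>i. y i - x i) < \<delta>; nrm m (\<lambda>i. z i - x i) < \<delta>\<rbrakk> \<Longrightarrow>
       \<bar>f i y - f i z - (\<Sum>j<m. partial_deriv j (f i) x * (y j - z j))\<bar> \<le> \<epsilon> * nrm m (\<lambda>i. y i - z i)"
    using C1_strict [OF U f [OF i] x \<epsilon>] by blast
  then show "\<exists>\<delta>>0. ?P i \<delta>" by (intro exI[of _ \<delta>]) simp
next
  fix i and \<delta> \<delta>' :: real assume "?P i \<delta>" "\<delta>' \<le> \<delta>"
  then show "?P i \<delta>'" by (meson order_less_le_trans)
qed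

lemma nrm_join: "nrm (n + n) (\<lambda>i. join n x y i - join n x' y' i) = nrm n (\<lambda>i. x i - x' i) + nrm n (\<lambda>i. y i - y' i)"
  by (simp add: nrm_def sum_double join_def)

lemma join_zero: "join n (\<lambda>_. 0) (\<lambda>_. 0) = (\<lambda>_. 0)"
  by (auto simp: join_def)

lemma fun_upd_join:
  "k < n \<Longrightarrow> (join n x y)(k := t) = join n (x(k := t)) y"
  "(join n x y)(n + k := t) = join n x (y(k := t))"
  by (auto simp: join_def fun_eq_iff)

lemma deriv_coordinate: "deriv (\<lambda>t :: real. if i = k then t else 0) a = (if i = k then 1 else 0)"
  by (cases "i = k") (auto intro!: DERIV_imp_deriv)

section \<open>The group operations of \<open>G\<close> in a chart centred at the unit\<close>

locale closed_approximate_lie = closed_approximate_subgroup G T \<Lambda> + lie_structure G T n A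
  for G :: "('a, 'b) monoid_scheme" (structure) and T \<Lambda> n A +
  fixes U :: "'a set" and c :: "'a \<Rightarrow> nat \<Rightarrow> real"
  assumes chart_one: "(U, c) \<in> A" "\<one> \<in> U"
begin

text \<open>The chart shifted so that the unit sits at the origin; \<open>B0\<close> is its image
  and \<open>j0\<close> its inverse.\<close>

definition c0 :: "'a \<Rightarrow> nat \<Rightarrow> real" where
  "c0 p = (\<lambda>i. c p i - c \<one> i)"

definition B0 :: "(nat \<Rightarrow> real) set" where
  "B0 = {x \<in> esp n. (\<lambda>i. x i + c \<one> i) \<in> c ` U}"

definition j0 :: "(nat \<Rightarrow> real) \<Rightarrow> 'a" where
  "j0 x = inv_into U c (\<lambda>i. x i + c \<one> i)"

lemmas chart_U = chart_properties [OF chart [OF chart_one(1)]]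

lemma c_one_esp: "c \<one> \<in> esp n"
  using chart_esp [OF chart_one] .

lemma c0_esp: "p \<in> U \<Longrightarrow> c0 p \<in> esp n"
  unfolding c0_def by (intro esp_diff chart_esp [OF chart_one(1)] c_one_esp)

lemma shift_smooth: "openin (Euclidean_space n) W \<Longrightarrow> Ck_on k n W (\<lambda>x. x i + c \<one> i)"
  by (intro Ck_on_add Ck_on_coordinate Ck_on_const)

lemma B0_open: "openin (Euclidean_space n) B0"
  unfolding B0_def
  by (rule Ck_preimage_open [OF openin_topspace chart_U(2)])
    (intro esp_add c_one_esp | rule shift_smooth openin_topspace | assumption)+

lemma B0_esp: "x \<in> B0 \<Longrightarrow> x \<in> esp n"
  by (simp add: B0_def)

lemma j0_smooth: "smooth_into n B0 j0"
  unfolding j0_def [abs_def]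
  by (rule smooth_into_compose [OF smooth_into_chart_inverse [OF chart_one(1)] B0_open])
    (auto simp: B0_def shift_smooth [OF B0_open, unfolded B0_def])

lemma j0_c0: "p \<in> U \<Longrightarrow> c0 p \<in> B0 \<and> j0 (c0 p) = p"
  using c0_esp [of p] chart_U(4) by (simp add: B0_def j0_def c0_def)

lemma c0_j0: "x \<in> B0 \<Longrightarrow> j0 x \<in> U \<and> c0 (j0 x) = x"
  by (simp add: B0_def j0_def c0_def inv_into_into f_inv_into_f)

lemma c0_one: "c0 \<one> = (\<lambda>_. 0)"
  by (simp add: c0_def)

lemma zero_B0: "(\<lambda>_. 0) \<in> B0" and j0_zero: "j0 (\<lambda>_. 0) = \<one>"
  using j0_c0 [OF chart_one(2)] by (simp_all add: c0_one)

lemma j0_carrier: "x \<in> B0 \<Longrightarrow> j0 x \<in> carrier G"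
  using c0_j0 chart_carrier [OF chart_one(1)] by blast

lemma c0_smooth:
  assumes "smooth_into m W F" "\<And>x. x \<in> W \<Longrightarrow> F x \<in> U" "i < n"
  shows "Ck_on k m W (\<lambda>x. c0 (F x) i)"
  unfolding c0_def
  by (intro Ck_on_diff Ck_on_const smooth_into_open [OF assms(1)] smooth_into_chart [OF assms(1) chart_one(1) assms(2,3)])

lemma c0_continuous: "continuous_map (subtopology T U) (Euclidean_space n) c0"
  unfolding c0_def [abs_def]
  by (intro continuous_map_Euclidean_space_diff chart_U(5)) (simp add: c_one_esp)

definition m :: "(nat \<Rightarrow> real) \<Rightarrow> (nat \<Rightarrow> real) \<Rightarrow> nat \<Rightarrow> real" where
  "m x y = c0 (j0 x \<otimes> j0 y)"

definition q :: "(nat \<Rightarrow> real) \<Rightarrow> (nat \<Rightarrow> real) \<Rightarrow> nat \<Rightarrow> real" where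
  "q x y = c0 (inv (j0 x) \<otimes> j0 y)"

text \<open>\<open>Ck_on\<close> speaks of functions of one point, so the product is differentiated
  as a function of concatenated coordinates.\<close>

definition M2 :: "(nat \<Rightarrow> real) \<Rightarrow> 'a" where
  "M2 z = j0 (fst_half n z) \<otimes> j0 (snd_half n z)"

definition Q2 :: "(nat \<Rightarrow> real) \<Rightarrow> 'a" where
  "Q2 z = inv (j0 (fst_half n z)) \<otimes> j0 (snd_half n z)"

definition B2 :: "(nat \<Rightarrow> real) set" where
  "B2 = {z \<in> {z \<in> esp (n + n). fst_half n z \<in> B0}. snd_half n z \<in> B0}"

lemma B2_open: "openin (Euclidean_space (n + n)) B2"
proof -
  have "openin (Euclidean_space (n + n)) {z \<in> esp (n + n). fst_half n z \<in> B0}"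
    by (intro Ck_preimage_open [OF openin_topspace B0_open half_esp(1) half_smooth(1)] openin_topspace)
  from Ck_preimage_open [OF this B0_open half_esp(2) half_smooth(2) [OF this]]
  show ?thesis unfolding B2_def by blast
qed

lemma halves_smooth: "smooth_into (n + n) B2 (\<lambda>z. j0 (fst_half n z))" "smooth_into (n + n) B2 (\<lambda>z. j0 (snd_half n z))"
  by (rule smooth_into_compose [OF j0_smooth B2_open], simp add: B2_def, rule half_smooth [OF B2_open], assumption)+

lemma M2_smooth: "smooth_into (n + n) B2 M2" and Q2_smooth: "smooth_into (n + n) B2 Q2"
  unfolding M2_def [abs_def] Q2_def [abs_def]
  by (intro smooth_into_mult smooth_into_inv halves_smooth)+

lemma join_B2: "x \<in> B0 \<Longrightarrow> y \<in> B0 \<Longrightarrow> join n x y \<in> B2"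
  using half_join [of x n y] half_join [of y n x] B0_esp by (simp add: B2_def join_esp half_join)

lemma M2_join: "x \<in> B0 \<Longrightarrow> y \<in> B0 \<Longrightarrow> c0 (M2 (join n x y)) = m x y"
  using B0_esp by (simp add: M2_def m_def half_join)

text \<open>The domain on which the product stays in the chart, so that \<open>c0\<close> of it is
  smooth.\<close>

definition S2 :: "(nat \<Rightarrow> real) set" where
  "S2 = {z \<in> B2. M2 z \<in> U}"

lemma S2_open: "openin (Euclidean_space (n + n)) S2"
  unfolding S2_def by (rule smooth_into_preimage_open [OF M2_smooth chart_U(1)])

lemma S2_smooth: "i < n \<Longrightarrow> Ck_on k (n + n) S2 (\<lambda>z. c0 (M2 z) i)"
  by (rule c0_smooth [OF smooth_into_subset [OF M2_smooth S2_open]]) (auto simp: S2_def)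

lemma join_zero_S2: "x \<in> B0 \<Longrightarrow> join n x (\<lambda>_. 0) \<in> S2"
proof -
  assume x: "x \<in> B0"
  then have "M2 (join n x (\<lambda>_. 0)) = j0 x"
    using B0_esp j0_carrier by (simp add: M2_def half_join j0_zero)
  then show ?thesis unfolding S2_def using join_B2 [OF x zero_B0] c0_j0 [OF x] by simp
qed

lemma m_right_zero: "x \<in> B0 \<Longrightarrow> m x (\<lambda>_. 0) = x" and m_left_zero: "x \<in> B0 \<Longrightarrow> m (\<lambda>_. 0) x = x"
  using c0_j0 j0_carrier by (simp_all add: m_def j0_zero)

text \<open>Along either half of the coordinates one factor is the unit, and there the product is
  the other factor itself. So the differential of the product at the origin is addition.\<close>

lemma M2_deriv:
  assumes i: "i < n" and k: "k < n"
  shows "partial_deriv k (\<lambda>z. c0 (M2 z) i) (\<lambda>_. 0) = (if i = k then 1 else 0)"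
    "partial_deriv (n + k) (\<lambda>z. c0 (M2 z) i) (\<lambda>_. 0) = (if i = k then 1 else 0)"
proof -
  have ev: "\<forall>\<^sub>F t in nhds 0. (\<lambda>_. 0)(k := t) \<in> B0"
    using eventually_fun_upd [OF B0_open zero_B0 k] .
  have upd: "((\<lambda>_. 0)(k := t)) i = (if i = k then t else 0)" for t :: real by simp
  have "\<forall>\<^sub>F t in nhds 0. c0 (M2 ((\<lambda>_. 0)(k := t))) i = (if i = k then t else 0)"
    using ev
  proof eventually_elim
    case (elim t)
    have "(\<lambda>_. 0)(k := t) = join n ((\<lambda>_. 0)(k := t)) (\<lambda>_. 0)"
      using fun_upd_join(1) [OF k, of "\<lambda>_. 0" "\<lambda>_. 0" t] by (simp only: join_zero)
    then have "c0 (M2 ((\<lambda>_. 0)(k := t))) = (\<lambda>_. 0)(k := t)"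
      using M2_join [OF elim zero_B0] m_right_zero [OF elim] by metis
    then show ?case by (simp only: upd)
  qed
  then show "partial_deriv k (\<lambda>z. c0 (M2 z) i) (\<lambda>_. 0) = (if i = k then 1 else 0)"
    unfolding partial_deriv_def deriv_coordinate [of i k 0, symmetric] by (rule deriv_cong_ev) simp
  have "\<forall>\<^sub>F t in nhds 0. c0 (M2 ((\<lambda>_. 0)(n + k := t))) i = (if i = k then t else 0)"
    using ev
  proof eventually_elim
    case (elim t)
    have "(\<lambda>_. 0)(n + k := t) = join n (\<lambda>_. 0) ((\<lambda>_. 0)(k := t))"
      using fun_upd_join(2) [of n "\<lambda>_. 0" "\<lambda>_. 0" k t] by (simp only: join_zero)
    then have "c0 (M2 ((\<lambda>_. 0)(n + k := t))) = (\<lambda>_. 0)(k := t)"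
      using M2_join [OF zero_B0 elim] m_left_zero [OF elim] by metis
    then show ?case by (simp only: upd)
  qed
  then show "partial_deriv (n + k) (\<lambda>z. c0 (M2 z) i) (\<lambda>_. 0) = (if i = k then 1 else 0)"
    unfolding partial_deriv_def deriv_coordinate [of i k 0, symmetric] by (rule deriv_cong_ev) simp
qed

text \<open>Two radii are needed: the closed ball of radius \<open>R\<close> carries the compact set
  \<open>L\<close>, and factors are restricted to radius \<open>r\<close> so that their products and
  quotients remain within radius \<open>R\<close>.\<close>

lemma radii:
  obtains N R r where "openin T N" "\<one> \<in> N" "N \<subseteq> U" "(\<Lambda>2 <#> \<Lambda>2) \<inter> N \<subseteq> \<Lambda>2" "0 < r" "r \<le> R"
    "\<And>x. \<lbrakk>x \<in> esp n; nrm n x \<le> R\<rbrakk> \<Longrightarrow> x \<in> B0 \<and> j0 x \<in> N"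
    "\<And>x y. \<lbrakk>x \<in> esp n; y \<in> esp n; nrm n x < r; nrm n y < r\<rbrakk> \<Longrightarrow>
       j0 x \<otimes> j0 y \<in> N \<and> inv (j0 x) \<otimes> j0 y \<in> N \<and> nrm n (m x y) < R \<and> nrm n (q x y) < R"
    "compactin (Euclidean_space n) {x \<in> esp n. nrm n x \<le> R \<and> j0 x \<in> \<Lambda>2}"
proof -
  obtain Z where Z: "closedin T Z" "covered Z" "\<Lambda>2 \<subseteq> Z" by (rule closed_cover)
  obtain W1 where W1: "openin T W1" "\<one> \<in> W1" "Z \<inter> W1 \<subseteq> \<Lambda>2" using covered_near_one [OF Z(2)] .
  obtain W2 where W2: "openin T W2" "\<one> \<in> W2" "(\<Lambda>2 <#> \<Lambda>2) \<inter> W2 \<subseteq> \<Lambda>2"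
    using covered_near_one [OF covered_mult [OF covered_\<Lambda>2 covered_\<Lambda>2]] .
  \<comment> \<open>Inside \<open>W1\<close> membership in \<open>Z\<close> implies membership in
    \<open>\<Lambda>2\<close>; inside \<open>W2\<close> products of elements of
    \<open>\<Lambda>2\<close> are back in \<open>\<Lambda>2\<close>; \<open>U\<close> is the chart
    domain.\<close>
  define N where "N = W1 \<inter> W2 \<inter> U"
  have N: "openin T N" "\<one> \<in> N" "N \<subseteq> U" "(\<Lambda>2 <#> \<Lambda>2) \<inter> N \<subseteq> \<Lambda>2"
    unfolding N_def using W1 W2 chart_U(1) chart_one(2) by auto
  have "openin (Euclidean_space n) {x \<in> B0. j0 x \<in> N}" by (rule smooth_into_preimage_open [OF j0_smooth N(1)])
  moreover have "(\<lambda>_. 0) \<in> {x \<in> B0. j0 x \<in> N}" using zero_B0 j0_zero N(2) by simp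
  ultimately obtain a where a: "a > 0" "\<And>x. x \<in> esp n \<Longrightarrow> nrm n (\<lambda>i. x i - 0) < a \<Longrightarrow> x \<in> {x \<in> B0. j0 x \<in> N}"
    by (rule openin_esp_ball) blast
  \<comment> \<open>Halved so that the closed ball of radius \<open>R\<close> lies in the open ball
    of radius \<open>a\<close>.\<close>
  define R where "R = a / 2"
  have R: "R > 0" "\<And>x. \<lbrakk>x \<in> esp n; nrm n x \<le> R\<rbrakk> \<Longrightarrow> x \<in> B0 \<and> j0 x \<in> N"
    unfolding R_def using a by auto
  have near: "\<exists>b>0. \<forall>z\<in>esp (n + n). nrm (n + n) (\<lambda>i. z i - 0) < b \<longrightarrow> z \<in> B2 \<and> F z \<in> N \<and> nrm n (c0 (F z)) < R"
    if F: "smooth_into (n + n) B2 F" and F0: "F (\<lambda>_. 0) = \<one>" for F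
  proof -
    define S where "S = {z \<in> B2. F z \<in> N}"
    have S: "openin (Euclidean_space (n + n)) S" unfolding S_def by (rule smooth_into_preimage_open [OF F N(1)])
    have "openin (Euclidean_space (n + n)) {z \<in> S. c0 (F z) \<in> {x \<in> esp n. nrm n (\<lambda>i. x i - 0) < R}}"
    proof (rule Ck_preimage_open [OF S openin_nrm_ball])
      show "c0 (F z) \<in> esp n" if "z \<in> S" for z using that N(3) by (auto simp: S_def intro: c0_esp)
      show "Ck_on 0 (n + n) S (\<lambda>z. c0 (F z) i)" if "i < n" for i
        by (rule c0_smooth [OF smooth_into_subset [OF F S] _ that]) (use N(3) in \<open>auto simp: S_def\<close>)
    qed
    moreover have "(\<lambda>_. 0) \<in> B2" using join_B2 [OF zero_B0 zero_B0] by (simp add: join_zero)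
    then have "(\<lambda>_. 0) \<in> {z \<in> S. c0 (F z) \<in> {x \<in> esp n. nrm n (\<lambda>i. x i - 0) < R}}"
      using F0 N(2) R(1) by (simp add: S_def c0_one)
    ultimately obtain b where "b > 0" "\<And>z. z \<in> esp (n + n) \<Longrightarrow> nrm (n + n) (\<lambda>i. z i - 0) < b \<Longrightarrow>
        z \<in> {z \<in> S. c0 (F z) \<in> {x \<in> esp n. nrm n (\<lambda>i. x i - 0) < R}}"
      by (rule openin_esp_ball) blast
    then show ?thesis by (intro exI[of _ b]) (simp add: S_def)
  qed
  have z0: "fst_half n (\<lambda>_. 0) = (\<lambda>_. 0)" "snd_half n (\<lambda>_. 0) = (\<lambda>_. 0)" by (auto simp: fst_half_def snd_half_def)
  obtain b1 where b1: "b1 > 0" "\<forall>z\<in>esp (n + n). nrm (n + n) (\<lambda>i. z i - 0) < b1 \<longrightarrow> z \<in> B2 \<and> M2 z \<in> N \<and> nrm n (c0 (M2 z)) < R"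
    using near [OF M2_smooth] by (auto simp: M2_def z0 j0_zero)
  obtain b2 where b2: "b2 > 0" "\<forall>z\<in>esp (n + n). nrm (n + n) (\<lambda>i. z i - 0) < b2 \<longrightarrow> z \<in> B2 \<and> Q2 z \<in> N \<and> nrm n (c0 (Q2 z)) < R"
    using near [OF Q2_smooth] by (auto simp: Q2_def z0 j0_zero)
  \<comment> \<open>Half of \<open>b1\<close> and \<open>b2\<close>, because the norm of a
    concatenation is the sum of the norms.\<close>
  define r where "r = min R (min b1 b2 / 2)"
  have r: "0 < r" "r \<le> R" "2 * r \<le> b1" "2 * r \<le> b2" unfolding r_def using R(1) b1(1) b2(1) by auto
  have ops: "j0 x \<otimes> j0 y \<in> N \<and> inv (j0 x) \<otimes> j0 y \<in> N \<and> nrm n (m x y) < R \<and> nrm n (q x y) < R"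
    if h: "x \<in> esp n" "y \<in> esp n" "nrm n x < r" "nrm n y < r" for x y
  proof -
    have z: "join n x y \<in> esp (n + n)" by (rule join_esp [OF h(2)])
    have "nrm (n + n) (\<lambda>i. join n x y i - 0) = nrm n x + nrm n y"
      using nrm_join [of n x y "\<lambda>_. 0" "\<lambda>_. 0"] by (simp add: join_zero)
    then have "nrm (n + n) (\<lambda>i. join n x y i - 0) < b1" "nrm (n + n) (\<lambda>i. join n x y i - 0) < b2"
      using h(3,4) r(3,4) by linarith+
    then have "M2 (join n x y) \<in> N" "nrm n (c0 (M2 (join n x y))) < R" "Q2 (join n x y) \<in> N" "nrm n (c0 (Q2 (join n x y))) < R"
      using b1(2) b2(2) z by blast+
    then show ?thesis by (simp add: M2_def Q2_def half_join h(1,2) m_def q_def)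
  qed
  let ?B = "{x \<in> esp n. nrm n x \<le> R}"
  \<comment> \<open>On this ball \<open>\<Lambda>2\<close> agrees with the closed set
    \<open>Z\<close>, which makes the set closed and hence compact.\<close>
  have L_eq: "{x \<in> esp n. nrm n x \<le> R \<and> j0 x \<in> \<Lambda>2} = {x \<in> topspace (subtopology (Euclidean_space n) ?B). j0 x \<in> Z}"
  proof (intro equalityI subsetI)
    fix x assume "x \<in> {x \<in> topspace (subtopology (Euclidean_space n) ?B). j0 x \<in> Z}"
    then have x: "x \<in> esp n" "nrm n x \<le> R" "j0 x \<in> Z" by auto
    then have "j0 x \<in> W1" using R(2) unfolding N_def by blast
    then show "x \<in> {x \<in> esp n. nrm n x \<le> R \<and> j0 x \<in> \<Lambda>2}" using x W1(3) by blast
  qed (use Z(3) in auto)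
  have "?B \<subseteq> B0" using R(2) by blast
  then have "continuous_map (subtopology (Euclidean_space n) ?B) T j0"
    using smooth_into_continuous [OF j0_smooth] continuous_map_from_subtopology_mono by blast
  then have "closedin (subtopology (Euclidean_space n) ?B) {x \<in> esp n. nrm n x \<le> R \<and> j0 x \<in> \<Lambda>2}"
    unfolding L_eq using Z(1) by (rule closedin_continuous_map_preimage)
  moreover have "compact_space (subtopology (Euclidean_space n) ?B)"
    using compactin_nrm_ball by (rule compact_space_subtopology)
  ultimately have "compactin (subtopology (Euclidean_space n) ?B) {x \<in> esp n. nrm n x \<le> R \<and> j0 x \<in> \<Lambda>2}"
    by (intro closedin_compact_space)
  then have compact: "compactin (Euclidean_space n) {x \<in> esp n. nrm n x \<le> R \<and> j0 x \<in> \<Lambda>2}"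
    by (simp add: compactin_subtopology)
  show thesis
  proof (rule that [OF N r(1,2)])
    show "x \<in> B0 \<and> j0 x \<in> N" if "x \<in> esp n" "nrm n x \<le> R" for x by (rule R(2) [OF that])
  qed (fact ops compact)+
qed

text \<open>The set \<open>\<Lambda>2\<close>, read in the chart, is a compact local subgroup
  \<open>L\<close>. The graph map of \<open>L\<close> followed by \<open>j0\<close> is the inverse
  of a chart of \<open>HG\<close> at the unit, and \<open>immersed_subgroup\<close> spreads it by
  translation.\<close>

theorem lie_group_HG: "lie_group HG TH"
proof -
  obtain N R r where N: "openin T N" "\<one> \<in> N" "N \<subseteq> U" "(\<Lambda>2 <#> \<Lambda>2) \<inter> N \<subseteq> \<Lambda>2" and r: "0 < r" "r \<le> R"
    and R: "\<And>x. \<lbrakk>x \<in> esp n; nrm n x \<le> R\<rbrakk> \<Longrightarrow> x \<in> B0 \<and> j0 x \<in> N"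
    and ops: "\<And>x y. \<lbrakk>x \<in> esp n; y \<in> esp n; nrm n x < r; nrm n y < r\<rbrakk> \<Longrightarrow>
       j0 x \<otimes> j0 y \<in> N \<and> inv (j0 x) \<otimes> j0 y \<in> N \<and> nrm n (m x y) < R \<and> nrm n (q x y) < R"
    and compact: "compactin (Euclidean_space n) {x \<in> esp n. nrm n x \<le> R \<and> j0 x \<in> \<Lambda>2}"
    by (rule radii) blast
  define L where "L = {x \<in> esp n. nrm n x \<le> R \<and> j0 x \<in> \<Lambda>2}"
  have rB: "x \<in> B0" if "x \<in> esp n" "nrm n x < r" for x using R [of x] that r by simp
  have m_j0: "j0 (m x y) = j0 x \<otimes> j0 y" "m x y \<in> esp n"
    and q_j0: "j0 (q x y) = inv (j0 x) \<otimes> j0 y" "q x y \<in> esp n"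
    if "x \<in> esp n" "y \<in> esp n" "nrm n x < r" "nrm n y < r" for x y
    using ops [OF that] N(3) j0_c0 c0_esp unfolding m_def q_def by auto
  have S2: "join n x y \<in> S2" if "x \<in> esp n" "y \<in> esp n" "nrm n x < r" "nrm n y < r" for x y
  proof -
    have "M2 (join n x y) = j0 x \<otimes> j0 y" using that by (simp add: M2_def half_join)
    then show ?thesis using ops [OF that] N(3) join_B2 rB that unfolding S2_def by auto
  qed
  let ?f = "\<lambda>i z. c0 (M2 z) i"
  have f1: "Ck_on 1 (n + n) S2 (?f i)" if "i < n" for i by (rule S2_smooth [OF that])
  have fm: "?f i (join n x y) = m x y i" if "x \<in> esp n" "y \<in> esp n" "nrm n x < r" "nrm n y < r" for x y i
    using M2_join rB that by simp
  have strict: "\<exists>\<delta>>0. \<forall>i<n. \<forall>y\<in>esp (n + n). \<forall>z\<in>esp (n + n).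
      nrm (n + n) (\<lambda>i. y i - x i) < \<delta> \<longrightarrow> nrm (n + n) (\<lambda>i. z i - x i) < \<delta> \<longrightarrow>
      \<bar>?f i y - ?f i z - (\<Sum>j<n + n. partial_deriv j (?f i) x * (y j - z j))\<bar> \<le> \<epsilon> * nrm (n + n) (\<lambda>i. y i - z i)"
    if "x \<in> S2" "\<epsilon> > 0" for x \<epsilon>
    by (rule C1_strict_vec [OF S2_open f1 that])
  interpret local_subgroup n m q L r
  proof
    show "r > 0" by fact
    show "m x (\<lambda>_. 0) = x" if "x \<in> esp n" "nrm n x < r" for x by (rule m_right_zero [OF rB [OF that]])
    show "q x y \<in> esp n \<and> m x (q x y) = y" if h: "x \<in> esp n" "y \<in> esp n" "nrm n x < r" "nrm n y < r" for x y
    proof -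
      have G: "j0 x \<in> carrier G" "j0 y \<in> carrier G" using rB h j0_carrier by auto
      then have "j0 x \<otimes> (inv (j0 x) \<otimes> j0 y) = j0 y" by (simp add: m_assoc [symmetric])
      then have "m x (q x y) = c0 (j0 y)" unfolding m_def q_j0(1) [OF h] by simp
      then show ?thesis using q_j0(2) [OF h] c0_j0 [OF rB [OF h(2,4)]] by simp
    qed
    show "compactin (Euclidean_space n) L" unfolding L_def by (rule compact)
    show "(\<lambda>_. 0) \<in> L" unfolding L_def using r \<Lambda>2_one by (simp add: j0_zero)
    show "m x y \<in> L" if h: "x \<in> L" "y \<in> L" "nrm n x < r" "nrm n y < r" for x y
    proof -
      have E: "x \<in> esp n" "y \<in> esp n" "j0 x \<in> \<Lambda>2" "j0 y \<in> \<Lambda>2" using h unfolding L_def by auto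
      have "j0 x \<otimes> j0 y \<in> \<Lambda>2 <#> \<Lambda>2" using E(3,4) unfolding set_mult_def by blast
      then have "j0 x \<otimes> j0 y \<in> \<Lambda>2" using ops [OF E(1,2) h(3,4)] N(4) by blast
      then show ?thesis
        unfolding L_def using m_j0 [OF E(1,2) h(3,4)] ops [OF E(1,2) h(3,4)] by simp
    qed
    show "q x y \<in> L" if h: "x \<in> L" "y \<in> L" "nrm n x < r" "nrm n y < r" for x y
    proof -
      have E: "x \<in> esp n" "y \<in> esp n" "inv (j0 x) \<in> \<Lambda>2" "j0 y \<in> \<Lambda>2" using h \<Lambda>2_inv unfolding L_def by auto
      have "inv (j0 x) \<otimes> j0 y \<in> \<Lambda>2 <#> \<Lambda>2" using E(3,4) unfolding set_mult_def by blast
      then have "inv (j0 x) \<otimes> j0 y \<in> \<Lambda>2" using ops [OF E(1,2) h(3,4)] N(4) by blast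
      then show ?thesis
        unfolding L_def using q_j0 [OF E(1,2) h(3,4)] ops [OF E(1,2) h(3,4)] by simp
    qed
    show "\<exists>\<delta>>0. \<forall>x\<in>esp n. \<forall>y\<in>esp n. nrm n x < \<delta> \<longrightarrow> nrm n y < \<delta> \<longrightarrow> nrm n (q x y) < \<epsilon>"
      if \<epsilon>: "\<epsilon> > 0" for \<epsilon>
    proof -
      define S where "S = {z \<in> B2. Q2 z \<in> U}"
      have S: "openin (Euclidean_space (n + n)) S"
        unfolding S_def by (rule smooth_into_preimage_open [OF Q2_smooth chart_U(1)])
      have "openin (Euclidean_space (n + n)) {z \<in> S. c0 (Q2 z) \<in> {x \<in> esp n. nrm n (\<lambda>i. x i - 0) < \<epsilon>}}"
      proof (rule Ck_preimage_open [OF S openin_nrm_ball])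
        show "c0 (Q2 z) \<in> esp n" if "z \<in> S" for z using that by (auto simp: S_def intro: c0_esp)
        show "Ck_on 0 (n + n) S (\<lambda>z. c0 (Q2 z) i)" if "i < n" for i
          by (rule c0_smooth [OF smooth_into_subset [OF Q2_smooth S] _ that]) (auto simp: S_def)
      qed
      moreover have "(\<lambda>_. 0) \<in> {z \<in> S. c0 (Q2 z) \<in> {x \<in> esp n. nrm n (\<lambda>i. x i - 0) < \<epsilon>}}"
      proof -
        have "Q2 (\<lambda>_. 0) = \<one>" by (simp add: Q2_def fst_half_def snd_half_def j0_zero)
        moreover have "(\<lambda>_. 0) \<in> B2" using join_B2 [OF zero_B0 zero_B0] by (simp add: join_zero)
        ultimately show ?thesis using \<epsilon> chart_one(2) by (simp add: S_def c0_one)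
      qed
      ultimately obtain b where b: "b > 0" "\<And>z. z \<in> esp (n + n) \<Longrightarrow> nrm (n + n) (\<lambda>i. z i - 0) < b \<Longrightarrow>
          z \<in> {z \<in> S. c0 (Q2 z) \<in> {x \<in> esp n. nrm n (\<lambda>i. x i - 0) < \<epsilon>}}"
        by (rule openin_esp_ball) blast
      show ?thesis
      proof (intro exI[of _ "b / 2"] conjI ballI impI)
        fix x y assume h: "x \<in> esp n" "y \<in> esp n" "nrm n x < b / 2" "nrm n y < b / 2"
        have "nrm (n + n) (\<lambda>i. join n x y i - 0) = nrm n x + nrm n y"
          using nrm_join [of n x y "\<lambda>_. 0" "\<lambda>_. 0"] by (simp add: join_zero)
        then have "nrm n (c0 (Q2 (join n x y))) < \<epsilon>" using b(2) [OF join_esp [OF h(2)], of x] h by simp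
        then show "nrm n (q x y) < \<epsilon>" using h by (simp add: Q2_def half_join q_def)
      qed (use b in simp)
    qed
    show "\<exists>\<delta>>0. \<forall>x\<in>esp n. \<forall>y\<in>esp n. \<forall>x'\<in>esp n. \<forall>y'\<in>esp n.
        nrm n x < \<delta> \<longrightarrow> nrm n y < \<delta> \<longrightarrow> nrm n x' < \<delta> \<longrightarrow> nrm n y' < \<delta> \<longrightarrow>
        nrm n (\<lambda>i. m x y i - m x' y' i - (x i - x' i) - (y i - y' i)) \<le>
          \<epsilon> * (nrm n (\<lambda>i. x i - x' i) + nrm n (\<lambda>i. y i - y' i))"
      if \<epsilon>: "\<epsilon> > 0" for \<epsilon>
    proof -
      \<comment> \<open>The norm adds up \<open>n\<close> coordinate errors; \<open>n + 1\<close>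
        avoids division by 0.\<close>
      define \<eta> where "\<eta> = \<epsilon> / (real n + 1)"
      have \<eta>: "\<eta> > 0" "real n * \<eta> \<le> \<epsilon>" unfolding \<eta>_def using \<epsilon> by (auto simp: field_simps)
      have z: "(\<lambda>_. 0) \<in> S2" using S2 [of "\<lambda>_. 0" "\<lambda>_. 0"] r(1) by (simp add: join_zero)
      obtain a where a: "a > 0" "\<forall>i<n. \<forall>y\<in>esp (n + n). \<forall>z\<in>esp (n + n).
          nrm (n + n) (\<lambda>i. y i - 0) < a \<longrightarrow> nrm (n + n) (\<lambda>i. z i - 0) < a \<longrightarrow>
          \<bar>?f i y - ?f i z - (\<Sum>j<n + n. partial_deriv j (?f i) (\<lambda>_. 0) * (y j - z j))\<bar> \<le> \<eta> * nrm (n + n) (\<lambda>i. y i - z i)"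
        using strict [OF z \<eta>(1)] by (elim exE conjE) (rule that)
      show ?thesis
      proof (intro exI[of _ "min r (a / 2)"] conjI ballI impI)
        show "min r (a / 2) > 0" using r(1) a(1) by simp
        fix x y x' y' assume E: "x \<in> esp n" "y \<in> esp n" "x' \<in> esp n" "y' \<in> esp n"
          and s: "nrm n x < min r (a / 2)" "nrm n y < min r (a / 2)" "nrm n x' < min r (a / 2)" "nrm n y' < min r (a / 2)"
        have sm: "nrm (n + n) (\<lambda>i. join n x y i - 0) < a" "nrm (n + n) (\<lambda>i. join n x' y' i - 0) < a"
          using nrm_join [of n x y "\<lambda>_. 0" "\<lambda>_. 0"] nrm_join [of n x' y' "\<lambda>_. 0" "\<lambda>_. 0"] s by (simp_all add: join_zero)
        have "\<bar>m x y i - m x' y' i - (x i - x' i) - (y i - y' i)\<bar> \<le>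
            \<eta> * (nrm n (\<lambda>i. x i - x' i) + nrm n (\<lambda>i. y i - y' i))" if i: "i < n" for i
        proof -
          have "(\<Sum>j<n + n. partial_deriv j (?f i) (\<lambda>_. 0) * (join n x y j - join n x' y' j)) =
              (\<Sum>k<n. if i = k then x k - x' k else 0) + (\<Sum>k<n. if i = k then y k - y' k else 0)"
            unfolding sum_double
            by (intro arg_cong2 [where f = "(+)"] sum.cong) (auto simp: M2_deriv i join_def)
          also have "\<dots> = (x i - x' i) + (y i - y' i)" using i by simp
          finally have "(\<Sum>j<n + n. partial_deriv j (?f i) (\<lambda>_. 0) * (join n x y j - join n x' y' j)) = (x i - x' i) + (y i - y' i)" .
          then show ?thesis
            using a(2) [rule_format, OF i join_esp [OF E(2)] join_esp [OF E(4)] sm] fm E s unfolding nrm_join by (simp add: algebra_simps)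
        qed
        then have "nrm n (\<lambda>i. m x y i - m x' y' i - (x i - x' i) - (y i - y' i)) \<le>
            real n * (\<eta> * (nrm n (\<lambda>i. x i - x' i) + nrm n (\<lambda>i. y i - y' i)))"
          unfolding nrm_def [of n "\<lambda>i. m x y i - m x' y' i - (x i - x' i) - (y i - y' i)"]
          using sum_bounded_above [of "{..<n}" "\<lambda>i. \<bar>m x y i - m x' y' i - (x i - x' i) - (y i - y' i)\<bar>"] by simp
        also have "\<dots> \<le> \<epsilon> * (nrm n (\<lambda>i. x i - x' i) + nrm n (\<lambda>i. y i - y' i))"
          unfolding mult.assoc [symmetric] using \<eta>(2) by (rule mult_right_mono) simp
        finally show "nrm n (\<lambda>i. m x y i - m x' y' i - (x i - x' i) - (y i - y' i)) \<le>
            \<epsilon> * (nrm n (\<lambda>i. x i - x' i) + nrm n (\<lambda>i. y i - y' i))" .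
      qed
    qed
  qed
  obtain J e where Je: "J \<subseteq> {..<n}" "\<And>j. j \<in> J \<Longrightarrow> e j \<in> tangent"
    "\<And>j k. j \<in> J \<Longrightarrow> k \<in> J \<Longrightarrow> e j k = (if j = k then 1 else 0)"
    "\<And>v. v \<in> tangent \<Longrightarrow> v = (\<lambda>i. \<Sum>j\<in>J. v j * e j i)"
  proof (rule subspace_coordinates [of tangent n])
    show "tangent \<subseteq> esp n" using tangent_esp by blast
    show "(\<lambda>i. v i + w i) \<in> tangent" if "v \<in> tangent" "w \<in> tangent" for v w by (rule tangent_add [OF that])
    show "(\<lambda>i. c * v i) \<in> tangent" if "v \<in> tangent" for c v by (rule tangent_scale [OF that])
  qed (rule that)
  interpret local_subgroup_coordinates n m q L r J e
    by unfold_locales (fact Je)+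
  define d where "d = card J"
  obtain \<sigma> where \<sigma>: "bij_betw \<sigma> {..<d} J"
    using ex_bij_betw_nat_finite [OF finite_J] unfolding d_def lessThan_atLeast0 by blast
  \<comment> \<open>The derivative of the product in its second factor, at the point where that
    factor is the unit.\<close>
  define A' where "A' = (\<lambda>i k x. partial_deriv (n + k) (?f i) (join n x (\<lambda>_. 0)))"
  interpret local_lie_subgroup n m q L r J e A' \<sigma> d
  proof
    show "bij_betw \<sigma> {..<d} J" by fact
    show "A' i k (\<lambda>_. 0) = (if i = k then 1 else 0)" if "i < n" "k < n" for i k
      unfolding A'_def using M2_deriv(2) [OF that] by (simp add: join_zero)
    show "Ck_on l n {x \<in> esp n. nrm n x < r} (A' i k)" if "i < n" "k < n" for i k l
      unfolding A'_def
    proof (rule Ck_on_compose [OF nrm_ball_open S2_open, where f = "partial_deriv (n + k) (?f i)" and g = "\<lambda>x. join n x (\<lambda>_. 0)"])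
      show "Ck_on l (n + n) S2 (partial_deriv (n + k) (?f i))"
        by (rule Ck_on_partial_Ck [OF S2_smooth]) (use that in auto)
      show "Ck_on l n {x \<in> esp n. nrm n x < r} (\<lambda>x. join n x (\<lambda>_. 0) j)" if "j < n + n" for j
        by (rule join_smooth [OF _ _ that]) (intro Ck_on_coordinate Ck_on_const nrm_ball_open)+
      show "join n x (\<lambda>_. 0) \<in> S2" if "x \<in> {x \<in> esp n. nrm n x < r}" for x
        using that rB by (intro join_zero_S2) auto
    qed
    show "\<exists>\<delta>>0. \<forall>u\<in>esp n. nrm n u < \<delta> \<longrightarrow> (\<forall>i<n. \<bar>m x u i - x i - (\<Sum>k<n. A' i k x * u k)\<bar> \<le> \<epsilon> * nrm n u)"
      if x: "x \<in> esp n" "nrm n x < r" and \<epsilon>: "\<epsilon> > 0" for x \<epsilon>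
    proof -
      let ?z = "join n x (\<lambda>_. 0)"
      have z: "?z \<in> S2" by (rule join_zero_S2 [OF rB [OF x]])
      obtain a where a: "a > 0" "\<forall>i<n. \<forall>y\<in>esp (n + n). \<forall>z\<in>esp (n + n).
          nrm (n + n) (\<lambda>i. y i - ?z i) < a \<longrightarrow> nrm (n + n) (\<lambda>i. z i - ?z i) < a \<longrightarrow>
          \<bar>?f i y - ?f i z - (\<Sum>j<n + n. partial_deriv j (?f i) ?z * (y j - z j))\<bar> \<le> \<epsilon> * nrm (n + n) (\<lambda>i. y i - z i)"
        using strict [OF z \<epsilon>] by (elim exE conjE) (rule that)
      show ?thesis
      proof (intro exI[of _ "min a r"] conjI ballI impI allI)
        show "min a r > 0" using a r by simp
        fix u i assume u: "u \<in> esp n" "nrm n u < min a r" and i: "i < n"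
        have nj: "nrm (n + n) (\<lambda>i. join n x u i - ?z i) = nrm n u"
          unfolding nrm_join by simp
        have "(\<Sum>j<n + n. partial_deriv j (?f i) ?z * (join n x u j - ?z j)) = (\<Sum>k<n. A' i k x * u k)"
          unfolding sum_double by (simp add: join_def A'_def)
        moreover have "?f i ?z = x i" using M2_join [OF rB [OF x] zero_B0] m_right_zero [OF rB [OF x]] by simp
        moreover have "?f i (join n x u) = m x u i" by (rule fm) (use x u in auto)
        ultimately show "\<bar>m x u i - x i - (\<Sum>k<n. A' i k x * u k)\<bar> \<le> \<epsilon> * nrm n u"
          using a(2) [rule_format, OF i join_esp [OF u(1)] join_esp [OF esp_zero], of x x] u(2) a(1) unfolding nj by simp
      qed
    qed
  qed
  obtain \<rho> D \<Gamma> where \<rho>: "0 < \<rho>" "\<rho> \<le> R" and D: "openin (Euclidean_space d) D" "(\<lambda>_. 0) \<in> D"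
    and \<Gamma>: "\<And>w. w \<in> D \<Longrightarrow> \<Gamma> w \<in> L \<and> nrm n (\<Gamma> w) < \<rho> \<and> proj (\<Gamma> w) = w"
    and \<Gamma>_proj: "\<And>x. \<lbrakk>x \<in> L; nrm n x < \<rho>; proj x \<in> D\<rbrakk> \<Longrightarrow> \<Gamma> (proj x) = x"
    and \<Gamma>_smooth: "\<And>i k. i < n \<Longrightarrow> Ck_on k d D (\<lambda>w. \<Gamma> w i)"
  proof (rule graph)
    show "R > 0" using \<open>0 < r\<close> \<open>r \<le> R\<close> by simp
  qed (rule that)
  define O1 where "O1 = {x \<in> {x \<in> esp n. nrm n x < \<rho>}. proj x \<in> D}"
  have proj_coord: "proj x a = x (\<sigma> a)" if "a < d" for x a using that by (simp add: proj_def)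
  have O1: "openin (Euclidean_space n) O1"
    unfolding O1_def
  proof (rule Ck_preimage_open [OF nrm_ball_open D(1) proj_esp])
    show "Ck_on 0 n {x \<in> esp n. nrm n x < \<rho>} (\<lambda>x. proj x a)" if "a < d" for a
      unfolding proj_coord [OF that] by (rule Ck_on_coordinate [OF nrm_ball_open])
  qed
  define W where "W = N \<inter> {p \<in> U. c0 p \<in> O1}"
  have "openin (subtopology T U) {p \<in> topspace (subtopology T U). c0 p \<in> O1}"
    by (rule openin_continuous_map_preimage [OF c0_continuous O1])
  then have "openin T {p \<in> U. c0 p \<in> O1}"
    using openin_open_subtopology [OF chart_U(1)] openin_subset [OF chart_U(1)] by (simp add: Int_absorb1)
  then have W: "openin T W" unfolding W_def using N(1) by blast
  \<comment> \<open>\<open>W \<subseteq> N\<close> makes \<open>openin_TH_\<Lambda>2\<close>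
    applicable, so \<open>V\<close> is open in \<open>TH\<close>; the condition on \<open>O1\<close>
    selects the part of \<open>L\<close> that is the graph over \<open>D\<close>.\<close>
  define V where "V = \<Lambda>2 \<inter> W"
  have VI: "p \<in> V \<longleftrightarrow> p \<in> \<Lambda>2 \<and> p \<in> N \<and> nrm n (c0 p) < \<rho> \<and> proj (c0 p) \<in> D" for p
    unfolding V_def W_def O1_def using N(3) c0_esp by blast
  have VU: "p \<in> U" if "p \<in> V" for p using that N(3) by (auto simp: VI)
  have V_L: "c0 p \<in> L" if "p \<in> V" for p
    unfolding L_def using that VU [OF that] j0_c0 c0_esp \<rho>(2) by (simp add: VI)
  have \<Gamma>B: "\<Gamma> w \<in> B0" "j0 (\<Gamma> w) \<in> N" "j0 (\<Gamma> w) \<in> \<Lambda>2" if "w \<in> D" for w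
    using \<Gamma> [OF that] R unfolding L_def by auto
  \<comment> \<open>On a covered set \<open>TH\<close> and the topology of \<open>G\<close> agree,
    so continuity of the chart and of its inverse can be checked in \<open>G\<close>.\<close>
  have V_covered: "covered V" using covered_subset [OF covered_\<Lambda>2] V_def by blast
  have \<iota>_smooth: "smooth_into d D (\<lambda>w. j0 (\<Gamma> w))"
    by (rule smooth_into_compose [OF j0_smooth D(1) \<Gamma>B(1) \<Gamma>_smooth])
  have \<iota>V: "j0 (\<Gamma> w) \<in> V" if "w \<in> D" for w
    unfolding VI using \<Gamma>B [OF that] \<Gamma> [OF that] c0_j0 that by simp
  have homeo: "homeomorphic_maps (subtopology TH V) (subtopology (Euclidean_space d) D) (\<lambda>p. proj (c0 p)) (\<lambda>w. j0 (\<Gamma> w))"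
    unfolding homeomorphic_maps_def subtopology_TH_covered [OF V_covered]
  proof (intro conjI ballI)
    have "continuous_map (subtopology T V) (Euclidean_space n) c0"
      using c0_continuous VU continuous_map_from_subtopology_mono by blast
    then have "continuous_map (subtopology T V) euclideanreal (\<lambda>p. c0 p i)" for i
      using continuous_map_compose [OF _ continuous_coordinate [of n i]] by (fastforce simp: o_def)
    then have "continuous_map (subtopology T V) (Euclidean_space d) (\<lambda>p. proj (c0 p))"
      by (intro continuous_map_into_esp proj_esp) (simp add: proj_coord)
    then show "continuous_map (subtopology T V) (subtopology (Euclidean_space d) D) (\<lambda>p. proj (c0 p))"
      by (auto simp: continuous_map_in_subtopology VI)
    show "continuous_map (subtopology (Euclidean_space d) D) (subtopology T V) (\<lambda>w. j0 (\<Gamma> w))"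
      using smooth_into_continuous [OF \<iota>_smooth] \<iota>V by (auto simp: continuous_map_in_subtopology)
    show "j0 (\<Gamma> (proj (c0 p))) = p" if "p \<in> topspace (subtopology T V)" for p
    proof -
      have p: "p \<in> V" using that by simp
      then show ?thesis using \<Gamma>_proj [OF V_L [OF p]] j0_c0 [OF VU [OF p]] by (simp add: VI)
    qed
    show "proj (c0 (j0 (\<Gamma> w))) = w" if "w \<in> topspace (subtopology (Euclidean_space d) D)" for w
      using that \<Gamma> [of w] c0_j0 [OF \<Gamma>B(1), of w] by simp
  qed
  have "immersed_subgroup G T n A HG TH d V (\<lambda>p. proj (c0 p)) D (\<lambda>w. j0 (\<Gamma> w))"
  proof (intro immersed_subgroup.intro immersed_subgroup_axioms.intro)
    show "lie_structure G T n A" by (rule lie_structure_axioms)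
    show "topological_group HG TH" by (rule TH_topological_group)
    show "carrier HG \<subseteq> carrier G" using H_carrier by auto
    show "inv\<^bsub>HG\<^esub> x = inv x" if "x \<in> carrier HG" for x using that by (simp add: HG_inv)
    show "Hausdorff_space TH" by (rule TH_Hausdorff)
    show "openin TH V" unfolding V_def
      by (rule openin_TH_\<Lambda>2 [OF W]) (use N(4) in \<open>auto simp: W_def\<close>)
    have "proj (\<lambda>_. 0) = (\<lambda>_. 0)" by (simp add: proj_def)
    then show "\<one> \<in> V" unfolding VI using \<Lambda>2_one N(2) \<rho>(1) D(2) by (simp add: c0_one)
    \<comment> \<open>The new chart only selects coordinates of the chart \<open>c0\<close> of
      \<open>G\<close>, so it inherits its smoothness.\<close>
    show "Ck_on k m W (\<lambda>x. proj (c0 (F x)) i)"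
      if "smooth_into m W F" "\<And>x. x \<in> W \<Longrightarrow> F x \<in> V" "i < d" for m W F i k
      unfolding proj_coord [OF that(3)] using that VU \<sigma>_n by (intro c0_smooth) auto
  qed (use D \<iota>_smooth homeo in auto)
  then show ?thesis by (rule immersed_subgroup.lie_group_K)
qed

end

theorem theorem1p4:
  fixes G :: "('a, 'b) monoid_scheme" and TG :: "'a topology" and \<Lambda> :: "'a set"
  assumes "locally_compact_group G TG"
    and "approximate_subgroup G \<Lambda>"
    and "closedin TG \<Lambda>"
  shows "\<exists>(H :: 'a monoid) TH \<phi> \<Xi>.
           locally_compact_group H TH \<and>
           \<phi> \<in> hom H G \<and> continuous_map TH TG \<phi> \<and> inj_on \<phi> (carrier H) \<and>
           approximate_subgroup H \<Xi> \<and> openin TH \<Xi> \<and>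
           proper_map (subtopology TH {h \<in> carrier H. \<phi> h \<in> \<Lambda>}) TG \<phi> \<and>
           \<Lambda> \<subseteq> \<phi> ` \<Xi> \<and> \<phi> ` \<Xi> \<subseteq> \<Lambda> <#>\<^bsub>G\<^esub> \<Lambda> <#>\<^bsub>G\<^esub> \<Lambda> \<and>
           (lie_group G TG \<longrightarrow> lie_group H TH)"
proof -
  interpret closed_approximate_subgroup G TG \<Lambda>
    using assms by (intro closed_approximate_subgroup.intro closed_approximate_subgroup_axioms.intro)
  show ?thesis
  proof (intro exI conjI impI)
    show "locally_compact_group HG TH"
      using TH_topological_group TH_locally_compact TH_Hausdorff
      by (intro locally_compact_group.intro locally_compact_group_axioms.intro)
    \<comment> \<open>The homomorphism is the inclusion of the generated subgroup; only the topology
      is changed.\<close>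
    show "(\<lambda>x. x) \<in> hom HG G" using H_carrier by (auto simp: hom_def)
    show "continuous_map TH TG (\<lambda>x. x)" by (rule continuous_TH_T)
    show "inj_on (\<lambda>x. x) (carrier HG)" by (rule inj_on_id2)
    show "approximate_subgroup HG \<Xi>" by (rule \<Xi>_approximate_subgroup)
    show "openin TH \<Xi>" by (rule \<Xi>_open)
    have "{h \<in> carrier HG. h \<in> \<Lambda>} = \<Lambda>" using \<Lambda>_H by auto
    then show "proper_map (subtopology TH {h \<in> carrier HG. h \<in> \<Lambda>}) TG (\<lambda>x. x)" using TH_proper by simp
    show "\<Lambda> \<subseteq> (\<lambda>x. x) ` \<Xi>" using \<Lambda>_\<Xi> by simp
    show "(\<lambda>x. x) ` \<Xi> \<subseteq> \<Lambda> <#>\<^bsub>G\<^esub> \<Lambda> <#>\<^bsub>G\<^esub> \<Lambda>" using \<Xi>_\<Lambda>3 by simp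
    assume "lie_group G TG"
    then obtain n A where "lie_structure G TG n A"
      unfolding lie_structure_def lie_structure_axioms_def lie_group_def lie_group_axioms_def by blast
    then interpret lie_structure G TG n A .
    obtain U c where "(U, c) \<in> A" "\<one>\<^bsub>G\<^esub> \<in> U" using chart_at [OF one_closed] .
    then interpret closed_approximate_lie G TG \<Lambda> n A U c
      by unfold_locales
    show "lie_group HG TH" by (rule lie_group_HG)
  qed
qed

end
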